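(* For every real $C>1$ there exists a constant $\varepsilon>0$ such that for all sufficiently large positive integers $\ell$, \[R(\ell, C\ell)\geq \big(p_C^{-1/2}+\varepsilon\big)^\ell,\] where $p_C\in(0,1/2)$ is the unique solution of the equation $C=\frac{\log p_C}{\log(1-p_C)}$.
   Context: For positive integers $\ell,k$, the Ramsey number $R(\ell,k)$ is the smallest integer $n$ such that every red/blue colouring of the edges of the complete graph $K_n$ contains either a red copy of $K_\ell$ (all edges red) or a blue copy of $K_k$ (all edges blue). In the statement $C\ell$ is used as the second argument of $R$, as printed in the paper. *)

theory Defs
  imports Complex_Main
begin

text \<open>A red/blue colouring of the edges of the complete graph on vertex set {..<n}
  is a function on 2-element vertex sets; True means red, False means blue.\<close>

definition mono_clique :: "(nat set \<Rightarrow> bool) \<Rightarrow> bool \<Rightarrow> nat \<Rightarrow> nat \<Rightarrow> bool" where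
  "mono_clique c col n k \<longleftrightarrow>
     (\<exists>S. S \<subseteq> {..<n} \<and> card S = k \<and>
          (\<forall>x\<in>S. \<forall>y\<in>S. x \<noteq> y \<longrightarrow> c {x, y} = col))"

definition ramsey_prop :: "nat \<Rightarrow> nat \<Rightarrow> nat \<Rightarrow> bool" where
  "ramsey_prop l k n \<longleftrightarrow>
     (\<forall>c :: nat set \<Rightarrow> bool. mono_clique c True n l \<or> mono_clique c False n k)"

definition ramsey_number :: "nat \<Rightarrow> nat \<Rightarrow> nat" where
  "ramsey_number l k = (LEAST n. ramsey_prop l k n)"

end

theory Submission
  imports Defs "HOL-Probability.Probability" "HOL-Library.Ramsey" "HOL-Real_Asymp.Real_Asymp"
begin

text \<open>
  Attach to every vertex an independent standard Gaussian vector in \<open>d\<close> dimensions, conditioned on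
  having almost the expected norm, where \<open>d\<close> is a constant times the square of the clique size.
  With \<open>g = \<langle>x, y\<rangle> / sqrt d\<close>, colour the edge between \<open>x\<close> and \<open>y\<close> red with probability \<open>q (1 - t g)\<close>,
  clipped to the unit interval, for a small constant \<open>t\<close>. The three inner products along a triangle
  are positively correlated at third order, so that red cliques on \<open>l\<close> vertices become rarer and blue
  cliques more frequent than in the binomial random graph, each by a factor that is exponential in
  the square of \<open>l\<close>. The two exponents are in the ratio of the cubes of \<open>1 / p\<close> and \<open>C / (1 - p)\<close>.
  As \<open>C p\<^sup>2 < (1 - p)\<^sup>2\<close>, choosing \<open>q\<close> slightly larger than \<open>p\<close> turns this into a gain for both colours.

  The expected number of cliques is bounded by eliminating one vertex after the other. A red or blue edge has
  probability proportional to at most \<open>max 0 (1 + b g)\<close>, with \<open>b < 0\<close> for red and \<open>b > 0\<close> for blue; this is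
  dominated by a mixture of exponentials of quadratic polynomials in \<open>g\<close>. Integrating out a Gaussian vertex
  keeps the product in this class but moves the slope \<open>b\<close> to \<open>b + b\<^sup>2 / sqrt d\<close>, and the accumulated
  change of \<open>b\<^sup>2\<close> is the cubic term.
\<close>

section \<open>Elementary inequalities\<close>

lemma exp_minus_le_quadratic:
  fixes x :: real
  assumes "0 \<le> x"
  shows "exp (- x) \<le> 1 - x + x\<^sup>2 / 2"
proof -
  have "exp (- x) - (1 - x + x\<^sup>2 / 2) \<le> exp (- 0) - (1 - 0 + 0\<^sup>2 / 2)"
    using assms
  proof (rule DERIV_nonpos_imp_nonincreasing)
    fix y :: real
    have "((\<lambda>x. exp (- x) - (1 - x + x\<^sup>2 / 2)) has_real_derivative (- exp (- y) - (- 1 + y))) (at y)"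
      by (auto intro!: derivative_eq_intros)
    moreover have "- exp (- y) - (- 1 + y) \<le> 0"
      using exp_ge_add_one_self[of "- y"] by simp
    ultimately show "\<exists>z. ((\<lambda>x. exp (- x) - (1 - x + x\<^sup>2 / 2)) has_real_derivative z) (at y) \<and> z \<le> 0"
      by blast
  qed
  then show ?thesis by simp
qed

lemma ln_one_plus_ge_quadratic:
  fixes x :: real
  assumes "0 \<le> x"
  shows "x - x\<^sup>2 \<le> ln (1 + x)"
proof (cases "x \<le> 1")
  case True
  then show ?thesis using assms by (intro ln_one_plus_pos_lower_bound)
next
  case False
  then have "x * (1 - x) \<le> 0" by (intro mult_nonneg_nonpos) auto
  also have "0 \<le> ln (1 + x)" using assms by simp
  finally show ?thesis by (simp add: power2_eq_square algebra_simps)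
qed

lemma ln_one_plus_le_cubic:
  fixes u :: real
  assumes "- 1 < u"
  shows "ln (1 + u) \<le> u - u\<^sup>2 / 2 + u ^ 3 / 3"
proof -
  define f where "f = (\<lambda>u::real. u - u\<^sup>2 / 2 + u ^ 3 / 3 - ln (1 + u))"
  have f_deriv: "(f has_real_derivative (x ^ 3 / (1 + x))) (at x)" if "- 1 < x" for x
    unfolding f_def using that
    by (auto intro!: derivative_eq_intros simp: field_simps power2_eq_square power3_eq_cube)
  have "f 0 \<le> f u"
  proof (cases "0 \<le> u")
    case True
    then show ?thesis
    proof (rule DERIV_nonneg_imp_nondecreasing)
      fix x :: real assume "0 \<le> x"
      then show "\<exists>y. (f has_real_derivative y) (at x) \<and> 0 \<le> y"
        by (intro exI[of _ "x ^ 3 / (1 + x)"]) (auto intro!: f_deriv)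
    qed
  next
    case False
    then have "u \<le> 0" by simp
    then show ?thesis
    proof (rule DERIV_nonpos_imp_nonincreasing)
      fix x :: real assume "u \<le> x" "x \<le> 0"
      then have "- 1 < x" "x ^ 3 \<le> 0"
        using assms by (auto simp: power_le_zero_eq)
      then show "\<exists>y. (f has_real_derivative y) (at x) \<and> y \<le> 0"
        by (intro exI[of _ "x ^ 3 / (1 + x)"]) (auto intro!: f_deriv divide_nonpos_pos)
    qed
  qed
  then show ?thesis by (simp add: f_def)
qed

section \<open>Gaussian integrals\<close>

definition std_gauss :: "real measure" where
  "std_gauss = density lborel std_normal_density"

lemma prob_space_std_gauss: "prob_space std_gauss"
  unfolding std_gauss_def by (rule prob_space_normal_density) simp

lemma sets_std_gauss [measurable_cong, simp]: "sets std_gauss = sets borel"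
  by (simp add: std_gauss_def)

lemma space_std_gauss [simp]: "space std_gauss = UNIV"
  by (simp add: std_gauss_def)

lemma std_normal_density_times_exp_quadratic:
  assumes "- 1/2 < q"
  shows "std_normal_density x * exp (b * x - q * x\<^sup>2)
    = exp (b\<^sup>2 / (2 * (1 + 2 * q))) / sqrt (1 + 2 * q) * normal_density (b / (1 + 2 * q)) (1 / sqrt (1 + 2 * q)) x"
proof -
  define D where "D = 1 + 2 * q"
  have "0 < D" using assms by (simp add: D_def)
  have "q = (D - 1) / 2" by (simp add: D_def)
  have "- x\<^sup>2 / 2 + (b * x - q * x\<^sup>2) = b\<^sup>2 / (2 * D) + - (x - b / D)\<^sup>2 / (2 * (1 / sqrt D)\<^sup>2)"
    using \<open>0 < D\<close>
    unfolding \<open>q = (D - 1) / 2\<close> by (simp add: power_divide power2_eq_square field_simps)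
  then have complete_square: "exp (- x\<^sup>2 / 2) * exp (b * x - q * x\<^sup>2)
      = exp (b\<^sup>2 / (2 * D)) * exp (- (x - b / D)\<^sup>2 / (2 * (1 / sqrt D)\<^sup>2))"
    by (simp only: exp_add [symmetric])
  have "sqrt (2 * pi * (1 / sqrt D)\<^sup>2) = sqrt (2 * pi) / sqrt D"
    using \<open>0 < D\<close> by (simp add: power_divide real_sqrt_divide)
  then have "normal_density (b / D) (1 / sqrt D) x
      = sqrt D / sqrt (2 * pi) * exp (- (x - b / D)\<^sup>2 / (2 * (1 / sqrt D)\<^sup>2))"
    by (simp add: normal_density_def)
  moreover have "std_normal_density x * exp (b * x - q * x\<^sup>2)
      = 1 / sqrt (2 * pi) * (exp (- x\<^sup>2 / 2) * exp (b * x - q * x\<^sup>2))"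
    by (simp add: std_normal_density_def)
  ultimately show ?thesis
    using \<open>0 < D\<close> unfolding complete_square D_def[symmetric] by simp
qed

lemma nn_integral_std_gauss_exp_quadratic:
  assumes "- 1/2 < q"
  shows "(\<integral>\<^sup>+x. ennreal (exp (b * x - q * x\<^sup>2)) \<partial>std_gauss)
    = ennreal (exp (b\<^sup>2 / (2 * (1 + 2 * q)) - ln (1 + 2 * q) / 2))"
proof -
  define D where "D = 1 + 2 * q"
  define c where "c = exp (b\<^sup>2 / (2 * D)) / sqrt D"
  have "0 < D" using assms by (simp add: D_def)
  interpret normal: prob_space "density lborel (normal_density (b / D) (1 / sqrt D))"
    using \<open>0 < D\<close> by (intro prob_space_normal_density) auto
  have "(\<integral>\<^sup>+x. ennreal (exp (b * x - q * x\<^sup>2)) \<partial>std_gauss)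
      = (\<integral>\<^sup>+x. ennreal (std_normal_density x * exp (b * x - q * x\<^sup>2)) \<partial>lborel)"
    unfolding std_gauss_def by (subst nn_integral_density) (auto simp: ennreal_mult')
  also have "\<dots> = (\<integral>\<^sup>+x. ennreal c * ennreal (normal_density (b / D) (1 / sqrt D) x) \<partial>lborel)"
    unfolding std_normal_density_times_exp_quadratic[OF assms] c_def D_def[symmetric]
    using \<open>0 < D\<close> by (simp add: ennreal_mult'[symmetric])
  also have "\<dots> = ennreal c"
    using normal.emeasure_space_1 by (subst nn_integral_cmult) (auto simp: emeasure_density)
  also have "c = exp (b\<^sup>2 / (2 * D) - ln D / 2)"
    using \<open>0 < D\<close> by (simp add: c_def exp_diff flip: ln_sqrt)
  finally show ?thesis by (simp add: D_def)
qed

section \<open>Gaussian integrals of quadratic forms\<close>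

definition quad_form :: "'i set \<Rightarrow> ('i \<Rightarrow> 'i \<Rightarrow> real) \<Rightarrow> ('i \<Rightarrow> real) \<Rightarrow> real" where
  "quad_form I Q x = (\<Sum>i\<in>I. \<Sum>j\<in>I. Q i j * x i * x j)"

text \<open>The form left after the variable \<open>i\<close> has been integrated out against a standard Gaussian.\<close>

definition marginal_form :: "'i \<Rightarrow> ('i \<Rightarrow> 'i \<Rightarrow> real) \<Rightarrow> 'i \<Rightarrow> 'i \<Rightarrow> real" where
  "marginal_form i Q j k = Q j k - 2 * Q i j * Q i k / (1 + 2 * Q i i)"

lemma quad_form_cong: "(\<And>i. i \<in> I \<Longrightarrow> x i = y i) \<Longrightarrow> quad_form I Q x = quad_form I Q y"
  unfolding quad_form_def by (intro sum.cong) auto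

lemma quad_form_insert:
  assumes "finite I" "i \<notin> I" "\<forall>j\<in>I. Q j i = Q i j"
  shows "quad_form (insert i I) Q x = Q i i * (x i)\<^sup>2 + 2 * x i * (\<Sum>j\<in>I. Q i j * x j) + quad_form I Q x"
proof -
  have "(\<Sum>j\<in>I. Q j i * x j * x i) = x i * (\<Sum>j\<in>I. Q i j * x j)"
    unfolding sum_distrib_left using assms(3) by (intro sum.cong) (auto simp: mult_ac)
  moreover have "(\<Sum>j\<in>I. Q i j * x i * x j) = x i * (\<Sum>j\<in>I. Q i j * x j)"
    by (simp add: sum_distrib_left mult_ac)
  ultimately show ?thesis
    using assms(1,2) by (simp add: quad_form_def sum.distrib power2_eq_square algebra_simps)
qed

lemma sum_fun_upd_notin:
  assumes "i \<notin> I"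
  shows "(\<Sum>j\<in>I. f j ((x(i := y)) j)) = (\<Sum>j\<in>I. f j (x j))"
  using assms by (intro sum.cong) auto

lemma quad_form_insert_upd:
  assumes "finite I" "i \<notin> I" "\<forall>j\<in>I. Q j i = Q i j"
  shows "quad_form (insert i I) Q (x(i := y)) = Q i i * y\<^sup>2 + 2 * y * (\<Sum>j\<in>I. Q i j * x j) + quad_form I Q x"
proof -
  have "quad_form I Q (x(i := y)) = quad_form I Q x"
    using assms(2) by (intro quad_form_cong) auto
  moreover have "(\<Sum>j\<in>I. Q i j * (x(i := y)) j) = (\<Sum>j\<in>I. Q i j * x j)"
    by (rule sum_fun_upd_notin[OF assms(2), of "\<lambda>j z. Q i j * z"])
  ultimately show ?thesis unfolding quad_form_insert[OF assms] by simp
qed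

lemma quad_form_marginal:
  "quad_form I (marginal_form i Q) x = quad_form I Q x - 2 * (\<Sum>j\<in>I. Q i j * x j)\<^sup>2 / (1 + 2 * Q i i)"
proof -
  have "quad_form I (marginal_form i Q) x
      = quad_form I Q x - (\<Sum>j\<in>I. \<Sum>k\<in>I. 2 / (1 + 2 * Q i i) * ((Q i j * x j) * (Q i k * x k)))"
    by (simp add: quad_form_def marginal_form_def sum_subtractf algebra_simps)
  also have "(\<Sum>j\<in>I. \<Sum>k\<in>I. 2 / (1 + 2 * Q i i) * ((Q i j * x j) * (Q i k * x k)))
      = 2 / (1 + 2 * Q i i) * (\<Sum>j\<in>I. Q i j * x j)\<^sup>2"
    by (simp only: power2_eq_square sum_product sum_distrib_left [symmetric])
  finally show ?thesis by simp
qed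

definition marginal_slope :: "'i \<Rightarrow> ('i \<Rightarrow> real) \<Rightarrow> ('i \<Rightarrow> 'i \<Rightarrow> real) \<Rightarrow> 'i \<Rightarrow> real" where
  "marginal_slope i b Q j = b j - 2 * b i * Q i j / (1 + 2 * Q i i)"

definition gauss_exponent :: "'i set \<Rightarrow> ('i \<Rightarrow> real) \<Rightarrow> ('i \<Rightarrow> 'i \<Rightarrow> real) \<Rightarrow> ('i \<Rightarrow> real) \<Rightarrow> real" where
  "gauss_exponent I b Q x = (\<Sum>i\<in>I. b i * x i) - quad_form I Q x"

lemma gauss_exponent_insert_upd:
  assumes "finite I" "i \<notin> I" "\<forall>j\<in>I. Q j i = Q i j"
  shows "gauss_exponent (insert i I) b Q (x(i := y))
    = (b i - 2 * (\<Sum>j\<in>I. Q i j * x j)) * y - Q i i * y\<^sup>2 + gauss_exponent I b Q x"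
  using assms(1,2) sum_fun_upd_notin[OF assms(2), of "\<lambda>j z. b j * z"]
  unfolding gauss_exponent_def quad_form_insert_upd[OF assms] by (simp add: algebra_simps)

lemma gauss_exponent_marginal:
  assumes "0 \<le> Q i i"
  shows "gauss_exponent I (marginal_slope i b Q) (marginal_form i Q) x
    = gauss_exponent I b Q x + (b i - 2 * (\<Sum>j\<in>I. Q i j * x j))\<^sup>2 / (2 * (1 + 2 * Q i i))
      - (b i)\<^sup>2 / (2 * (1 + 2 * Q i i))"
proof -
  define D where "D = 1 + 2 * Q i i"
  define r where "r = (\<Sum>j\<in>I. Q i j * x j)"
  have "0 < D" using assms by (simp add: D_def)
  have "(\<Sum>j\<in>I. marginal_slope i b Q j * x j) = (\<Sum>j\<in>I. b j * x j) - 2 * b i * r / D"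
    by (simp add: marginal_slope_def D_def r_def algebra_simps sum_subtractf sum_distrib_left sum_divide_distrib)
  moreover have "(b i - 2 * r)\<^sup>2 / (2 * D) - (b i)\<^sup>2 / (2 * D) = 2 * r\<^sup>2 / D - 2 * b i * r / D"
    using \<open>0 < D\<close> by (simp add: power2_eq_square field_simps)
  ultimately show ?thesis
    unfolding gauss_exponent_def quad_form_marginal D_def[symmetric] r_def[symmetric] by simp
qed

locale gauss_elimination =
  fixes I :: "'i set" and i :: 'i and Q :: "'i \<Rightarrow> 'i \<Rightarrow> real"
  assumes finite_rest: "finite I" and notin_rest: "i \<notin> I"
    and symmetric: "\<And>j k. j \<in> insert i I \<Longrightarrow> k \<in> insert i I \<Longrightarrow> Q j k = Q k j"
    and psd: "\<And>x. 0 \<le> quad_form (insert i I) Q x"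
begin

lemma row_eq_column: "\<forall>j\<in>I. Q j i = Q i j"
  by (simp add: symmetric)

lemmas quad_form_upd = quad_form_insert_upd[OF finite_rest notin_rest row_eq_column]
lemmas gauss_exponent_upd = gauss_exponent_insert_upd[OF finite_rest notin_rest row_eq_column]

lemma pivot_nonneg: "0 \<le> Q i i"
  using psd[of "(\<lambda>_. 0)(i := 1)"]
  unfolding quad_form_upd by (simp add: quad_form_def cong: sum.cong)

lemma psd_rest: "0 \<le> quad_form I Q x"
  using psd[of "x(i := 0)"] unfolding quad_form_upd by simp

lemma psd_marginal: "0 \<le> quad_form I (marginal_form i Q) x"
proof -
  define D where "D = 1 + 2 * Q i i"
  define r where "r = (\<Sum>j\<in>I. Q i j * x j)"
  define y where "y = - 2 * r / D"
  have "0 < D" using pivot_nonneg by (simp add: D_def)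
  have "0 \<le> Q i i * y\<^sup>2 + 2 * y * r + quad_form I Q x"
    using psd[of "x(i := y)"] unfolding quad_form_upd r_def .
  also have "\<dots> \<le> D / 2 * y\<^sup>2 + 2 * y * r + quad_form I Q x"
    by (simp add: D_def algebra_simps add_divide_distrib)
  also have "\<dots> = quad_form I (marginal_form i Q) x"
    using \<open>0 < D\<close> unfolding quad_form_marginal D_def[symmetric] r_def[symmetric] y_def
    by (simp add: power2_eq_square field_simps)
  finally show ?thesis .
qed

lemma frobenius_marginal_le:
  "(\<Sum>j\<in>I. \<Sum>k\<in>I. (marginal_form i Q j k)\<^sup>2) \<le> (\<Sum>j\<in>I. \<Sum>k\<in>I. (Q j k)\<^sup>2)"
proof -
  define D where "D = 1 + 2 * Q i i"
  let ?M = "marginal_form i Q"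
  have "(\<Sum>j\<in>I. \<Sum>k\<in>I. (Q j k)\<^sup>2) - (\<Sum>j\<in>I. \<Sum>k\<in>I. (?M j k)\<^sup>2)
      = (\<Sum>j\<in>I. \<Sum>k\<in>I. 2 / D * (Q j k * Q i j * Q i k + ?M j k * Q i j * Q i k))"
    unfolding sum_subtractf[symmetric] D_def marginal_form_def
    by (intro sum.cong refl) (simp add: power2_eq_square algebra_simps)
  also have "\<dots> = 2 / D * (quad_form I Q (Q i) + quad_form I ?M (Q i))"
    by (simp only: quad_form_def sum_distrib_left sum.distrib distrib_left)
  also have "\<dots> \<ge> 0"
    using pivot_nonneg psd_rest psd_marginal by (simp add: D_def)
  finally show ?thesis by simp
qed

lemma trace_frobenius_marginal_le:
  "- ln (1 + 2 * Q i i) / 2 - (\<Sum>j\<in>I. marginal_form i Q j j) + 2 * (\<Sum>j\<in>I. \<Sum>k\<in>I. (marginal_form i Q j k)\<^sup>2)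
    \<le> 2 * (\<Sum>j\<in>insert i I. \<Sum>k\<in>insert i I. (Q j k)\<^sup>2) - (\<Sum>j\<in>insert i I. Q j j)"
proof -
  define D where "D = 1 + 2 * Q i i"
  define V where "V = (\<Sum>j\<in>I. (Q i j)\<^sup>2)"
  have "1 \<le> D" using pivot_nonneg by (simp add: D_def)
  have "0 \<le> V" by (simp add: V_def sum_nonneg)
  have "(\<Sum>j\<in>I. marginal_form i Q j j) = (\<Sum>j\<in>I. Q j j) - 2 * V / D"
    by (simp add: marginal_form_def V_def D_def sum_subtractf sum_distrib_left sum_divide_distrib power2_eq_square mult_ac)
  moreover have "V / D \<le> V"
    using \<open>1 \<le> D\<close> \<open>0 \<le> V\<close> by (simp add: divide_le_eq mult_le_cancel_left1)
  moreover have "(\<Sum>j\<in>insert i I. \<Sum>k\<in>insert i I. (Q j k)\<^sup>2) = (Q i i)\<^sup>2 + 2 * V + (\<Sum>j\<in>I. \<Sum>k\<in>I. (Q j k)\<^sup>2)"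
    using finite_rest notin_rest by (simp add: sum.distrib row_eq_column V_def cong: sum.cong)
  moreover have "(\<Sum>j\<in>insert i I. Q j j) = Q i i + (\<Sum>j\<in>I. Q j j)"
    using finite_rest notin_rest by simp
  moreover have "2 * Q i i - (2 * Q i i)\<^sup>2 \<le> ln D"
    unfolding D_def using pivot_nonneg by (intro ln_one_plus_ge_quadratic) simp
  ultimately show ?thesis
    using frobenius_marginal_le \<open>0 \<le> V\<close> unfolding D_def[symmetric] by (simp add: power_mult_distrib)
qed

lemma exponent_marginal_le:
  assumes "\<And>x. gauss_exponent (insert i I) b Q x - (\<Sum>j\<in>insert i I. (x j)\<^sup>2) / 2 \<le> K"
  shows "gauss_exponent I (marginal_slope i b Q) (marginal_form i Q) x - (\<Sum>j\<in>I. (x j)\<^sup>2) / 2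
    \<le> K - (b i)\<^sup>2 / (2 * (1 + 2 * Q i i))"
proof -
  define D where "D = 1 + 2 * Q i i"
  define r where "r = b i - 2 * (\<Sum>j\<in>I. Q i j * x j)"
  define y where "y = r / D"
  have "0 < D" using pivot_nonneg by (simp add: D_def)
  have "(\<Sum>j\<in>insert i I. ((x(i := y)) j)\<^sup>2) = y\<^sup>2 + (\<Sum>j\<in>I. (x j)\<^sup>2)"
    using finite_rest notin_rest sum_fun_upd_notin[OF notin_rest, of "\<lambda>j z. z\<^sup>2"] by simp
  then have "r * y - Q i i * y\<^sup>2 + gauss_exponent I b Q x - (y\<^sup>2 + (\<Sum>j\<in>I. (x j)\<^sup>2)) / 2 \<le> K"
    using assms[of "x(i := y)"] gauss_exponent_upd
    by (simp add: r_def)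
  moreover have "r * y - Q i i * y\<^sup>2 - y\<^sup>2 / 2 = r * y - D / 2 * y\<^sup>2"
    by (simp add: D_def algebra_simps add_divide_distrib)
  moreover have "r * y - D / 2 * y\<^sup>2 = r\<^sup>2 / (2 * D)"
    using \<open>0 < D\<close> by (simp add: y_def power2_eq_square)
  ultimately show ?thesis
    unfolding gauss_exponent_marginal[where b = b and Q = Q, OF pivot_nonneg] D_def[symmetric] r_def[symmetric]
    by (simp add: add_divide_distrib)
qed

lemma nn_integral_eliminate_variable:
  "(\<integral>\<^sup>+y. ennreal (exp (gauss_exponent (insert i I) b Q (x(i := y)))) \<partial>std_gauss)
    = ennreal (exp ((b i)\<^sup>2 / (2 * (1 + 2 * Q i i)) - ln (1 + 2 * Q i i) / 2))
      * ennreal (exp (gauss_exponent I (marginal_slope i b Q) (marginal_form i Q) x))"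
proof -
  define D where "D = 1 + 2 * Q i i"
  define r where "r = b i - 2 * (\<Sum>j\<in>I. Q i j * x j)"
  have "(\<integral>\<^sup>+y. ennreal (exp (gauss_exponent (insert i I) b Q (x(i := y)))) \<partial>std_gauss)
      = (\<integral>\<^sup>+y. ennreal (exp (gauss_exponent I b Q x)) * ennreal (exp (r * y - Q i i * y\<^sup>2)) \<partial>std_gauss)"
    unfolding gauss_exponent_upd r_def
    by (simp add: exp_add mult.commute flip: ennreal_mult')
  also have "\<dots> = ennreal (exp (gauss_exponent I b Q x)) * ennreal (exp (r\<^sup>2 / (2 * D) - ln D / 2))"
    using pivot_nonneg by (simp add: nn_integral_cmult nn_integral_std_gauss_exp_quadratic D_def)
  also have "\<dots> = ennreal (exp (gauss_exponent I b Q x + r\<^sup>2 / (2 * D) - ln D / 2))"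
    by (simp add: ennreal_mult'[symmetric] exp_add[symmetric] add_diff_eq)
  also have "gauss_exponent I b Q x + r\<^sup>2 / (2 * D) - ln D / 2
      = ((b i)\<^sup>2 / (2 * D) - ln D / 2) + gauss_exponent I (marginal_slope i b Q) (marginal_form i Q) x"
    unfolding gauss_exponent_marginal[where b = b and Q = Q, OF pivot_nonneg] D_def r_def by simp
  finally show ?thesis unfolding D_def exp_add by (simp only: ennreal_mult' exp_ge_zero)
qed

end

lemma gauss_exponent_measurable [measurable]:
  "gauss_exponent I b Q \<in> borel_measurable (Pi\<^sub>M I (\<lambda>_. std_gauss))"
  unfolding gauss_exponent_def quad_form_def by measurable

text \<open>
  The hypothesis on \<open>K\<close> bounds the supremum of the exponent together with the Gaussian weight. Unlike
  the closed form of this supremum, which involves the inverse of \<open>1 + 2 Q\<close>, it passes directly to the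
  remaining variables when one variable is integrated out.
\<close>

lemma nn_integral_gauss_exponent_le:
  fixes Q :: "'i \<Rightarrow> 'i \<Rightarrow> real"
  assumes "finite I"
    and "\<And>i j. i \<in> I \<Longrightarrow> j \<in> I \<Longrightarrow> Q i j = Q j i"
    and "\<And>x. 0 \<le> quad_form I Q x"
    and "\<And>x. gauss_exponent I b Q x - (\<Sum>i\<in>I. (x i)\<^sup>2) / 2 \<le> K"
  shows "(\<integral>\<^sup>+x. ennreal (exp (gauss_exponent I b Q x)) \<partial>Pi\<^sub>M I (\<lambda>_. std_gauss))
    \<le> ennreal (exp (K + (2 * (\<Sum>i\<in>I. \<Sum>j\<in>I. (Q i j)\<^sup>2) - (\<Sum>i\<in>I. Q i i))))"
  using assms
proof (induction I arbitrary: b Q K rule: finite_induct)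
  case empty
  interpret prob_space "Pi\<^sub>M {} (\<lambda>_::'i. std_gauss)"
    by (intro prob_space_PiM prob_space_std_gauss)
  have "0 \<le> K"
    using empty(3) by (simp add: gauss_exponent_def quad_form_def)
  then show ?case
    using emeasure_space_1 ennreal_leI[of 1 "exp K"] by (simp add: gauss_exponent_def quad_form_def)
next
  case (insert i I)
  interpret std: prob_space std_gauss by (rule prob_space_std_gauss)
  interpret product_sigma_finite "\<lambda>_::'i. std_gauss" ..
  interpret gauss_elimination I i Q
    using insert.hyps insert.prems by unfold_locales auto
  define c where "c = (b i)\<^sup>2 / (2 * (1 + 2 * Q i i))"
  define \<delta> where "\<delta> = ln (1 + 2 * Q i i) / 2"
  let ?b = "marginal_slope i b Q" and ?Q = "marginal_form i Q"
  have "(\<integral>\<^sup>+x. ennreal (exp (gauss_exponent (insert i I) b Q x)) \<partial>Pi\<^sub>M (insert i I) (\<lambda>_. std_gauss))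
      = (\<integral>\<^sup>+x. ennreal (exp (c - \<delta>)) * ennreal (exp (gauss_exponent I ?b ?Q x)) \<partial>Pi\<^sub>M I (\<lambda>_. std_gauss))"
    unfolding c_def \<delta>_def nn_integral_eliminate_variable[symmetric]
    by (rule product_nn_integral_insert[OF insert.hyps]) measurable
  also have "\<dots> = ennreal (exp (c - \<delta>)) * (\<integral>\<^sup>+x. ennreal (exp (gauss_exponent I ?b ?Q x)) \<partial>Pi\<^sub>M I (\<lambda>_. std_gauss))"
    by (rule nn_integral_cmult) measurable
  also have "\<dots> \<le> ennreal (exp (c - \<delta>))
      * ennreal (exp (K - c + (2 * (\<Sum>j\<in>I. \<Sum>k\<in>I. (?Q j k)\<^sup>2) - (\<Sum>j\<in>I. ?Q j j))))"
  proof (intro mult_left_mono insert.IH)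
    show "?Q j k = ?Q k j" if "j \<in> I" "k \<in> I" for j k
      using that symmetric[of j k] by (simp add: marginal_form_def)
    show "gauss_exponent I ?b ?Q x - (\<Sum>j\<in>I. (x j)\<^sup>2) / 2 \<le> K - c" for x
      unfolding c_def by (rule exponent_marginal_le[OF insert.prems(3)])
  qed (simp_all add: psd_marginal)
  also have "\<dots> = ennreal (exp (K - \<delta> + (2 * (\<Sum>j\<in>I. \<Sum>k\<in>I. (?Q j k)\<^sup>2) - (\<Sum>j\<in>I. ?Q j j))))"
    by (simp add: ennreal_mult'[symmetric] exp_add[symmetric])
  also have "\<dots> \<le> ennreal (exp (K + (2 * (\<Sum>j\<in>insert i I. \<Sum>k\<in>insert i I. (Q j k)\<^sup>2) - (\<Sum>j\<in>insert i I. Q j j))))"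
    using trace_frobenius_marginal_le unfolding \<delta>_def by (intro ennreal_leI) simp
  finally show ?case .
qed

section \<open>Pairs of vertices\<close>

definition pairs :: "'a::linorder set \<Rightarrow> ('a \<times> 'a) set" where
  "pairs S = {(i, j). i \<in> S \<and> j \<in> S \<and> i < j}"

lemma finite_pairs [simp]: "finite S \<Longrightarrow> finite (pairs S)"
  by (rule finite_subset[of _ "S \<times> S"]) (auto simp: pairs_def)

lemma pairs_empty [simp]: "pairs {} = {}"
  by (simp add: pairs_def)

lemma pairs_mono: "S \<subseteq> T \<Longrightarrow> pairs S \<subseteq> pairs T"
  by (auto simp: pairs_def)

lemma pairs_insert_max:
  assumes "\<forall>i\<in>S. i < m"
  shows "pairs (insert m S) = pairs S \<union> (\<lambda>i. (i, m)) ` S"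
  using assms by (force simp: pairs_def)

lemma sum_pairs_insert_max:
  assumes "finite S" "\<forall>i\<in>S. i < m"
  shows "(\<Sum>(i,j)\<in>pairs (insert m S). f i j) = (\<Sum>(i,j)\<in>pairs S. f i j) + (\<Sum>i\<in>S. f i m)"
proof -
  have "pairs S \<inter> (\<lambda>i. (i, m)) ` S = {}"
    using assms by (force simp: pairs_def)
  then show ?thesis
    using assms(1) unfolding pairs_insert_max[OF assms(2)]
    by (simp add: sum.union_disjoint sum.reindex inj_on_def)
qed

lemma sum_symmetric_pairs:
  fixes f :: "'a::linorder \<Rightarrow> 'a \<Rightarrow> real"
  assumes "finite S" "\<And>i j. i \<in> S \<Longrightarrow> j \<in> S \<Longrightarrow> f i j = f j i"
  shows "(\<Sum>i\<in>S. \<Sum>j\<in>S. f i j) = (\<Sum>i\<in>S. f i i) + 2 * (\<Sum>(i,j)\<in>pairs S. f i j)"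
  using assms
proof (induction S rule: finite_linorder_max_induct)
  case (insert m S)
  have "m \<notin> S" using insert.hyps by auto
  moreover have "(\<Sum>i\<in>S. f m i) = (\<Sum>i\<in>S. f i m)"
    using insert.prems by (intro sum.cong) auto
  ultimately show ?case
    using insert by (simp add: sum.distrib sum_pairs_insert_max)
qed simp

lemma card_pairs:
  assumes "finite S"
  shows "card (pairs S) = card S choose 2"
  using assms
proof (induction S rule: finite_linorder_max_induct)
  case (insert m S)
  have "m \<notin> S" using insert.hyps by auto
  then show ?case
    using insert.IH insert.hyps sum_pairs_insert_max[OF insert.hyps, of "\<lambda>_ _. 1::nat"]
    by (simp add: case_prod_beta numeral_2_eq_2)
qed simp

lemma real_choose_two: "real (k choose 2) = real k * (real k - 1) / 2"
  by (induction k) (auto simp: numeral_2_eq_2 field_simps)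

section \<open>Gaussian vectors of almost constant norm\<close>

definition gauss_vec :: "nat \<Rightarrow> (nat \<Rightarrow> real) measure" where
  "gauss_vec d = Pi\<^sub>M {..<d} (\<lambda>_. std_gauss)"

definition dot :: "nat \<Rightarrow> (nat \<Rightarrow> real) \<Rightarrow> (nat \<Rightarrow> real) \<Rightarrow> real" where
  "dot d x y = (\<Sum>m<d. x m * y m)"

definition gram_form :: "'j set \<Rightarrow> ('j \<Rightarrow> real) \<Rightarrow> ('j \<Rightarrow> nat \<Rightarrow> real) \<Rightarrow> nat \<Rightarrow> nat \<Rightarrow> real" where
  "gram_form S w x m n = (\<Sum>j\<in>S. w j * x j m * x j n)"

lemma prob_space_gauss_vec: "prob_space (gauss_vec d)"
  unfolding gauss_vec_def by (intro prob_space_PiM prob_space_std_gauss)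

lemma dot_commute: "dot d x y = dot d y x"
  by (simp add: dot_def mult.commute)

lemma dot_self_nonneg: "0 \<le> dot d x x"
  by (simp add: dot_def sum_nonneg)

lemma dot_Cauchy_Schwarz: "(dot d x y)\<^sup>2 \<le> dot d x x * dot d y y"
  using Cauchy_Schwarz_ineq_sum[of x y "{..<d}"] by (simp add: dot_def power2_eq_square)

lemma dot_sum_left: "dot d (\<lambda>m. \<Sum>j\<in>S. a j * x j m) y = (\<Sum>j\<in>S. a j * dot d (x j) y)"
  unfolding dot_def sum_distrib_right sum_distrib_left mult.assoc by (rule sum.swap)

lemma dot_measurable [measurable]: "dot d x \<in> borel_measurable (gauss_vec d)"
  unfolding dot_def gauss_vec_def by measurable

lemma dot_self_measurable [measurable]: "(\<lambda>x. dot d x x) \<in> borel_measurable (gauss_vec d)"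
  unfolding dot_def gauss_vec_def by measurable

lemma quad_form_gram: "quad_form {..<d} (gram_form S w x) y = (\<Sum>j\<in>S. w j * (dot d (x j) y)\<^sup>2)"
proof -
  have "quad_form {..<d} (gram_form S w x) y
      = (\<Sum>m<d. \<Sum>n<d. \<Sum>j\<in>S. w j * ((x j m * y m) * (x j n * y n)))"
    by (simp add: quad_form_def gram_form_def sum_distrib_left sum_distrib_right mult_ac)
  also have "\<dots> = (\<Sum>m<d. \<Sum>j\<in>S. \<Sum>n<d. w j * ((x j m * y m) * (x j n * y n)))"
    by (intro sum.cong refl sum.swap)
  also have "\<dots> = (\<Sum>j\<in>S. \<Sum>m<d. \<Sum>n<d. w j * ((x j m * y m) * (x j n * y n)))"
    by (rule sum.swap)
  also have "\<dots> = (\<Sum>j\<in>S. w j * (dot d (x j) y)\<^sup>2)"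
    unfolding dot_def power2_eq_square sum_product by (simp only: sum_distrib_left)
  finally show ?thesis .
qed

lemma trace_gram: "(\<Sum>m<d. gram_form S w x m m) = (\<Sum>j\<in>S. w j * dot d (x j) (x j))"
  unfolding gram_form_def dot_def sum_distrib_left mult.assoc by (rule sum.swap)

lemma frobenius_gram:
  "(\<Sum>m<d. \<Sum>n<d. (gram_form S w x m n)\<^sup>2) = (\<Sum>i\<in>S. \<Sum>j\<in>S. w i * w j * (dot d (x i) (x j))\<^sup>2)"
proof -
  let ?Q = "gram_form S w x"
  have "(\<Sum>m<d. \<Sum>n<d. (?Q m n)\<^sup>2) = (\<Sum>m<d. \<Sum>n<d. \<Sum>i\<in>S. w i * (?Q m n * x i m * x i n))"
    unfolding power2_eq_square
    by (subst (2) gram_form_def) (simp add: sum_distrib_left mult_ac)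
  also have "\<dots> = (\<Sum>m<d. \<Sum>i\<in>S. \<Sum>n<d. w i * (?Q m n * x i m * x i n))"
    by (intro sum.cong refl sum.swap)
  also have "\<dots> = (\<Sum>i\<in>S. \<Sum>m<d. \<Sum>n<d. w i * (?Q m n * x i m * x i n))"
    by (rule sum.swap)
  also have "\<dots> = (\<Sum>i\<in>S. w i * quad_form {..<d} ?Q (x i))"
    unfolding quad_form_def by (simp only: sum_distrib_left)
  finally show ?thesis
    by (simp add: quad_form_gram sum_distrib_left dot_commute[of d "x i" "x j" for i j] mult_ac)
qed

lemma nn_integral_gauss_vec_exp_dot_le:
  assumes "\<forall>j\<in>S. 0 \<le> w j"
  shows "(\<integral>\<^sup>+y. ennreal (exp (\<Sum>j\<in>S. a j * dot d (x j) y - w j * (dot d (x j) y)\<^sup>2)) \<partial>gauss_vec d)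
    \<le> ennreal (exp ((\<Sum>i\<in>S. \<Sum>j\<in>S. a i * a j * dot d (x i) (x j)) / 2
        + (2 * (\<Sum>i\<in>S. \<Sum>j\<in>S. w i * w j * (dot d (x i) (x j))\<^sup>2) - (\<Sum>j\<in>S. w j * dot d (x j) (x j)))))"
proof -
  define \<beta> where "\<beta> = (\<lambda>m. \<Sum>j\<in>S. a j * x j m)"
  let ?Q = "gram_form S w x"
  have exponent: "(\<Sum>j\<in>S. a j * dot d (x j) y - w j * (dot d (x j) y)\<^sup>2) = gauss_exponent {..<d} \<beta> ?Q y" for y
  proof -
    have "dot d \<beta> y = (\<Sum>j\<in>S. a j * dot d (x j) y)"
      unfolding \<beta>_def by (rule dot_sum_left)
    then show ?thesis by (simp add: gauss_exponent_def quad_form_gram sum_subtractf dot_def[of d \<beta>])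
  qed
  have psd: "0 \<le> quad_form {..<d} ?Q y" for y
    unfolding quad_form_gram using assms by (intro sum_nonneg) auto
  have "dot d \<beta> \<beta> = (\<Sum>i\<in>S. a i * dot d (x i) \<beta>)"
    by (subst \<beta>_def) (rule dot_sum_left)
  also have "\<dots> = (\<Sum>i\<in>S. a i * (\<Sum>j\<in>S. a j * dot d (x j) (x i)))"
    unfolding dot_commute[of d _ \<beta>] by (simp add: \<beta>_def dot_sum_left)
  finally have norm_\<beta>: "dot d \<beta> \<beta> = (\<Sum>i\<in>S. \<Sum>j\<in>S. a i * a j * dot d (x i) (x j))"
    by (simp add: sum_distrib_left dot_commute[of d "x i" "x j" for i j] mult_ac)
  have "(\<integral>\<^sup>+y. ennreal (exp (gauss_exponent {..<d} \<beta> ?Q y)) \<partial>Pi\<^sub>M {..<d} (\<lambda>_. std_gauss))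
      \<le> ennreal (exp (dot d \<beta> \<beta> / 2 + (2 * (\<Sum>m<d. \<Sum>n<d. (?Q m n)\<^sup>2) - (\<Sum>m<d. ?Q m m))))"
  proof (rule nn_integral_gauss_exponent_le)
    show "?Q m n = ?Q n m" for m n by (simp add: gram_form_def mult_ac)
    show "gauss_exponent {..<d} \<beta> ?Q z - (\<Sum>m<d. (z m)\<^sup>2) / 2 \<le> dot d \<beta> \<beta> / 2" for z
    proof -
      have "0 \<le> (\<Sum>m<d. (\<beta> m - z m)\<^sup>2)" by (intro sum_nonneg) auto
      also have "\<dots> = dot d \<beta> \<beta> + (\<Sum>m<d. (z m)\<^sup>2) - 2 * (\<Sum>m<d. \<beta> m * z m)"
        unfolding dot_def sum_distrib_left sum.distrib[symmetric] sum_subtractf[symmetric]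
        by (intro sum.cong) (auto simp: power2_eq_square algebra_simps)
      finally show ?thesis using psd[of z] by (simp add: gauss_exponent_def)
    qed
  qed (auto simp: psd)
  then show ?thesis
    by (simp only: exponent gauss_vec_def norm_\<beta> frobenius_gram trace_gram)
qed

lemma nn_integral_gauss_vec_exp_norm:
  assumes "u < 1/2"
  shows "(\<integral>\<^sup>+x. ennreal (exp (u * dot d x x)) \<partial>gauss_vec d) = ennreal (exp (- real d * ln (1 - 2 * u) / 2))"
proof -
  interpret std: prob_space std_gauss by (rule prob_space_std_gauss)
  interpret product_sigma_finite "\<lambda>_::nat. std_gauss" ..
  have "(\<integral>\<^sup>+x. ennreal (exp (u * dot d x x)) \<partial>gauss_vec d)
      = (\<integral>\<^sup>+x. (\<Prod>m<d. ennreal (exp (0 * x m - (- u) * (x m)\<^sup>2))) \<partial>Pi\<^sub>M {..<d} (\<lambda>_. std_gauss))"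
    unfolding gauss_vec_def dot_def
    by (simp add: prod_ennreal exp_sum[symmetric] sum_distrib_left power2_eq_square)
  also have "\<dots> = (\<Prod>m<d. (\<integral>\<^sup>+x. ennreal (exp (0 * x - (- u) * x\<^sup>2)) \<partial>std_gauss))"
    by (rule product_nn_integral_prod) auto
  also have "\<dots> = ennreal (exp (- ln (1 - 2 * u) / 2) ^ d)"
    using assms by (subst nn_integral_std_gauss_exp_quadratic) (auto simp: ennreal_power)
  finally show ?thesis by (simp flip: exp_of_nat_mult)
qed

lemma emeasure_gauss_vec_norm_tail_le:
  assumes "u < 1/2"
  shows "emeasure (gauss_vec d) {x \<in> space (gauss_vec d). 0 \<le> u * (dot d x x - r)}
    \<le> ennreal (exp (- u * r - real d * ln (1 - 2 * u) / 2))"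
proof -
  let ?T = "{x \<in> space (gauss_vec d). 0 \<le> u * (dot d x x - r)}"
  have "emeasure (gauss_vec d) ?T = (\<integral>\<^sup>+x. indicator ?T x \<partial>gauss_vec d)" by simp
  also have "\<dots> \<le> (\<integral>\<^sup>+x. ennreal (exp (- u * r)) * ennreal (exp (u * dot d x x)) \<partial>gauss_vec d)"
  proof (intro nn_integral_mono)
    fix x
    show "indicator ?T x \<le> ennreal (exp (- u * r)) * ennreal (exp (u * dot d x x))"
      using ennreal_leI[of 1 "exp (- u * r + u * dot d x x)"]
      by (auto simp: indicator_def ennreal_mult'[symmetric] exp_add[symmetric] algebra_simps)
  qed
  also have "\<dots> = ennreal (exp (- u * r)) * ennreal (exp (- real d * ln (1 - 2 * u) / 2))"
    using assms by (subst nn_integral_cmult) (auto simp: nn_integral_gauss_vec_exp_norm)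
  also have "\<dots> = ennreal (exp (- u * r - real d * ln (1 - 2 * u) / 2))"
    by (simp flip: ennreal_mult' exp_add)
  finally show ?thesis .
qed

lemma emeasure_gauss_vec_norm_deviation_le:
  assumes "\<bar>\<epsilon>\<bar> \<le> 1" "32 \<le> \<epsilon>\<^sup>2 * real d"
  shows "emeasure (gauss_vec d) {x \<in> space (gauss_vec d). 0 \<le> \<epsilon> / 8 * (dot d x x - (1 + \<epsilon>) * d)} \<le> ennreal (1/4)"
proof -
  have "emeasure (gauss_vec d) {x \<in> space (gauss_vec d). 0 \<le> \<epsilon> / 8 * (dot d x x - (1 + \<epsilon>) * d)}
      \<le> ennreal (exp (- (\<epsilon> / 8) * ((1 + \<epsilon>) * d) - real d * ln (1 - 2 * (\<epsilon> / 8)) / 2))"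
    using assms(1) by (intro emeasure_gauss_vec_norm_tail_le) auto
  also have "\<dots> \<le> ennreal (exp (- 2))"
  proof (intro ennreal_leI exp_le_cancel_iff[THEN iffD2])
    have "- (ln (1 + (- (\<epsilon> / 4))) - (- (\<epsilon> / 4))) \<le> 2 * (- (\<epsilon> / 4))\<^sup>2"
      using assms(1) by (intro abs_le_D2 abs_ln_one_plus_x_minus_x_bound) auto
    then have "- ln (1 - \<epsilon> / 4) / 2 \<le> \<epsilon> / 8 + \<epsilon>\<^sup>2 / 16"
      by (simp add: power_divide)
    then have "real d * (- ln (1 - \<epsilon> / 4) / 2) \<le> real d * (\<epsilon> / 8 + \<epsilon>\<^sup>2 / 16)"
      by (intro mult_left_mono) auto
    moreover have "- (\<epsilon> / 8) * ((1 + \<epsilon>) * d) + real d * (\<epsilon> / 8 + \<epsilon>\<^sup>2 / 16) = - (\<epsilon>\<^sup>2 * d) / 16"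
      by (simp add: power2_eq_square field_simps)
    ultimately show "- (\<epsilon> / 8) * ((1 + \<epsilon>) * d) - real d * ln (1 - 2 * (\<epsilon> / 8)) / 2 \<le> - 2"
      using assms(2) by simp
  qed
  also have "exp (- 2) \<le> (1/4 :: real)"
    using exp_lower_Taylor_quadratic[of 2] by (simp add: exp_minus field_simps)
  finally show ?thesis by (simp add: ennreal_leI)
qed

definition shell :: "nat \<Rightarrow> real \<Rightarrow> (nat \<Rightarrow> real) set" where
  "shell d \<eta> = {x \<in> space (gauss_vec d). (1 - \<eta>) * d \<le> dot d x x \<and> dot d x x \<le> (1 + \<eta>) * d}"

definition shell_measure :: "nat \<Rightarrow> real \<Rightarrow> (nat \<Rightarrow> real) measure" where
  "shell_measure d \<eta> = restrict_space (uniform_measure (gauss_vec d) (shell d \<eta>)) (shell d \<eta>)"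

definition shell_kernel :: "nat \<Rightarrow> (nat \<Rightarrow> real) \<Rightarrow> (nat \<Rightarrow> real) \<Rightarrow> real" where
  "shell_kernel d x y = dot d x y / sqrt d"

lemma shell_sets [measurable]: "shell d \<eta> \<in> sets (gauss_vec d)"
  unfolding shell_def by measurable

lemma measure_shell_ge:
  assumes "0 < \<eta>" "\<eta> \<le> 1" "32 \<le> \<eta>\<^sup>2 * real d"
  shows "1/2 \<le> measure (gauss_vec d) (shell d \<eta>)"
proof -
  interpret prob_space "gauss_vec d" by (rule prob_space_gauss_vec)
  define T where "T = (\<lambda>\<epsilon> :: real. {x \<in> space (gauss_vec d). 0 \<le> \<epsilon> / 8 * (dot d x x - (1 + \<epsilon>) * d)})"
  have [measurable]: "T \<epsilon> \<in> sets (gauss_vec d)" for \<epsilon> unfolding T_def by measurable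
  have prob_T: "prob (T \<epsilon>) \<le> 1/4" if "\<bar>\<epsilon>\<bar> = \<eta>" for \<epsilon>
  proof -
    have "\<epsilon>\<^sup>2 = \<eta>\<^sup>2" unfolding that[symmetric] by simp
    then show ?thesis
      using emeasure_gauss_vec_norm_deviation_le[of \<epsilon> d] that assms
      by (simp add: T_def emeasure_eq_measure)
  qed
  have "space (gauss_vec d) - shell d \<eta> \<subseteq> T \<eta> \<union> T (- \<eta>)"
    using assms(1) by (auto simp: shell_def T_def zero_le_mult_iff mult_le_0_iff)
  then have "prob (space (gauss_vec d) - shell d \<eta>) \<le> prob (T \<eta> \<union> T (- \<eta>))"
    by (intro finite_measure_mono) auto
  also have "\<dots> \<le> prob (T \<eta>) + prob (T (- \<eta>))" by (rule measure_Un_le) auto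
  also have "\<dots> \<le> 1/4 + 1/4" using assms(1) by (intro add_mono prob_T) auto
  finally show ?thesis by (simp add: prob_compl)
qed

lemma sets_shell_measure [measurable_cong]:
  "sets (shell_measure d \<eta>) = sets (restrict_space (gauss_vec d) (shell d \<eta>))"
  unfolding shell_measure_def by (intro sets_restrict_space_cong) simp

lemma space_shell_measure: "space (shell_measure d \<eta>) = shell d \<eta>"
  unfolding shell_measure_def by (auto simp: space_restrict_space shell_def)

lemma prob_space_shell_measure:
  assumes "0 < \<eta>" "\<eta> \<le> 1" "32 \<le> \<eta>\<^sup>2 * real d"
  shows "prob_space (shell_measure d \<eta>)"
proof -
  interpret V: prob_space "gauss_vec d" by (rule prob_space_gauss_vec)
  have "emeasure (gauss_vec d) (shell d \<eta>) \<noteq> 0"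
    using measure_shell_ge[OF assms] by (simp add: V.emeasure_eq_measure)
  then interpret U: prob_space "uniform_measure (gauss_vec d) (shell d \<eta>)"
    by (intro prob_space_uniform_measure) auto
  show ?thesis
    unfolding shell_measure_def using \<open>emeasure (gauss_vec d) (shell d \<eta>) \<noteq> 0\<close>
    by (intro prob_space_restrict_space) (auto simp: V.emeasure_eq_measure intro!: ennreal_divide_self)
qed

lemma nn_integral_shell_measure_le:
  assumes "0 < \<eta>" "\<eta> \<le> 1" "32 \<le> \<eta>\<^sup>2 * real d" and [measurable]: "f \<in> borel_measurable (gauss_vec d)"
  shows "(\<integral>\<^sup>+y. f y \<partial>shell_measure d \<eta>) \<le> 2 * (\<integral>\<^sup>+y. f y \<partial>gauss_vec d)"
proof -
  interpret V: prob_space "gauss_vec d" by (rule prob_space_gauss_vec)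
  define P where "P = V.prob (shell d \<eta>)"
  have "1/2 \<le> P" unfolding P_def by (rule measure_shell_ge[OF assms(1-3)])
  then have "inverse (ennreal P) \<le> 2"
    using ennreal_leI[of "inverse P" 2] by (simp add: inverse_ennreal field_simps)
  have "(\<integral>\<^sup>+y. f y \<partial>shell_measure d \<eta>) = (\<integral>\<^sup>+y. f y * indicator (shell d \<eta>) y \<partial>uniform_measure (gauss_vec d) (shell d \<eta>))"
    unfolding shell_measure_def by (rule nn_integral_restrict_space) simp
  also have "\<dots> = inverse (ennreal P) * (\<integral>\<^sup>+y. f y * indicator (shell d \<eta>) y * indicator (shell d \<eta>) y \<partial>gauss_vec d)"
    by (subst nn_integral_uniform_measure) (auto simp: P_def V.emeasure_eq_measure divide_ennreal_def mult.commute)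
  also have "\<dots> \<le> 2 * (\<integral>\<^sup>+y. f y \<partial>gauss_vec d)"
    using \<open>inverse (ennreal P) \<le> 2\<close> by (intro mult_mono nn_integral_mono) (auto simp: indicator_def)
  finally show ?thesis .
qed

lemma shell_kernel_commute: "shell_kernel d x y = shell_kernel d y x"
  by (simp add: shell_kernel_def dot_commute)

lemma shell_kernel_measurable [measurable]:
  "(\<lambda>(x, y). shell_kernel d x y) \<in> borel_measurable (shell_measure d \<eta> \<Otimes>\<^sub>M shell_measure d \<eta>)"
proof -
  have identity_measurable: "(\<lambda>x. x) \<in> measurable (shell_measure d \<eta>) (gauss_vec d)"
    by (simp add: measurable_cong_sets[OF sets_shell_measure refl] measurable_restrict_space1)
  have [measurable]: "(\<lambda>x. x m) \<in> borel_measurable (shell_measure d \<eta>)" if "m < d" for m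
    using measurable_compose[OF identity_measurable, of "\<lambda>x. x m" borel] that
    by (simp add: gauss_vec_def)
  show ?thesis unfolding shell_kernel_def dot_def case_prod_beta by measurable
qed

lemma shell_kernel_diag:
  assumes "0 < d" "x \<in> shell d \<eta>"
  shows "(1 - \<eta>) * sqrt d \<le> shell_kernel d x x" "shell_kernel d x x \<le> (1 + \<eta>) * sqrt d"
  using assms by (auto simp: shell_def shell_kernel_def field_simps)

lemma abs_shell_kernel_le:
  assumes "0 < d" "\<eta> \<le> 1" "x \<in> shell d \<eta>" "y \<in> shell d \<eta>"
  shows "\<bar>shell_kernel d x y\<bar> \<le> 2 * sqrt d"
proof -
  have "(1 + \<eta>) * d \<le> 2 * real d" "dot d x x \<le> (1 + \<eta>) * d" "dot d y y \<le> (1 + \<eta>) * d"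
    using assms by (auto simp: shell_def intro: mult_right_mono)
  then have "dot d x x * dot d y y \<le> (2 * real d) * (2 * real d)"
    by (intro mult_mono) (auto simp: dot_self_nonneg)
  then have "(dot d x y)\<^sup>2 \<le> (2 * real d)\<^sup>2"
    using dot_Cauchy_Schwarz[of d x y] by (simp add: power2_eq_square)
  then have "\<bar>dot d x y\<bar> \<le> 2 * sqrt d * sqrt d"
    using abs_le_square_iff[of "dot d x y" "2 * real d"] by (simp add: mult.assoc)
  then show ?thesis
    using assms(1) by (simp add: shell_kernel_def divide_le_eq)
qed

lemma nn_integral_shell_exp_kernel_le:
  assumes eta_bounds: "0 < \<eta>" "\<eta> \<le> 1" "32 \<le> \<eta>\<^sup>2 * real d" and "\<forall>j\<in>S. 0 \<le> c j"
  shows "(\<integral>\<^sup>+y. ennreal (exp (\<Sum>j\<in>S. b * shell_kernel d (x j) y - c j * (shell_kernel d (x j) y)\<^sup>2)) \<partial>shell_measure d \<eta>)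
    \<le> 2 * ennreal (exp (b\<^sup>2 / 2 * (\<Sum>i\<in>S. \<Sum>j\<in>S. shell_kernel d (x i) (x j) / sqrt d)
          + (2 * (\<Sum>i\<in>S. \<Sum>j\<in>S. c i * c j * (shell_kernel d (x i) (x j) / sqrt d)\<^sup>2)
             - (\<Sum>j\<in>S. c j * (shell_kernel d (x j) (x j) / sqrt d)))))"
proof -
  let ?f = "\<lambda>y. ennreal (exp (\<Sum>j\<in>S. b / sqrt d * dot d (x j) y - c j / d * (dot d (x j) y)\<^sup>2))"
  have weights: "\<forall>j\<in>S. 0 \<le> c j / d" using assms(4) by simp
  have kernel_over_scale: "shell_kernel d x y / sqrt d = dot d x y / d" for x y
    by (simp add: shell_kernel_def)
  have "(\<integral>\<^sup>+y. ennreal (exp (\<Sum>j\<in>S. b * shell_kernel d (x j) y - c j * (shell_kernel d (x j) y)\<^sup>2)) \<partial>shell_measure d \<eta>)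
      \<le> 2 * (\<integral>\<^sup>+y. ?f y \<partial>gauss_vec d)"
    using nn_integral_shell_measure_le[OF eta_bounds, of ?f]
    by (simp add: shell_kernel_def power_divide)
  also note mult_left_mono[OF nn_integral_gauss_vec_exp_dot_le[OF weights, where a = "\<lambda>_. b / sqrt d" and d = d and x = x]]
  finally show ?thesis
    unfolding kernel_over_scale
    by (simp add: sum_distrib_left sum_divide_distrib power_divide power2_eq_square mult_ac)
qed

section \<open>Almost Gaussian kernels\<close>

locale latent_kernel = prob_space \<mu> for \<mu> :: "'a measure" +
  fixes G :: "'a \<Rightarrow> 'a \<Rightarrow> real"
  assumes G_measurable [measurable]: "(\<lambda>(x, y). G x y) \<in> borel_measurable (\<mu> \<Otimes>\<^sub>M \<mu>)"

text \<open>
  Up to a factor 2, the variables \<open>G (x j)\<close> obey the bound that holds for centred Gaussian variables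
  with covariances \<open>G (x i) (x j) / s\<close>.
\<close>

locale almost_gaussian_kernel = latent_kernel \<mu> G for \<mu> :: "'a measure" and G +
  fixes s \<eta> :: real
  assumes s_pos: "0 < s" and \<eta>_bounds: "0 < \<eta>" "\<eta> \<le> 1"
    and G_commute: "G x y = G y x"
    and G_diag: "x \<in> space \<mu> \<Longrightarrow> (1 - \<eta>) * s \<le> G x x" "x \<in> space \<mu> \<Longrightarrow> G x x \<le> (1 + \<eta>) * s"
    and G_bound: "x \<in> space \<mu> \<Longrightarrow> y \<in> space \<mu> \<Longrightarrow> \<bar>G x y\<bar> \<le> 2 * s"
    and nn_integral_exp_G_le: "\<And>(S :: nat set) x c b. finite S \<Longrightarrow> \<forall>j\<in>S. x j \<in> space \<mu> \<Longrightarrow> \<forall>j\<in>S. 0 \<le> c j \<Longrightarrow>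
      (\<integral>\<^sup>+y. ennreal (exp (\<Sum>j\<in>S. b * G (x j) y - c j * (G (x j) y)\<^sup>2)) \<partial>\<mu>)
      \<le> 2 * ennreal (exp (b\<^sup>2 / 2 * (\<Sum>i\<in>S. \<Sum>j\<in>S. G (x i) (x j) / s)
            + (2 * (\<Sum>i\<in>S. \<Sum>j\<in>S. c i * c j * (G (x i) (x j) / s)\<^sup>2) - (\<Sum>j\<in>S. c j * (G (x j) (x j) / s)))))"

lemma almost_gaussian_kernel_shell:
  assumes "0 < \<eta>" "\<eta> \<le> 1" "32 \<le> \<eta>\<^sup>2 * real d"
  shows "almost_gaussian_kernel (shell_measure d \<eta>) (shell_kernel d) (sqrt d) \<eta>"
proof -
  interpret prob_space "shell_measure d \<eta>" by (rule prob_space_shell_measure[OF assms])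
  have "0 < d" using assms by (cases d) auto
  show ?thesis
  proof
    show "0 < sqrt d" "0 < \<eta>" "\<eta> \<le> 1" using \<open>0 < d\<close> assms by auto
    show "(\<lambda>(x, y). shell_kernel d x y) \<in> borel_measurable (shell_measure d \<eta> \<Otimes>\<^sub>M shell_measure d \<eta>)"
      by (rule shell_kernel_measurable)
    show "shell_kernel d x y = shell_kernel d y x" for x y by (rule shell_kernel_commute)
    show "(1 - \<eta>) * sqrt d \<le> shell_kernel d x x" "shell_kernel d x x \<le> (1 + \<eta>) * sqrt d"
      if "x \<in> space (shell_measure d \<eta>)" for x
      using that shell_kernel_diag[OF \<open>0 < d\<close>] by (simp_all add: space_shell_measure)
    show "\<bar>shell_kernel d x y\<bar> \<le> 2 * sqrt d"
      if "x \<in> space (shell_measure d \<eta>)" "y \<in> space (shell_measure d \<eta>)" for x y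
      using that abs_shell_kernel_le[OF \<open>0 < d\<close> assms(2)] by (simp add: space_shell_measure)
  qed (rule nn_integral_shell_exp_kernel_le[OF assms])
qed

section \<open>Eliminating vertices\<close>

definition slope_cost :: "real \<Rightarrow> real" where
  "slope_cost v = - ln (1 - v) - v"

lemma exp_mult_le_quadratic:
  fixes y D :: real
  assumes "y < 1" "0 < D" "D \<le> 2" "0 \<le> y \<Longrightarrow> D \<le> 1"
  shows "exp y * D \<le> (1 + y) * D + y\<^sup>2"
proof (cases "0 \<le> y")
  case True
  then have "exp y * D \<le> (1 + y + y\<^sup>2) * D"
    using assms by (intro mult_right_mono exp_bound) auto
  moreover have "y\<^sup>2 * D \<le> y\<^sup>2 * 1" using True assms by (intro mult_left_mono) auto
  ultimately show ?thesis by (simp add: algebra_simps)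
next
  case False
  then have "exp y * D \<le> (1 + y + y\<^sup>2 / 2) * D"
    using assms exp_minus_le_quadratic[of "- y"] by (intro mult_right_mono) auto
  moreover have "y\<^sup>2 / 2 * D \<le> y\<^sup>2 / 2 * 2" using assms by (intro mult_left_mono) auto
  ultimately show ?thesis by (simp add: algebra_simps)
qed

text \<open>
  The elimination of a vertex moves the slope \<open>y\<close> to \<open>y + y\<^sup>2\<close>. This recursion is an Euler scheme for
  \<open>y' = y\<^sup>2\<close>, whose solution \<open>y / (1 - k y)\<close> leads to the closed form \<open>slope_cost\<close>.
\<close>

lemma slope_cost_step:
  fixes k y :: real
  assumes "0 \<le> k" "- 1 \<le> y * (k + 1)" "y * (k + 1) < 1"
  shows "- 1 \<le> (y + y\<^sup>2) * k" "(y + y\<^sup>2) * k < 1"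
    and "k * y\<^sup>2 + slope_cost ((y + y\<^sup>2) * k) \<le> slope_cost (y * (k + 1))"
proof -
  define D where "D = 1 - y * (k + 1)"
  have gap_range: "0 < D" "D \<le> 2" using assms by (auto simp: D_def)
  have "- 1 \<le> y"
  proof (rule ccontr)
    assume "\<not> - 1 \<le> y"
    then have "y * (k + 1) \<le> y * 1" using assms(1) by (intro mult_left_mono_neg) auto
    then show False using \<open>\<not> - 1 \<le> y\<close> assms(2) by linarith
  qed
  have "y < 1"
  proof (rule ccontr)
    assume "\<not> y < 1"
    then have "y * 1 \<le> y * (k + 1)" using assms(1) by (intro mult_left_mono) auto
    then show False using \<open>\<not> y < 1\<close> assms(3) by linarith
  qed
  have next_gap: "1 - (y + y\<^sup>2) * k = (1 + y) * D + y\<^sup>2"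
    by (simp add: D_def power2_eq_square algebra_simps)
  have "exp y * D \<le> (1 + y) * D + y\<^sup>2"
    using gap_range \<open>y < 1\<close> assms(1) by (intro exp_mult_le_quadratic) (auto simp: D_def)
  then have exp_le: "exp y * D \<le> 1 - (y + y\<^sup>2) * k" unfolding next_gap .
  moreover have "0 < exp y * D" using gap_range by simp
  ultimately have "ln (exp y * D) \<le> ln (1 - (y + y\<^sup>2) * k)"
    by (subst ln_le_cancel_iff) auto
  then have "y + ln D \<le> ln (1 - (y + y\<^sup>2) * k)" using gap_range by (simp add: ln_mult)
  then show "k * y\<^sup>2 + slope_cost ((y + y\<^sup>2) * k) \<le> slope_cost (y * (k + 1))"
    by (simp add: slope_cost_def D_def algebra_simps)
  show "(y + y\<^sup>2) * k < 1" using exp_le \<open>0 < exp y * D\<close> by simp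
  have "- 1 \<le> k * y + y" using assms(2) by (simp add: algebra_simps)
  moreover have "0 \<le> k * y" if "0 \<le> y" using assms(1) that by simp
  ultimately have "- 1 \<le> k * y" by (cases "0 \<le> y") linarith+
  moreover have "0 \<le> k * y\<^sup>2" using assms(1) by simp
  ultimately show "- 1 \<le> (y + y\<^sup>2) * k" by (simp add: algebra_simps)
qed

lemma scaled_slope_cost_step:
  fixes k b s :: real
  assumes "0 < s" "0 \<le> k" "- 1 \<le> b / s * (k + 1)" "b / s * (k + 1) < 1"
  shows "k * b\<^sup>2 + s\<^sup>2 * slope_cost ((b + b\<^sup>2 / s) / s * k) \<le> s\<^sup>2 * slope_cost (b / s * (k + 1))"
proof -
  have "(b + b\<^sup>2 / s) / s = b / s + (b / s)\<^sup>2" by (simp add: power2_eq_square add_divide_distrib)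
  then have "s\<^sup>2 * (k * (b / s)\<^sup>2 + slope_cost ((b + b\<^sup>2 / s) / s * k)) \<le> s\<^sup>2 * slope_cost (b / s * (k + 1))"
    using slope_cost_step(3)[OF assms(2-4)] by (simp only:) (rule mult_left_mono, auto)
  then show ?thesis using assms(1) by (simp add: power_divide algebra_simps)
qed

context latent_kernel
begin

definition gibbs :: "nat set \<Rightarrow> real \<Rightarrow> (nat \<Rightarrow> nat \<Rightarrow> real) \<Rightarrow> (nat \<Rightarrow> 'a) \<Rightarrow> real" where
  "gibbs S b c x = exp (\<Sum>(i,j)\<in>pairs S. b * G (x i) (x j) - c i j * (G (x i) (x j))\<^sup>2)"

lemma G_pair_measurable:
  assumes "(i, j) \<in> pairs S" "S \<subseteq> T"
  shows "(\<lambda>x. G (x i) (x j)) \<in> borel_measurable (Pi\<^sub>M T (\<lambda>_. \<mu>))"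
proof -
  have [measurable]: "i \<in> T" "j \<in> T" using assms by (auto simp: pairs_def)
  have "(\<lambda>x. (x i, x j)) \<in> measurable (Pi\<^sub>M T (\<lambda>_. \<mu>)) (\<mu> \<Otimes>\<^sub>M \<mu>)" by measurable
  from measurable_compose[OF this G_measurable] show ?thesis by simp
qed

lemma prod_pairs_measurable:
  assumes "f \<in> borel_measurable borel" "S \<subseteq> T"
  shows "(\<lambda>x. \<Prod>(i,j)\<in>pairs S. f (G (x i) (x j)) :: real) \<in> borel_measurable (Pi\<^sub>M T (\<lambda>_. \<mu>))"
  unfolding case_prod_beta
  by (intro borel_measurable_prod measurable_compose[OF G_pair_measurable assms(1)])
    (use assms(2) in auto)

lemma gibbs_measurable [measurable]: "gibbs S b c \<in> borel_measurable (Pi\<^sub>M S (\<lambda>_. \<mu>))"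
proof -
  have "(\<lambda>x. \<Sum>e\<in>pairs S. b * G (x (fst e)) (x (snd e)) - c (fst e) (snd e) * (G (x (fst e)) (x (snd e)))\<^sup>2)
      \<in> borel_measurable (Pi\<^sub>M S (\<lambda>_. \<mu>))"
    by (intro borel_measurable_sum borel_measurable_diff borel_measurable_times borel_measurable_power
        borel_measurable_const G_pair_measurable[where S = S]) auto
  then show ?thesis unfolding gibbs_def case_prod_beta by measurable
qed

lemma gibbs_nonneg: "0 \<le> gibbs S b c x"
  by (simp add: gibbs_def)

lemma gibbs_insert_max:
  assumes "finite S" "\<forall>i\<in>S. i < m"
  shows "gibbs (insert m S) b c (x(m := y))
    = gibbs S b c x * exp (\<Sum>i\<in>S. b * G (x i) y - c i m * (G (x i) y)\<^sup>2)"
proof -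
  let ?f = "\<lambda>x i j. b * G (x i) (x j) - c i j * (G (x i) (x j))\<^sup>2"
  have "m \<notin> S" using assms(2) by auto
  have "(\<Sum>(i,j)\<in>pairs S. ?f (x(m := y)) i j) = (\<Sum>(i,j)\<in>pairs S. ?f x i j)"
    by (intro sum.cong) (use \<open>m \<notin> S\<close> in \<open>auto simp: pairs_def\<close>)
  moreover have "(\<Sum>i\<in>S. ?f (x(m := y)) i m) = (\<Sum>i\<in>S. b * G (x i) y - c i m * (G (x i) y)\<^sup>2)"
    by (intro sum.cong) (use \<open>m \<notin> S\<close> in auto)
  ultimately show ?thesis
    unfolding gibbs_def exp_add[symmetric] sum_pairs_insert_max[OF assms] by simp
qed

end

context almost_gaussian_kernel
begin

definition eliminated :: "nat \<Rightarrow> (nat \<Rightarrow> nat \<Rightarrow> real) \<Rightarrow> nat \<Rightarrow> nat \<Rightarrow> real" where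
  "eliminated m c i j = c i j - 4 / s\<^sup>2 * (c i m * c j m)"

lemma G_diag_over_s:
  assumes "x \<in> space \<mu>"
  shows "1 - \<eta> \<le> G x x / s" "G x x / s \<le> 1 + \<eta>"
  using G_diag[OF assms] s_pos by (auto simp: field_simps)

lemma sum_G_over_s_le:
  fixes S :: "nat set"
  assumes "finite S" "\<forall>j\<in>S. x j \<in> space \<mu>"
  shows "(\<Sum>i\<in>S. \<Sum>j\<in>S. G (x i) (x j) / s) \<le> (1 + \<eta>) * card S + 2 * (\<Sum>(i,j)\<in>pairs S. G (x i) (x j) / s)"
proof -
  have "(\<Sum>i\<in>S. \<Sum>j\<in>S. G (x i) (x j) / s)
      = (\<Sum>i\<in>S. G (x i) (x i) / s) + 2 * (\<Sum>(i,j)\<in>pairs S. G (x i) (x j) / s)"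
    by (rule sum_symmetric_pairs[OF assms(1)]) (simp add: G_commute)
  also have "(\<Sum>i\<in>S. G (x i) (x i) / s) \<le> card S * (1 + \<eta>)"
    using assms(2) G_diag_over_s(2) by (intro sum_bounded_above) auto
  finally show ?thesis by (simp add: mult.commute)
qed

lemma sum_squared_G_over_s_le:
  fixes S :: "nat set"
  assumes "finite S" "\<forall>j\<in>S. x j \<in> space \<mu>"
  shows "(\<Sum>i\<in>S. \<Sum>j\<in>S. c i * c j * (G (x i) (x j) / s)\<^sup>2)
    \<le> 4 * (\<Sum>j\<in>S. (c j)\<^sup>2) + 2 * (\<Sum>(i,j)\<in>pairs S. c i * c j * (G (x i) (x j) / s)\<^sup>2)"
proof -
  have range: "0 \<le> G (x j) (x j) / s" "G (x j) (x j) / s \<le> 2" if "j \<in> S" for j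
    using G_diag_over_s[of "x j"] assms(2) that \<eta>_bounds by fastforce+
  have "(\<Sum>i\<in>S. \<Sum>j\<in>S. c i * c j * (G (x i) (x j) / s)\<^sup>2)
      = (\<Sum>i\<in>S. c i * c i * (G (x i) (x i) / s)\<^sup>2) + 2 * (\<Sum>(i,j)\<in>pairs S. c i * c j * (G (x i) (x j) / s)\<^sup>2)"
    by (rule sum_symmetric_pairs[OF assms(1)]) (simp add: G_commute mult.commute)
  also have "(\<Sum>i\<in>S. c i * c i * (G (x i) (x i) / s)\<^sup>2) \<le> (\<Sum>i\<in>S. c i * c i * 2\<^sup>2)"
    using range by (intro sum_mono mult_left_mono power_mono) auto
  finally show ?thesis by (simp add: sum_distrib_left power2_eq_square mult_ac)
qed

lemma nn_integral_exp_G_pairs_le: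
  fixes S :: "nat set"
  assumes "finite S" and points: "\<forall>j\<in>S. x j \<in> space \<mu>" and coeff_nonneg: "\<forall>j\<in>S. 0 \<le> c j"
  shows "(\<integral>\<^sup>+y. ennreal (exp (\<Sum>j\<in>S. b * G (x j) y - c j * (G (x j) y)\<^sup>2)) \<partial>\<mu>)
    \<le> 2 * ennreal (exp ((1 + \<eta>) / 2 * b\<^sup>2 * card S - (1 - \<eta>) * (\<Sum>j\<in>S. c j) + 8 * (\<Sum>j\<in>S. (c j)\<^sup>2)
        + (\<Sum>(i,j)\<in>pairs S. b\<^sup>2 / s * G (x i) (x j) + 4 / s\<^sup>2 * (c i * c j) * (G (x i) (x j))\<^sup>2)))"
proof (rule order_trans[OF nn_integral_exp_G_le[OF assms]],
    intro mult_left_mono ennreal_leI exp_le_cancel_iff[THEN iffD2])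
  let ?g = "\<lambda>i j. G (x i) (x j) / s"
  have "b\<^sup>2 / 2 * (\<Sum>i\<in>S. \<Sum>j\<in>S. ?g i j)
      \<le> b\<^sup>2 / 2 * ((1 + \<eta>) * card S + 2 * (\<Sum>(i,j)\<in>pairs S. ?g i j))"
    by (intro mult_left_mono sum_G_over_s_le assms) simp
  also have "\<dots> = (1 + \<eta>) / 2 * b\<^sup>2 * card S + (\<Sum>(i,j)\<in>pairs S. b\<^sup>2 / s * G (x i) (x j))"
    by (simp add: case_prod_beta sum_distrib_left add_divide_distrib algebra_simps)
  finally have linear: "b\<^sup>2 / 2 * (\<Sum>i\<in>S. \<Sum>j\<in>S. ?g i j)
      \<le> (1 + \<eta>) / 2 * b\<^sup>2 * card S + (\<Sum>(i,j)\<in>pairs S. b\<^sup>2 / s * G (x i) (x j))" .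
  have trace: "(1 - \<eta>) * (\<Sum>j\<in>S. c j) \<le> (\<Sum>j\<in>S. c j * ?g j j)"
    unfolding sum_distrib_left mult.commute[of "1 - \<eta>"]
    using G_diag_over_s(1) points coeff_nonneg by (intro sum_mono mult_left_mono) auto
  have "2 * (\<Sum>i\<in>S. \<Sum>j\<in>S. c i * c j * (?g i j)\<^sup>2)
      \<le> 2 * (4 * (\<Sum>j\<in>S. (c j)\<^sup>2) + 2 * (\<Sum>(i,j)\<in>pairs S. c i * c j * (?g i j)\<^sup>2))"
    by (intro mult_left_mono sum_squared_G_over_s_le assms) simp
  also have "\<dots> = 8 * (\<Sum>j\<in>S. (c j)\<^sup>2) + (\<Sum>(i,j)\<in>pairs S. 4 / s\<^sup>2 * (c i * c j) * (G (x i) (x j))\<^sup>2)"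
    by (simp add: case_prod_beta sum_distrib_left power_divide mult_ac)
  finally show "b\<^sup>2 / 2 * (\<Sum>i\<in>S. \<Sum>j\<in>S. ?g i j)
      + (2 * (\<Sum>i\<in>S. \<Sum>j\<in>S. c i * c j * (?g i j)\<^sup>2) - (\<Sum>j\<in>S. c j * ?g j j))
    \<le> (1 + \<eta>) / 2 * b\<^sup>2 * card S - (1 - \<eta>) * (\<Sum>j\<in>S. c j) + 8 * (\<Sum>j\<in>S. (c j)\<^sup>2)
        + (\<Sum>(i,j)\<in>pairs S. b\<^sup>2 / s * G (x i) (x j) + 4 / s\<^sup>2 * (c i * c j) * (G (x i) (x j))\<^sup>2)"
    using linear trace by (simp add: case_prod_beta sum.distrib)
qed auto

lemma nn_integral_gibbs_insert_max_le:
  assumes below_m: "finite S" "\<forall>i\<in>S. i < m" and point: "x \<in> space (Pi\<^sub>M S (\<lambda>_. \<mu>))"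
    and coeff_nonneg: "\<And>i. i \<in> S \<Longrightarrow> 0 \<le> c i m"
  shows "(\<integral>\<^sup>+y. ennreal (gibbs (insert m S) b c (x(m := y))) \<partial>\<mu>)
    \<le> 2 * ennreal (exp ((1 + \<eta>) / 2 * b\<^sup>2 * card S - (1 - \<eta>) * (\<Sum>i\<in>S. c i m) + 8 * (\<Sum>i\<in>S. (c i m)\<^sup>2)))
      * ennreal (gibbs S (b + b\<^sup>2 / s) (eliminated m c) x)"
proof -
  define E where "E = (1 + \<eta>) / 2 * b\<^sup>2 * card S - (1 - \<eta>) * (\<Sum>i\<in>S. c i m) + 8 * (\<Sum>i\<in>S. (c i m)\<^sup>2)"
  define R where "R = (\<Sum>(i,j)\<in>pairs S. b\<^sup>2 / s * G (x i) (x j) + 4 / s\<^sup>2 * (c i m * c j m) * (G (x i) (x j))\<^sup>2)"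
  let ?f = "\<lambda>y. ennreal (exp (\<Sum>i\<in>S. b * G (x i) y - c i m * (G (x i) y)\<^sup>2))"
  have coordinates: "x j \<in> space \<mu>" if "j \<in> S" for j using point that by (auto simp: space_PiM)
  have [measurable]: "G (x i) \<in> borel_measurable \<mu>" if "i \<in> S" for i
    using measurable_compose[OF measurable_Pair1' G_measurable] coordinates[OF that] by simp
  have absorb: "gibbs S b c x * exp R = gibbs S (b + b\<^sup>2 / s) (eliminated m c) x"
    unfolding gibbs_def R_def exp_add[symmetric] sum.distrib[symmetric] eliminated_def case_prod_beta
    by (intro arg_cong[where f = exp] sum.cong refl) (simp add: algebra_simps)
  have "(\<integral>\<^sup>+y. ennreal (gibbs (insert m S) b c (x(m := y))) \<partial>\<mu>)
      = (\<integral>\<^sup>+y. ennreal (gibbs S b c x) * ?f y \<partial>\<mu>)"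
    unfolding gibbs_insert_max[OF below_m] by (simp add: ennreal_mult' gibbs_nonneg)
  also have "\<dots> = ennreal (gibbs S b c x) * (\<integral>\<^sup>+y. ?f y \<partial>\<mu>)"
    by (rule nn_integral_cmult) measurable
  also have "\<dots> \<le> ennreal (gibbs S b c x) * (2 * ennreal (exp (E + R)))"
    unfolding E_def R_def
    using below_m(1) coordinates coeff_nonneg by (intro mult_left_mono nn_integral_exp_G_pairs_le) auto
  also have "\<dots> = 2 * ennreal (exp E) * ennreal (gibbs S b c x * exp R)"
    by (simp add: exp_add ennreal_mult ennreal_mult' gibbs_nonneg mult_ac)
  finally show ?thesis unfolding absorb E_def .
qed

definition gibbs_exponent :: "nat set \<Rightarrow> real \<Rightarrow> real \<Rightarrow> (nat \<Rightarrow> nat \<Rightarrow> real) \<Rightarrow> real" where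
  "gibbs_exponent S \<gamma> b c = (1 + \<eta>) / 2 * (s\<^sup>2 * slope_cost (b / s * card S)) - (1 - \<eta>) * (\<Sum>(i,j)\<in>pairs S. c i j)
     + card (pairs S) * (8 * \<gamma>\<^sup>2 + card S * (4 * \<gamma>\<^sup>2 / s\<^sup>2))"

lemma eliminated_bounds:
  assumes "\<forall>i\<in>S. i < m" "(i, j) \<in> pairs S"
    and coeff_range: "\<forall>(i,j)\<in>pairs (insert m S). 0 \<le> c i j \<and> c i j \<le> \<gamma>"
  shows "c i j - 4 * \<gamma>\<^sup>2 / s\<^sup>2 \<le> eliminated m c i j" "eliminated m c i j \<le> c i j"
proof -
  have "(i, m) \<in> pairs (insert m S)" "(j, m) \<in> pairs (insert m S)"
    using assms(1,2) by (auto simp: pairs_def)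
  then have range: "0 \<le> c i m" "0 \<le> c j m" "c i m \<le> \<gamma>" "c j m \<le> \<gamma>"
    using coeff_range by blast+
  then have "c i m * c j m \<le> \<gamma> * \<gamma>" by (intro mult_mono) auto
  then have "4 / s\<^sup>2 * (c i m * c j m) \<le> 4 / s\<^sup>2 * (\<gamma> * \<gamma>)" by (intro mult_left_mono) auto
  then show "c i j - 4 * \<gamma>\<^sup>2 / s\<^sup>2 \<le> eliminated m c i j"
    by (simp add: eliminated_def power2_eq_square)
  show "eliminated m c i j \<le> c i j" using range by (simp add: eliminated_def)
qed

lemma sum_eliminated_ge:
  assumes "\<forall>i\<in>S. i < m" and coeff_range: "\<forall>(i,j)\<in>pairs (insert m S). 0 \<le> c i j \<and> c i j \<le> \<gamma>"
  shows "(\<Sum>(i,j)\<in>pairs S. c i j) - card (pairs S) * (4 * \<gamma>\<^sup>2 / s\<^sup>2) \<le> (\<Sum>(i,j)\<in>pairs S. eliminated m c i j)"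
proof -
  have "(\<Sum>(i,j)\<in>pairs S. c i j) - card (pairs S) * (4 * \<gamma>\<^sup>2 / s\<^sup>2) = (\<Sum>(i,j)\<in>pairs S. c i j - 4 * \<gamma>\<^sup>2 / s\<^sup>2)"
    by (simp add: case_prod_beta sum_subtractf)
  also have "\<dots> \<le> (\<Sum>(i,j)\<in>pairs S. eliminated m c i j)"
    by (intro sum_mono) (auto intro!: eliminated_bounds(1)[OF assms(1) _ coeff_range])
  finally show ?thesis .
qed

lemma gibbs_exponent_insert_max_ge:
  assumes below_m: "finite S" "\<forall>i\<in>S. i < m"
    and coeff_range: "\<forall>(i,j)\<in>pairs (insert m S). 0 \<le> c i j \<and> c i j \<le> \<gamma>"
    and slope: "- 1 \<le> b / s * card (insert m S)" "b / s * card (insert m S) < 1"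
  shows "(1 + \<eta>) / 2 * b\<^sup>2 * card S - (1 - \<eta>) * (\<Sum>i\<in>S. c i m) + 8 * (\<Sum>i\<in>S. (c i m)\<^sup>2)
      + gibbs_exponent S \<gamma> (b + b\<^sup>2 / s) (eliminated m c) \<le> gibbs_exponent (insert m S) \<gamma> b c"
proof -
  define k where "k = card S"
  define N where "N = real (card (pairs S))"
  define \<theta> where "\<theta> = 4 * \<gamma>\<^sup>2 / s\<^sup>2"
  have "m \<notin> S" using below_m(2) by auto
  then have card: "real (card (insert m S)) = real k + 1" "real (card (pairs (insert m S))) = N + k"
    using below_m sum_pairs_insert_max[OF below_m, of "\<lambda>_ _. 1::real"]
    by (simp_all add: k_def N_def case_prod_beta)
  have "k * b\<^sup>2 + s\<^sup>2 * slope_cost ((b + b\<^sup>2 / s) / s * k) \<le> s\<^sup>2 * slope_cost (b / s * (real k + 1))"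
    using slope s_pos unfolding card by (intro scaled_slope_cost_step) auto
  then have "(1 + \<eta>) / 2 * (k * b\<^sup>2 + s\<^sup>2 * slope_cost ((b + b\<^sup>2 / s) / s * k))
      \<le> (1 + \<eta>) / 2 * (s\<^sup>2 * slope_cost (b / s * (real k + 1)))"
    using \<eta>_bounds by (intro mult_left_mono) auto
  then have slope_le: "(1 + \<eta>) / 2 * b\<^sup>2 * k + (1 + \<eta>) / 2 * (s\<^sup>2 * slope_cost ((b + b\<^sup>2 / s) / s * k))
      \<le> (1 + \<eta>) / 2 * (s\<^sup>2 * slope_cost (b / s * (real k + 1)))"
    by (simp only: distrib_left mult.commute mult.left_commute)
  have squares: "(\<Sum>i\<in>S. (c i m)\<^sup>2) \<le> k * \<gamma>\<^sup>2"
    unfolding k_def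
    using below_m(2) coeff_range by (intro sum_bounded_above power_mono) (auto simp: pairs_def)
  have "(1 - \<eta>) * ((\<Sum>(i,j)\<in>pairs S. c i j) - N * \<theta>) \<le> (1 - \<eta>) * (\<Sum>(i,j)\<in>pairs S. eliminated m c i j)"
    unfolding N_def \<theta>_def
    using \<eta>_bounds by (intro mult_left_mono sum_eliminated_ge below_m(2) coeff_range) auto
  moreover have "(1 - \<eta>) * (N * \<theta>) \<le> 1 * (N * \<theta>)"
    using \<eta>_bounds by (intro mult_right_mono) (auto simp: N_def \<theta>_def)
  ultimately have sum_le: "- ((1 - \<eta>) * (\<Sum>(i,j)\<in>pairs S. eliminated m c i j))
      \<le> N * \<theta> - (1 - \<eta>) * (\<Sum>(i,j)\<in>pairs S. c i j)"
    by (simp add: right_diff_distrib)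
  have "0 \<le> k * ((real k + 1) * \<theta>)" by (simp add: \<theta>_def)
  moreover have "(N + k) * (8 * \<gamma>\<^sup>2 + (real k + 1) * \<theta>)
      = N * (8 * \<gamma>\<^sup>2 + k * \<theta>) + N * \<theta> + 8 * (k * \<gamma>\<^sup>2) + k * ((real k + 1) * \<theta>)"
    by (simp add: algebra_simps)
  ultimately show ?thesis
    using slope_le squares sum_le
    unfolding gibbs_exponent_def card sum_pairs_insert_max[OF below_m]
      k_def[symmetric] N_def[symmetric] \<theta>_def[symmetric]
      distrib_left[of "1 - \<eta>"]
    by linarith
qed

lemma nn_integral_gibbs_insert_le:
  assumes below_m: "finite S" "\<forall>i\<in>S. i < m" and coeff_range: "\<forall>(i,j)\<in>pairs (insert m S). 0 \<le> c i j \<and> c i j \<le> \<gamma>"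
    and slope: "- 1 \<le> b / s * card (insert m S)" "b / s * card (insert m S) < 1"
    and rest: "(\<integral>\<^sup>+x. ennreal (gibbs S (b + b\<^sup>2 / s) (eliminated m c) x) \<partial>Pi\<^sub>M S (\<lambda>_. \<mu>))
      \<le> 2 ^ card S * ennreal (exp (gibbs_exponent S \<gamma> (b + b\<^sup>2 / s) (eliminated m c)))"
  shows "(\<integral>\<^sup>+x. ennreal (gibbs (insert m S) b c x) \<partial>Pi\<^sub>M (insert m S) (\<lambda>_. \<mu>))
    \<le> 2 ^ card (insert m S) * ennreal (exp (gibbs_exponent (insert m S) \<gamma> b c))"
proof -
  have "m \<notin> S" using below_m(2) by auto
  interpret product_sigma_finite "\<lambda>_::nat. \<mu>" ..
  define E where "E = (1 + \<eta>) / 2 * b\<^sup>2 * card S - (1 - \<eta>) * (\<Sum>i\<in>S. c i m) + 8 * (\<Sum>i\<in>S. (c i m)\<^sup>2)"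
  define E' where "E' = gibbs_exponent S \<gamma> (b + b\<^sup>2 / s) (eliminated m c)"
  let ?g = "\<lambda>x. ennreal (gibbs S (b + b\<^sup>2 / s) (eliminated m c) x)"
  have "(\<integral>\<^sup>+x. ennreal (gibbs (insert m S) b c x) \<partial>Pi\<^sub>M (insert m S) (\<lambda>_. \<mu>))
      = (\<integral>\<^sup>+x. (\<integral>\<^sup>+y. ennreal (gibbs (insert m S) b c (x(m := y))) \<partial>\<mu>) \<partial>Pi\<^sub>M S (\<lambda>_. \<mu>))"
    by (rule product_nn_integral_insert[OF below_m(1) \<open>m \<notin> S\<close>]) measurable
  also have "\<dots> \<le> (\<integral>\<^sup>+x. 2 * ennreal (exp E) * ?g x \<partial>Pi\<^sub>M S (\<lambda>_. \<mu>))"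
    unfolding E_def
    by (intro nn_integral_mono nn_integral_gibbs_insert_max_le[OF below_m])
      (use below_m(2) coeff_range in \<open>auto simp: pairs_def\<close>)
  also have "\<dots> = 2 * ennreal (exp E) * (\<integral>\<^sup>+x. ?g x \<partial>Pi\<^sub>M S (\<lambda>_. \<mu>))"
    by (rule nn_integral_cmult) measurable
  also have "\<dots> \<le> 2 * ennreal (exp E) * (2 ^ card S * ennreal (exp E'))"
    unfolding E'_def by (intro mult_left_mono rest) auto
  also have "\<dots> = 2 ^ card (insert m S) * ennreal (exp (E + E'))"
    using below_m(1) \<open>m \<notin> S\<close> by (simp add: exp_add ennreal_mult' mult_ac)
  also have "\<dots> \<le> 2 ^ card (insert m S) * ennreal (exp (gibbs_exponent (insert m S) \<gamma> b c))"
    using gibbs_exponent_insert_max_ge[OF below_m coeff_range slope] unfolding E_def E'_def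
    by (intro mult_left_mono ennreal_leI) auto
  finally show ?thesis .
qed

text \<open>
  An elimination lowers the coefficients \<open>c i j\<close> by at most \<open>4 * \<gamma>\<^sup>2 / s\<^sup>2\<close>; the lower bound on them
  keeps all coefficients nonnegative until the last vertex is gone.
\<close>

lemma nn_integral_gibbs_le:
  assumes "finite S"
    and "\<forall>(i,j)\<in>pairs S. card S * (4 * \<gamma>\<^sup>2 / s\<^sup>2) \<le> c i j \<and> c i j \<le> \<gamma>"
    and "- 1 \<le> b / s * card S" "b / s * card S < 1"
  shows "(\<integral>\<^sup>+x. ennreal (gibbs S b c x) \<partial>Pi\<^sub>M S (\<lambda>_. \<mu>)) \<le> 2 ^ card S * ennreal (exp (gibbs_exponent S \<gamma> b c))"
  using assms
proof (induction S arbitrary: b c rule: finite_linorder_max_induct)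
  case empty
  interpret P: prob_space "Pi\<^sub>M {} (\<lambda>_::nat. \<mu>)"
    by (intro prob_space_PiM prob_space_axioms)
  show ?case
    using P.emeasure_space_1 by (simp add: gibbs_def gibbs_exponent_def slope_cost_def)
next
  case (insert m S)
  note below_m = insert.hyps
  have "m \<notin> S" using below_m(2) by auto
  define \<theta> where "\<theta> = 4 * \<gamma>\<^sup>2 / s\<^sup>2"
  have card: "card (insert m S) = card S + 1" using below_m(1) \<open>m \<notin> S\<close> by simp
  have reserve: "real (card S) * \<theta> + \<theta> \<le> c i j" "c i j \<le> \<gamma>" if "(i, j) \<in> pairs (insert m S)" for i j
    using insert.prems(1) that unfolding card \<theta>_def[symmetric] by (auto simp: distrib_right)
  have "0 \<le> real (card S) * \<theta> + \<theta>" by (simp add: \<theta>_def)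
  then have range: "\<forall>(i,j)\<in>pairs (insert m S). 0 \<le> c i j \<and> c i j \<le> \<gamma>"
    using reserve by (blast intro: order_trans)
  have slope: "- 1 \<le> b / s * (real (card S) + 1)" "b / s * (real (card S) + 1) < 1"
    using insert.prems(2,3) unfolding card by (simp_all add: add.commute)
  have next_slope: "(b + b\<^sup>2 / s) / s = b / s + (b / s)\<^sup>2"
    by (simp add: power2_eq_square add_divide_distrib)
  show ?case
  proof (intro nn_integral_gibbs_insert_le[OF below_m range insert.prems(2,3)] insert.IH)
    show "- 1 \<le> (b + b\<^sup>2 / s) / s * card S" "(b + b\<^sup>2 / s) / s * card S < 1"
      unfolding next_slope using slope by (intro slope_cost_step(1,2); simp)+
    show "\<forall>(i,j)\<in>pairs S. card S * (4 * \<gamma>\<^sup>2 / s\<^sup>2) \<le> eliminated m c i j \<and> eliminated m c i j \<le> \<gamma>"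
    proof (intro ballI, clarify)
      fix i j assume old_pair: "(i, j) \<in> pairs S"
      then have "(i, j) \<in> pairs (insert m S)" by (auto simp: pairs_def)
      then show "card S * (4 * \<gamma>\<^sup>2 / s\<^sup>2) \<le> eliminated m c i j \<and> eliminated m c i j \<le> \<gamma>"
        using eliminated_bounds[OF below_m(2) old_pair range] reserve[of i j]
        unfolding \<theta>_def[symmetric] by linarith
    qed
  qed
qed

end

section \<open>Soft cliques\<close>

lemma one_plus_times_exp_le_near_0:
  fixes \<eta> u y :: real
  assumes "0 < \<eta>" "\<eta> < 1" "\<bar>u\<bar> \<le> \<eta> / 4" "y \<le> \<eta> / 6 * u\<^sup>2"
  shows "(1 + u) * exp y \<le> exp u * (1 - (1 - \<eta>) / 2 * u\<^sup>2)"
proof -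
  define h where "h = 1/2 - \<eta> / 3"
  have h_range: "0 \<le> h" "h \<le> 1/2" using assms by (auto simp: h_def)
  have u_gt: "- 1 < u" using assms by simp
  have "u * u\<^sup>2 \<le> \<eta> / 4 * u\<^sup>2" using assms by (intro mult_right_mono) auto
  moreover have "0 \<le> \<eta> * u\<^sup>2" using assms(1) by simp
  ultimately have "ln (1 + u) + y \<le> u - h * u\<^sup>2"
    using ln_one_plus_le_cubic[OF u_gt] assms(4)
    by (simp add: h_def power3_eq_cube power2_eq_square algebra_simps)
  then have "exp (ln (1 + u) + y) \<le> exp (u + (- (h * u\<^sup>2)))" by simp
  then have "(1 + u) * exp y \<le> exp u * exp (- (h * u\<^sup>2))"
    using u_gt by (simp only: exp_add) simp
  moreover have "exp (- (h * u\<^sup>2)) \<le> 1 - (1 - \<eta>) / 2 * u\<^sup>2"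
  proof -
    have "u\<^sup>2 \<le> (\<eta> / 4)\<^sup>2" using assms(1,3) abs_le_square_iff[of u "\<eta> / 4"] by simp
    moreover have "h\<^sup>2 \<le> (1/2)\<^sup>2" using h_range by (intro power_mono)
    ultimately have "h\<^sup>2 * u\<^sup>2 \<le> (1/2)\<^sup>2 * (\<eta> / 4)\<^sup>2" by (intro mult_mono) auto
    moreover have "\<eta> * \<eta> \<le> \<eta> * 1" using assms by (intro mult_left_mono) auto
    ultimately have "h\<^sup>2 * u\<^sup>2 \<le> \<eta> / 64" by (simp add: power2_eq_square)
    moreover have "(1 - \<eta>) / 2 = h - \<eta> / 6" by (simp add: h_def field_simps)
    ultimately have "(1 - \<eta>) / 2 \<le> h - h\<^sup>2 * u\<^sup>2 / 2" using assms(1) by linarith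
    then have "(1 - \<eta>) / 2 * u\<^sup>2 \<le> (h - h\<^sup>2 * u\<^sup>2 / 2) * u\<^sup>2" by (rule mult_right_mono) simp
    also have "\<dots> = h * u\<^sup>2 - (h * u\<^sup>2)\<^sup>2 / 2" by (simp add: power2_eq_square algebra_simps)
    also have "\<dots> \<le> 1 - exp (- (h * u\<^sup>2))"
      using exp_minus_le_quadratic[of "h * u\<^sup>2"] h_range by simp
    finally show ?thesis by simp
  qed
  ultimately show ?thesis by (meson exp_ge_zero mult_left_mono order_trans)
qed

lemma one_plus_times_exp_le_away_from_0:
  fixes \<delta> u y :: real
  assumes "0 < \<delta>" "\<delta> \<le> 1/4" "- 1 < u" "\<delta> \<le> \<bar>u\<bar>" "y \<le> \<delta> / 8 * \<bar>u\<bar>"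
  shows "(1 + u) * exp y \<le> exp u * exp (- (\<delta>\<^sup>2 / 4))"
proof -
  have "ln (1 + u) + y \<le> u - \<delta>\<^sup>2 / 4"
  proof (cases "0 < u")
    case True
    then have u_ge: "\<delta> \<le> u" using assms(4) by simp
    have "ln (1 + u) = ln (1 + \<delta>) + ln ((1 + u) / (1 + \<delta>))"
      using u_ge assms(1) by (simp add: ln_div)
    also have "ln ((1 + u) / (1 + \<delta>)) \<le> (1 + u) / (1 + \<delta>) - 1"
      using u_ge assms(1) by (intro ln_le_minus_one) auto
    also have "\<dots> = (u - \<delta>) * (1 / (1 + \<delta>))" using assms(1) by (simp add: field_simps)
    also have "\<dots> \<le> (u - \<delta>) * (1 - \<delta> / 8)"
    proof (intro mult_left_mono)
      have "\<delta> * \<delta> \<le> \<delta> * 1" using assms(1,2) by (intro mult_left_mono) auto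
      then have "1 \<le> (1 - \<delta> / 8) * (1 + \<delta>)" using assms(1) by (simp add: algebra_simps)
      then show "1 / (1 + \<delta>) \<le> 1 - \<delta> / 8" using assms(1) by (simp add: divide_le_eq)
    qed (use u_ge in simp)
    also have "ln (1 + \<delta>) \<le> \<delta> - \<delta>\<^sup>2 / 2 + \<delta> ^ 3 / 3"
      using assms(1) by (intro ln_one_plus_le_cubic) simp
    also have "\<delta> ^ 3 / 3 \<le> \<delta>\<^sup>2 / 8"
    proof -
      have "\<delta> ^ 3 = \<delta>\<^sup>2 * \<delta>" by (simp add: power3_eq_cube power2_eq_square)
      also have "\<dots> \<le> \<delta>\<^sup>2 * (1/4)" using assms(2) by (intro mult_left_mono) auto
      finally show ?thesis using zero_le_power2[of \<delta>] by linarith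
    qed
    finally show ?thesis
      using assms(5) True
      by (simp add: power2_eq_square algebra_simps add_divide_distrib diff_divide_distrib)
  next
    case False
    then have u_le: "\<delta> \<le> - u" "\<bar>u\<bar> = - u" using assms(4) by auto
    have "u ^ 3 \<le> 0" using False by (simp add: power_le_zero_eq)
    then have "ln (1 + u) \<le> u - u\<^sup>2 / 2" using ln_one_plus_le_cubic[OF assms(3)] by linarith
    moreover have "\<delta> * (\<delta> / 4) \<le> (- u) * ((- u) / 2 - \<delta> / 8)"
      using u_le assms(1) by (intro mult_mono) auto
    ultimately show ?thesis
      using assms(5) unfolding u_le(2) by (simp add: power2_eq_square algebra_simps)
  qed
  then have "exp (ln (1 + u) + y) \<le> exp (u + (- (\<delta>\<^sup>2 / 4)))" by simp
  then show ?thesis using assms(3) by (simp only: exp_add) simp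
qed

text \<open>
  The factor \<open>exp y\<close> is the reserve that keeps the coefficients of the quadratic terms nonnegative.
  A mixture is needed because \<open>(1 + u) * exp (- u)\<close> decays more slowly than a Gaussian; the
  normalization of \<open>\<kappa> * a\<close> makes it correct to second order at 0, up to \<open>\<eta>\<close>.
\<close>

definition edge_mixture :: "real \<Rightarrow> real \<Rightarrow> real \<Rightarrow> real \<Rightarrow> bool" where
  "edge_mixture \<eta> \<kappa> a \<tau> \<longleftrightarrow> 0 < \<kappa> \<and> \<kappa> < 1 \<and> 0 < a \<and> \<kappa> * a = (1 - \<eta>) / 2 \<and> 0 < \<tau> \<and>
     (\<forall>u y. y \<le> \<eta> / 6 * u\<^sup>2 \<longrightarrow> y \<le> \<tau> * \<bar>u\<bar> \<longrightarrow>
       max 0 (1 + u) * exp y \<le> exp u * (\<kappa> * exp (- a * u\<^sup>2) + (1 - \<kappa>)))"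

lemma exists_edge_mixture:
  assumes "0 < \<eta>" "\<eta> < 1"
  shows "\<exists>\<kappa> a \<tau>. edge_mixture \<eta> \<kappa> a \<tau>"
proof -
  define \<delta> where "\<delta> = \<eta> / 4"
  define \<kappa> where "\<kappa> = 1 - exp (- (\<delta>\<^sup>2 / 4))"
  define a where "a = (1 - \<eta>) / 2 / \<kappa>"
  have delta_range: "0 < \<delta>" "\<delta> \<le> 1/4" using assms by (auto simp: \<delta>_def)
  have kappa_range: "0 < \<kappa>" "\<kappa> < 1" using delta_range by (auto simp: \<kappa>_def)
  have kappa_times_a: "\<kappa> * a = (1 - \<eta>) / 2" using kappa_range by (simp add: a_def)
  have "max 0 (1 + u) * exp y \<le> exp u * (\<kappa> * exp (- a * u\<^sup>2) + (1 - \<kappa>))"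
    if reserve: "y \<le> \<eta> / 6 * u\<^sup>2" "y \<le> \<delta> / 8 * \<bar>u\<bar>" for u y
  proof -
    consider (truncated) "u \<le> - 1" | (near_0) "\<bar>u\<bar> \<le> \<delta>" "- 1 < u" | (away_from_0) "\<delta> \<le> \<bar>u\<bar>" "- 1 < u" by linarith
    then show ?thesis
    proof cases
      case truncated
      then have "max 0 (1 + u) = 0" by simp
      then show ?thesis using kappa_range by (simp add: add_nonneg_nonneg)
    next
      case near_0
      have "max 0 (1 + u) * exp y = (1 + u) * exp y" using near_0 by simp
      also have "\<dots> \<le> exp u * (1 - (1 - \<eta>) / 2 * u\<^sup>2)"
        using near_0 reserve assms by (intro one_plus_times_exp_le_near_0) (auto simp: \<delta>_def)
      also have "\<dots> = exp u * (\<kappa> * (1 + - a * u\<^sup>2) + (1 - \<kappa>))"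
        unfolding kappa_times_a[symmetric] by (simp add: algebra_simps)
      also have "\<dots> \<le> exp u * (\<kappa> * exp (- a * u\<^sup>2) + (1 - \<kappa>))"
        using kappa_range by (intro mult_left_mono add_right_mono exp_ge_add_one_self) auto
      finally show ?thesis .
    next
      case away_from_0
      have "(1 + u) * exp y \<le> exp u * exp (- (\<delta>\<^sup>2 / 4))"
        using away_from_0 reserve delta_range by (intro one_plus_times_exp_le_away_from_0)
      also have "\<dots> \<le> exp u * (\<kappa> * exp (- a * u\<^sup>2) + (1 - \<kappa>))"
        using kappa_range by (intro mult_left_mono) (auto simp: \<kappa>_def)
      finally show ?thesis using away_from_0 by simp
    qed
  qed
  then have "edge_mixture \<eta> \<kappa> a (\<delta> / 8)"
    using kappa_range kappa_times_a delta_range assms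
    unfolding edge_mixture_def by (auto simp: a_def)
  then show ?thesis by blast
qed

lemma prod_mixture:
  fixes f :: "'i \<Rightarrow> real"
  assumes "finite P"
  shows "(\<Prod>e\<in>P. \<kappa> * f e + (1 - \<kappa>))
    = (\<Sum>X\<in>Pow P. \<kappa> ^ card X * (1 - \<kappa>) ^ card (P - X) * (\<Prod>e\<in>X. f e))"
proof -
  have "(\<Prod>e\<in>P. \<kappa> * f e + (1 - \<kappa>)) = (\<Sum>X\<in>Pow P. (\<Prod>e\<in>X. \<kappa> * f e) * (\<Prod>e\<in>P - X. 1 - \<kappa>))"
    by (rule prod_add[OF assms])
  then show ?thesis by (simp add: prod.distrib mult_ac)
qed

lemma sum_mixture_exp:
  fixes \<kappa> c E :: real
  assumes "finite P"
  shows "(\<Sum>X\<in>Pow P. \<kappa> ^ card X * (1 - \<kappa>) ^ card (P - X) * exp (E - c * card X))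
    = exp E * (\<kappa> * exp (- c) + (1 - \<kappa>)) ^ card P"
proof -
  have exp_card: "exp (E - c * n) = exp E * exp (- c) ^ n" for n :: nat
    by (simp add: exp_of_nat_mult[symmetric] exp_add[symmetric] mult_ac)
  have "(\<Sum>X\<in>Pow P. \<kappa> ^ card X * (1 - \<kappa>) ^ card (P - X) * exp (E - c * card X))
      = exp E * (\<Sum>X\<in>Pow P. \<kappa> ^ card X * (1 - \<kappa>) ^ card (P - X) * exp (- c) ^ card X)"
    unfolding exp_card sum_distrib_left by (simp only: mult_ac)
  also have "(\<Sum>X\<in>Pow P. \<kappa> ^ card X * (1 - \<kappa>) ^ card (P - X) * exp (- c) ^ card X)
      = (\<kappa> * exp (- c) + (1 - \<kappa>)) ^ card P"
    using prod_mixture[OF assms, of \<kappa> "\<lambda>_. exp (- c)"] by simp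
  finally show ?thesis .
qed

lemma mixture_le_exp:
  fixes \<kappa> x c :: real
  assumes "0 \<le> \<kappa>" "0 \<le> x" "x \<le> c"
  shows "\<kappa> * exp (- x) + (1 - \<kappa>) \<le> exp (- (\<kappa> * (x - c\<^sup>2 / 2)))"
proof -
  have "exp (- x) \<le> 1 - x + c\<^sup>2 / 2"
    using exp_minus_le_quadratic[OF assms(2)] power_mono[OF assms(3,2), of 2] by simp
  then have "\<kappa> * exp (- x) \<le> \<kappa> * (1 - x + c\<^sup>2 / 2)" using assms(1) by (rule mult_left_mono)
  then have "\<kappa> * exp (- x) + (1 - \<kappa>) \<le> 1 + - (\<kappa> * (x - c\<^sup>2 / 2))" by (simp add: algebra_simps)
  also have "\<dots> \<le> exp (- (\<kappa> * (x - c\<^sup>2 / 2)))" by (rule exp_ge_add_one_self)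
  finally show ?thesis .
qed

context almost_gaussian_kernel
begin

lemma soft_clique_le_mixture:
  assumes "finite S" "x \<in> space (Pi\<^sub>M S (\<lambda>_. \<mu>))"
    and edge: "\<And>g. \<bar>g\<bar> \<le> 2 * s \<Longrightarrow>
      max 0 (1 + b * g) \<le> exp (b * g - \<alpha> * g\<^sup>2) * (\<kappa> * exp (- c * g\<^sup>2) + (1 - \<kappa>))"
  shows "(\<Prod>(i,j)\<in>pairs S. max 0 (1 + b * G (x i) (x j)))
    \<le> (\<Sum>X\<in>Pow (pairs S). \<kappa> ^ card X * (1 - \<kappa>) ^ card (pairs S - X)
          * gibbs S b (\<lambda>i j. \<alpha> + c * indicator X (i, j)) x)"
proof -
  define P where "P = pairs S"
  define g where "g = (\<lambda>e. G (x (fst e)) (x (snd e)))"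
  have "finite P" using assms(1) by (simp add: P_def)
  have g_bound: "\<bar>g e\<bar> \<le> 2 * s" if "e \<in> P" for e
    unfolding g_def using that assms(2) by (intro G_bound) (auto simp: P_def pairs_def space_PiM)
  have marked: "exp (\<Sum>e\<in>P. b * g e - \<alpha> * (g e)\<^sup>2) * (\<Prod>e\<in>X. exp (- c * (g e)\<^sup>2))
      = gibbs S b (\<lambda>i j. \<alpha> + c * indicator X (i, j)) x" if "X \<subseteq> P" for X
  proof -
    have "finite X" using that \<open>finite P\<close> finite_subset by blast
    have "(\<Sum>e\<in>X. - c * (g e)\<^sup>2) = (\<Sum>e\<in>P. - (c * indicator X e * (g e)\<^sup>2))"
      by (rule sum.mono_neutral_cong_left) (use that \<open>finite P\<close> in auto)
    then have "(\<Sum>e\<in>P. b * g e - \<alpha> * (g e)\<^sup>2) + (\<Sum>e\<in>X. - c * (g e)\<^sup>2)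
        = (\<Sum>e\<in>P. b * g e - (\<alpha> + c * indicator X e) * (g e)\<^sup>2)"
      by (simp add: sum.distrib[symmetric] algebra_simps)
    then show ?thesis
      by (simp add: gibbs_def P_def g_def case_prod_beta exp_sum[OF \<open>finite X\<close>, symmetric] exp_add[symmetric])
  qed
  have "(\<Prod>e\<in>P. max 0 (1 + b * g e))
      \<le> (\<Prod>e\<in>P. exp (b * g e - \<alpha> * (g e)\<^sup>2) * (\<kappa> * exp (- c * (g e)\<^sup>2) + (1 - \<kappa>)))"
    using edge g_bound by (intro prod_mono) auto
  also have "\<dots> = exp (\<Sum>e\<in>P. b * g e - \<alpha> * (g e)\<^sup>2)
      * (\<Sum>X\<in>Pow P. \<kappa> ^ card X * (1 - \<kappa>) ^ card (P - X) * (\<Prod>e\<in>X. exp (- c * (g e)\<^sup>2)))"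
    by (simp add: prod.distrib exp_sum[OF \<open>finite P\<close>] prod_mixture[OF \<open>finite P\<close>])
  also have "\<dots> = (\<Sum>X\<in>Pow P. \<kappa> ^ card X * (1 - \<kappa>) ^ card (P - X)
      * gibbs S b (\<lambda>i j. \<alpha> + c * indicator X (i, j)) x)"
    unfolding sum_distrib_left by (intro sum.cong refl) (simp add: marked[symmetric] mult_ac)
  finally show ?thesis by (simp add: P_def g_def case_prod_beta)
qed

lemma nn_integral_soft_clique_le_mixture:
  fixes S :: "nat set"
  assumes "finite S" "0 \<le> \<kappa>" "\<kappa> \<le> 1"
    and edge: "\<And>g. \<bar>g\<bar> \<le> 2 * s \<Longrightarrow>
      max 0 (1 + b * g) \<le> exp (b * g - \<alpha> * g\<^sup>2) * (\<kappa> * exp (- c * g\<^sup>2) + (1 - \<kappa>))"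
  shows "(\<integral>\<^sup>+x. ennreal (\<Prod>(i,j)\<in>pairs S. max 0 (1 + b * G (x i) (x j))) \<partial>Pi\<^sub>M S (\<lambda>_. \<mu>))
    \<le> (\<Sum>X\<in>Pow (pairs S). ennreal (\<kappa> ^ card X * (1 - \<kappa>) ^ card (pairs S - X))
          * (\<integral>\<^sup>+x. ennreal (gibbs S b (\<lambda>i j. \<alpha> + c * indicator X (i, j)) x) \<partial>Pi\<^sub>M S (\<lambda>_. \<mu>)))"
proof -
  define w where "w = (\<lambda>X. \<kappa> ^ card X * (1 - \<kappa>) ^ card (pairs S - X))"
  let ?f = "\<lambda>X. gibbs S b (\<lambda>i j. \<alpha> + c * indicator X (i, j))"
  have w_nonneg: "0 \<le> w X" for X using assms(2,3) by (simp add: w_def)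
  have "(\<integral>\<^sup>+x. ennreal (\<Prod>(i,j)\<in>pairs S. max 0 (1 + b * G (x i) (x j))) \<partial>Pi\<^sub>M S (\<lambda>_. \<mu>))
      \<le> (\<integral>\<^sup>+x. (\<Sum>X\<in>Pow (pairs S). ennreal (w X) * ennreal (?f X x)) \<partial>Pi\<^sub>M S (\<lambda>_. \<mu>))"
  proof (intro nn_integral_mono)
    fix x assume "x \<in> space (Pi\<^sub>M S (\<lambda>_. \<mu>))"
    then have "(\<Prod>(i,j)\<in>pairs S. max 0 (1 + b * G (x i) (x j))) \<le> (\<Sum>X\<in>Pow (pairs S). w X * ?f X x)"
      unfolding w_def using soft_clique_le_mixture[OF assms(1) _ edge] by blast
    then have "ennreal (\<Prod>(i,j)\<in>pairs S. max 0 (1 + b * G (x i) (x j))) \<le> ennreal (\<Sum>X\<in>Pow (pairs S). w X * ?f X x)"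
      by (rule ennreal_leI)
    then show "ennreal (\<Prod>(i,j)\<in>pairs S. max 0 (1 + b * G (x i) (x j)))
        \<le> (\<Sum>X\<in>Pow (pairs S). ennreal (w X) * ennreal (?f X x))"
      using w_nonneg by (simp add: sum_ennreal[symmetric] ennreal_mult gibbs_nonneg)
  qed
  also have "\<dots> = (\<Sum>X\<in>Pow (pairs S). ennreal (w X) * (\<integral>\<^sup>+x. ennreal (?f X x) \<partial>Pi\<^sub>M S (\<lambda>_. \<mu>)))"
    by (simp add: nn_integral_sum nn_integral_cmult)
  finally show ?thesis unfolding w_def .
qed

lemma nn_integral_gibbs_marked_le:
  fixes S :: "nat set" and c :: real
  defines "\<alpha> \<equiv> 16 * c\<^sup>2 * card S / s\<^sup>2"
  assumes "finite S" "X \<subseteq> pairs S" "0 \<le> c" "\<alpha> \<le> c" "- 1 \<le> b / s * card S" "b / s * card S < 1"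
  shows "(\<integral>\<^sup>+x. ennreal (gibbs S b (\<lambda>i j. \<alpha> + c * indicator X (i, j)) x) \<partial>Pi\<^sub>M S (\<lambda>_. \<mu>))
    \<le> 2 ^ card S * ennreal (exp ((1 + \<eta>) / 2 * (s\<^sup>2 * slope_cost (b / s * card S))
          + card (pairs S) * (32 * c\<^sup>2 + \<alpha>) - (1 - \<eta>) * c * card X))"
proof -
  let ?c = "\<lambda>i j. \<alpha> + c * indicator X (i, j)"
  have alpha_eqs: "0 \<le> \<alpha>" "card S * (4 * (2 * c)\<^sup>2 / s\<^sup>2) = \<alpha>"
    by (simp_all add: \<alpha>_def power2_eq_square)
  have "(\<integral>\<^sup>+x. ennreal (gibbs S b ?c x) \<partial>Pi\<^sub>M S (\<lambda>_. \<mu>)) \<le> 2 ^ card S * ennreal (exp (gibbs_exponent S (2 * c) b ?c))"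
    unfolding \<alpha>_def[symmetric]
  proof (rule nn_integral_gibbs_le)
    show "\<forall>(i, j)\<in>pairs S. card S * (4 * (2 * c)\<^sup>2 / s\<^sup>2) \<le> ?c i j \<and> ?c i j \<le> 2 * c"
      unfolding alpha_eqs(2) using assms(4,5) by (auto simp: indicator_def)
  qed (use assms in auto)
  also have "\<dots> \<le> 2 ^ card S * ennreal (exp ((1 + \<eta>) / 2 * (s\<^sup>2 * slope_cost (b / s * card S))
          + card (pairs S) * (32 * c\<^sup>2 + \<alpha>) - (1 - \<eta>) * c * card X))"
  proof (intro mult_left_mono ennreal_leI exp_le_cancel_iff[THEN iffD2])
    have "(\<Sum>e\<in>pairs S. c * indicator X e) = (\<Sum>e\<in>X. c)"
      by (rule sum.mono_neutral_cong_right) (use assms(2,3) in auto)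
    then have "c * card X \<le> (\<Sum>(i,j)\<in>pairs S. ?c i j)"
      using alpha_eqs(1) by (simp add: case_prod_beta sum.distrib)
    then have "(1 - \<eta>) * (c * card X) \<le> (1 - \<eta>) * (\<Sum>(i,j)\<in>pairs S. ?c i j)"
      using \<eta>_bounds by (intro mult_left_mono) auto
    then show "gibbs_exponent S (2 * c) b ?c
        \<le> (1 + \<eta>) / 2 * (s\<^sup>2 * slope_cost (b / s * card S))
          + card (pairs S) * (32 * c\<^sup>2 + \<alpha>) - (1 - \<eta>) * c * card X"
      unfolding gibbs_exponent_def alpha_eqs(2) by (simp add: power_mult_distrib mult.assoc)
  qed auto
  finally show ?thesis .
qed

lemma nn_integral_soft_clique_le:
  fixes S :: "nat set" and c :: real
  defines "\<alpha> \<equiv> 16 * c\<^sup>2 * card S / s\<^sup>2"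
  assumes finite_S: "finite S" and kappa_range: "0 \<le> \<kappa>" "\<kappa> \<le> 1" and coeff: "0 \<le> c" "\<alpha> \<le> c"
    and slope: "- 1 \<le> b / s * card S" "b / s * card S < 1"
    and edge: "\<And>g. \<bar>g\<bar> \<le> 2 * s \<Longrightarrow>
      max 0 (1 + b * g) \<le> exp (b * g - \<alpha> * g\<^sup>2) * (\<kappa> * exp (- c * g\<^sup>2) + (1 - \<kappa>))"
  shows "(\<integral>\<^sup>+x. ennreal (\<Prod>(i,j)\<in>pairs S. max 0 (1 + b * G (x i) (x j))) \<partial>Pi\<^sub>M S (\<lambda>_. \<mu>))
    \<le> ennreal (2 ^ card S * exp ((1 + \<eta>) / 2 * (s\<^sup>2 * slope_cost (b / s * card S))
          + card (pairs S) * (32 * c\<^sup>2 + \<alpha> - \<kappa> * ((1 - \<eta>) * c - c\<^sup>2 / 2))))"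
proof -
  define P where "P = pairs S"
  define E where "E = (1 + \<eta>) / 2 * (s\<^sup>2 * slope_cost (b / s * card S)) + card P * (32 * c\<^sup>2 + \<alpha>)"
  define w where "w = (\<lambda>X. \<kappa> ^ card X * (1 - \<kappa>) ^ card (P - X))"
  have "finite P" using finite_S by (simp add: P_def)
  have w_nonneg: "0 \<le> w X" for X using kappa_range by (simp add: w_def)
  have "(\<integral>\<^sup>+x. ennreal (\<Prod>(i,j)\<in>pairs S. max 0 (1 + b * G (x i) (x j))) \<partial>Pi\<^sub>M S (\<lambda>_. \<mu>))
      \<le> (\<Sum>X\<in>Pow P. ennreal (w X) * (\<integral>\<^sup>+x. ennreal (gibbs S b (\<lambda>i j. \<alpha> + c * indicator X (i, j)) x) \<partial>Pi\<^sub>M S (\<lambda>_. \<mu>)))"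
    unfolding w_def P_def by (rule nn_integral_soft_clique_le_mixture[OF finite_S kappa_range edge])
  also have "\<dots> \<le> (\<Sum>X\<in>Pow P. ennreal (w X) * (2 ^ card S * ennreal (exp (E - (1 - \<eta>) * c * card X))))"
    unfolding E_def P_def \<alpha>_def
    by (intro sum_mono mult_left_mono nn_integral_gibbs_marked_le) (use finite_S coeff slope in \<open>auto simp: \<alpha>_def\<close>)
  also have "\<dots> = ennreal (2 ^ card S * (\<Sum>X\<in>Pow P. w X * exp (E - (1 - \<eta>) * c * card X)))"
    using w_nonneg
    by (simp add: ennreal_mult ennreal_power[symmetric] sum_distrib_left mult_ac flip: sum_ennreal)
  also have "(\<Sum>X\<in>Pow P. w X * exp (E - (1 - \<eta>) * c * card X))
      = exp E * (\<kappa> * exp (- ((1 - \<eta>) * c)) + (1 - \<kappa>)) ^ card P"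
    unfolding w_def by (rule sum_mixture_exp[OF \<open>finite P\<close>])
  also have "ennreal (2 ^ card S * \<dots>) \<le> ennreal (2 ^ card S * (exp E * exp (- (\<kappa> * ((1 - \<eta>) * c - c\<^sup>2 / 2))) ^ card P))"
    using kappa_range coeff \<eta>_bounds
    by (intro ennreal_leI mult_left_mono power_mono mixture_le_exp) (auto simp: mult_left_le_one_le)
  also have "exp E * exp (- (\<kappa> * ((1 - \<eta>) * c - c\<^sup>2 / 2))) ^ card P
      = exp (E - card P * (\<kappa> * ((1 - \<eta>) * c - c\<^sup>2 / 2)))"
    by (simp add: exp_of_nat_mult[symmetric] exp_add[symmetric])
  also have "E - card P * (\<kappa> * ((1 - \<eta>) * c - c\<^sup>2 / 2)) = (1 + \<eta>) / 2 * (s\<^sup>2 * slope_cost (b / s * card S))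
      + card P * (32 * c\<^sup>2 + \<alpha> - \<kappa> * ((1 - \<eta>) * c - c\<^sup>2 / 2))"
    by (simp add: E_def algebra_simps)
  finally show ?thesis by (simp add: P_def)
qed

end

definition clique_exponent :: "real \<Rightarrow> real \<Rightarrow> real \<Rightarrow> real \<Rightarrow> real \<Rightarrow> real \<Rightarrow> real" where
  "clique_exponent \<eta> \<kappa> c b s k = k * ln 2 + (1 + \<eta>) / 2 * (s\<^sup>2 * slope_cost (b / s * k))
     + k * (k - 1) / 2 * (32 * c\<^sup>2 + 16 * c\<^sup>2 * k / s\<^sup>2 - \<kappa> * ((1 - \<eta>) * c - c\<^sup>2 / 2))"

lemma (in almost_gaussian_kernel) nn_integral_soft_clique_le_exponent:
  fixes S :: "nat set" and a b :: real
  defines "\<alpha> \<equiv> 16 * (a * b\<^sup>2)\<^sup>2 * card S / s\<^sup>2"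
  assumes "finite S" and mixture: "edge_mixture \<eta> \<kappa> a \<tau>"
    and slope: "- 1 \<le> b / s * card S" "b / s * card S < 1"
    and reserve: "\<alpha> \<le> a * b\<^sup>2" "\<alpha> \<le> \<eta> / 6 * b\<^sup>2" "\<alpha> * (2 * s) \<le> \<tau> * \<bar>b\<bar>"
  shows "(\<integral>\<^sup>+x. ennreal (\<Prod>(i,j)\<in>pairs S. max 0 (1 + b * G (x i) (x j))) \<partial>Pi\<^sub>M S (\<lambda>_. \<mu>))
    \<le> ennreal (exp (clique_exponent \<eta> \<kappa> (a * b\<^sup>2) b s (card S)))"
proof -
  have alpha_nonneg: "0 \<le> \<alpha>" by (simp add: \<alpha>_def)
  have edge: "max 0 (1 + b * g) \<le> exp (b * g - \<alpha> * g\<^sup>2) * (\<kappa> * exp (- (a * b\<^sup>2) * g\<^sup>2) + (1 - \<kappa>))"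
    if g_range: "\<bar>g\<bar> \<le> 2 * s" for g
  proof -
    have "\<alpha> * g\<^sup>2 \<le> \<eta> / 6 * (b * g)\<^sup>2"
      using mult_right_mono[OF reserve(2), of "g\<^sup>2"] by (simp add: power_mult_distrib mult_ac)
    moreover have "\<alpha> * g\<^sup>2 \<le> \<tau> * \<bar>b * g\<bar>"
    proof -
      have "\<alpha> * g\<^sup>2 = \<alpha> * \<bar>g\<bar> * \<bar>g\<bar>" by (simp add: power2_eq_square)
      also have "\<dots> \<le> \<alpha> * (2 * s) * \<bar>g\<bar>"
        using g_range alpha_nonneg by (intro mult_right_mono mult_left_mono) auto
      also have "\<dots> \<le> \<tau> * \<bar>b\<bar> * \<bar>g\<bar>" by (intro mult_right_mono reserve) auto
      finally show ?thesis by (simp add: abs_mult)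
    qed
    ultimately have "max 0 (1 + b * g) * exp (\<alpha> * g\<^sup>2)
        \<le> exp (b * g) * (\<kappa> * exp (- a * (b * g)\<^sup>2) + (1 - \<kappa>))"
      using mixture unfolding edge_mixture_def by blast
    then have "max 0 (1 + b * g) \<le> exp (b * g) * (\<kappa> * exp (- a * (b * g)\<^sup>2) + (1 - \<kappa>)) / exp (\<alpha> * g\<^sup>2)"
      by (simp only: pos_le_divide_eq exp_gt_zero)
    then show ?thesis by (simp add: exp_diff power_mult_distrib mult.assoc)
  qed
  have "(\<integral>\<^sup>+x. ennreal (\<Prod>(i,j)\<in>pairs S. max 0 (1 + b * G (x i) (x j))) \<partial>Pi\<^sub>M S (\<lambda>_. \<mu>))
    \<le> ennreal (2 ^ card S * exp ((1 + \<eta>) / 2 * (s\<^sup>2 * slope_cost (b / s * card S))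
          + card (pairs S) * (32 * (a * b\<^sup>2)\<^sup>2 + \<alpha> - \<kappa> * ((1 - \<eta>) * (a * b\<^sup>2) - (a * b\<^sup>2)\<^sup>2 / 2))))"
    unfolding \<alpha>_def
    by (rule nn_integral_soft_clique_le) (use assms edge in \<open>auto simp: edge_mixture_def \<alpha>_def\<close>)
  also have "2 ^ card S = exp (real (card S) * ln 2)" by (simp add: exp_of_nat_mult)
  finally show ?thesis
    using \<open>finite S\<close>
    by (simp add: clique_exponent_def \<alpha>_def card_pairs real_choose_two exp_add[symmetric] add.assoc)
qed

section \<open>Random colourings\<close>

lemma ramsey_prop_mono:
  assumes "ramsey_prop l k m" "m \<le> n"
  shows "ramsey_prop l k n"
proof -
  have "mono_clique c col n j" if clique: "mono_clique c col m j" for c col j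
  proof -
    obtain S where "S \<subseteq> {..<m}" "card S = j" "\<forall>x\<in>S. \<forall>y\<in>S. x \<noteq> y \<longrightarrow> c {x, y} = col"
      using clique unfolding mono_clique_def by auto
    moreover from this assms(2) have "S \<subseteq> {..<n}" by auto
    ultimately show ?thesis unfolding mono_clique_def by (intro exI[of _ S]) simp
  qed
  then show ?thesis using assms(1) unfolding ramsey_prop_def by blast
qed

lemma ramsey_prop_exists: "\<exists>n. ramsey_prop l k n"
proof -
  obtain r where ramsey_bound: "\<And>(V::nat set) E. finite V \<Longrightarrow> r \<le> card V \<Longrightarrow>
      \<exists>R\<subseteq>V. card R = l \<and> clique R E \<or> card R = k \<and> indep R E"
    using ramsey2[of l k] by blast
  have "mono_clique c True r l \<or> mono_clique c False r k" for c
  proof -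
    obtain R where "R \<subseteq> {..<r}" "card R = l \<and> clique R {A. c A} \<or> card R = k \<and> indep R {A. c A}"
      using ramsey_bound[of "{..<r}" "{A. c A}"] by auto
    then show ?thesis unfolding mono_clique_def clique_def indep_def by auto
  qed
  then show ?thesis unfolding ramsey_prop_def by blast
qed

lemma less_ramsey_number:
  assumes "\<not> ramsey_prop l k n"
  shows "n < ramsey_number l k"
proof (rule ccontr)
  assume "\<not> n < ramsey_number l k"
  moreover have "ramsey_prop l k (ramsey_number l k)"
    unfolding ramsey_number_def using ramsey_prop_exists by (rule LeastI_ex)
  ultimately show False using ramsey_prop_mono assms by (meson not_less)
qed

lemma ramsey_prop_pairs:
  assumes "ramsey_prop l k n"
  obtains S where "S \<subseteq> {..<n}" "card S = l" "\<forall>e\<in>pairs S. f e = True"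
    | S where "S \<subseteq> {..<n}" "card S = k" "\<forall>e\<in>pairs S. f e = False"
proof -
  define c where "c = (\<lambda>A::nat set. f (Min A, Max A))"
  have cliqueE: thesis
    if clique: "mono_clique c col n j"
      and result: "\<And>S. S \<subseteq> {..<n} \<Longrightarrow> card S = j \<Longrightarrow> \<forall>e\<in>pairs S. f e = col \<Longrightarrow> thesis" for col j
  proof -
    obtain S where S_mono: "S \<subseteq> {..<n}" "card S = j" "\<forall>x\<in>S. \<forall>y\<in>S. x \<noteq> y \<longrightarrow> c {x, y} = col"
      using clique unfolding mono_clique_def by auto
    have "f e = col" if e_pair: "e \<in> pairs S" for e
    proof -
      obtain x y where endpoints: "e = (x, y)" "x \<in> S" "y \<in> S" "x < y"
        using e_pair by (auto simp: pairs_def)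
      then have "c {x, y} = col" using S_mono(3) by (metis less_irrefl)
      then show ?thesis using endpoints by (simp add: c_def)
    qed
    with S_mono(1,2) show thesis by (intro result) auto
  qed
  have "mono_clique c True n l \<or> mono_clique c False n k"
    using assms unfolding ramsey_prop_def by simp
  then show thesis
  proof
    assume "mono_clique c True n l"
    then show thesis by (rule cliqueE) (rule that(1))
  next
    assume "mono_clique c False n k"
    then show thesis by (rule cliqueE) (rule that(2))
  qed
qed

lemma measure_Pi_pmf_agree:
  assumes "finite E" "F \<subseteq> E"
  shows "measure_pmf.prob (Pi_pmf E d p) {f. \<forall>e\<in>F. f e = g e} = (\<Prod>e\<in>F. pmf (p e) (g e))"
proof -
  have "{f. \<forall>e\<in>F. f e = g e} = Pi E (\<lambda>e. if e \<in> F then {g e} else UNIV)"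
    using assms(2) by (auto simp: Pi_def split: if_splits)
  also have "measure_pmf.prob (Pi_pmf E d p) \<dots> = (\<Prod>e\<in>E. measure_pmf.prob (p e) (if e \<in> F then {g e} else UNIV))"
    by (rule measure_Pi_pmf_Pi[OF assms(1)])
  also have "\<dots> = (\<Prod>e\<in>F. pmf (p e) (g e))"
    by (rule prod.mono_neutral_cong_right) (use assms in \<open>auto simp: measure_pmf_single\<close>)
  finally show ?thesis .
qed

lemma not_ramsey_prop_weights:
  fixes \<pi> :: "nat \<times> nat \<Rightarrow> real"
  assumes weight_range: "\<And>e. 0 \<le> \<pi> e" "\<And>e. \<pi> e \<le> 1"
    and less: "(\<Sum>S | S \<subseteq> {..<n} \<and> card S = l. \<Prod>e\<in>pairs S. \<pi> e)
        + (\<Sum>S | S \<subseteq> {..<n} \<and> card S = k. \<Prod>e\<in>pairs S. 1 - \<pi> e) < 1"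
  shows "\<not> ramsey_prop l k n"
proof
  assume "ramsey_prop l k n"
  define M where "M = Pi_pmf (pairs {..<n}) False (\<lambda>e. bernoulli_pmf (\<pi> e))"
  define mono where "mono = (\<lambda>col S. {f :: nat \<times> nat \<Rightarrow> bool. \<forall>e\<in>pairs S. f e = col})"
  define cliques where "cliques = (\<lambda>j. {S. S \<subseteq> {..<n} \<and> card S = j})"
  have "finite (cliques j)" for j by (simp add: cliques_def)
  have "measure_pmf.prob M (mono col S) = (\<Prod>e\<in>pairs S. pmf (bernoulli_pmf (\<pi> e)) col)" if "S \<in> cliques j" for S j col
    unfolding M_def mono_def
    using that by (intro measure_Pi_pmf_agree) (auto simp: cliques_def intro!: pairs_mono)
  then have prob_mono: "(\<Sum>S\<in>cliques j. measure_pmf.prob M (mono col S))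
      = (\<Sum>S\<in>cliques j. \<Prod>e\<in>pairs S. pmf (bernoulli_pmf (\<pi> e)) col)" for j col
    by (intro sum.cong) auto
  have "f \<in> (\<Union>S\<in>cliques l. mono True S) \<union> (\<Union>S\<in>cliques k. mono False S)" for f
    by (rule ramsey_prop_pairs[OF \<open>ramsey_prop l k n\<close>, of f]) (auto simp: mono_def cliques_def)
  then have "UNIV = (\<Union>S\<in>cliques l. mono True S) \<union> (\<Union>S\<in>cliques k. mono False S)" by blast
  moreover have "1 = measure_pmf.prob M UNIV" by simp
  ultimately have "1 = measure_pmf.prob M ((\<Union>S\<in>cliques l. mono True S) \<union> (\<Union>S\<in>cliques k. mono False S))"
    by (simp only:)
  also have "\<dots> \<le> measure_pmf.prob M (\<Union>S\<in>cliques l. mono True S) + measure_pmf.prob M (\<Union>S\<in>cliques k. mono False S)"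
    by (rule measure_Un_le) auto
  also have "\<dots> \<le> (\<Sum>S\<in>cliques l. measure_pmf.prob M (mono True S)) + (\<Sum>S\<in>cliques k. measure_pmf.prob M (mono False S))"
    using \<open>\<And>j. finite (cliques j)\<close> by (intro add_mono measure_UNION_le) auto
  also have "\<dots> < 1"
    unfolding prob_mono using less weight_range by (simp add: cliques_def)
  finally show False by simp
qed

context latent_kernel
begin

lemma nn_integral_prod_pairs_restrict:
  fixes S T :: "nat set"
  assumes "finite T" "S \<subseteq> T" and f_measurable: "f \<in> borel_measurable borel"
  shows "(\<integral>\<^sup>+x. ennreal (\<Prod>(i,j)\<in>pairs S. f (G (x i) (x j))) \<partial>Pi\<^sub>M T (\<lambda>_. \<mu>))
    = (\<integral>\<^sup>+x. ennreal (\<Prod>(i,j)\<in>pairs S. f (G (x i) (x j))) \<partial>Pi\<^sub>M S (\<lambda>_. \<mu>))"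
proof -
  interpret product_prob_space "\<lambda>_::nat. \<mu>" T ..
  let ?f = "\<lambda>x. ennreal (\<Prod>(i,j)\<in>pairs S. f (G (x i) (x j)))"
  have [measurable]: "?f \<in> borel_measurable (Pi\<^sub>M S (\<lambda>_. \<mu>))"
    using prod_pairs_measurable[OF f_measurable order_refl] by measurable
  have restrict: "?f (restrict x S) = ?f x" for x
    by (intro arg_cong[of _ _ ennreal] prod.cong) (auto simp: pairs_def)
  have "(\<integral>\<^sup>+x. ?f x \<partial>Pi\<^sub>M S (\<lambda>_. \<mu>)) = (\<integral>\<^sup>+x. ?f x \<partial>distr (Pi\<^sub>M T (\<lambda>_. \<mu>)) (Pi\<^sub>M S (\<lambda>_. \<mu>)) (\<lambda>x. restrict x S))"
    using assms(1,2) finite_subset by (subst distr_PiM_restrict_finite) auto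
  also have "\<dots> = (\<integral>\<^sup>+x. ?f (restrict x S) \<partial>Pi\<^sub>M T (\<lambda>_. \<mu>))"
    by (rule nn_integral_distr) (use assms(2) in \<open>auto intro: measurable_restrict_subset\<close>)
  finally show ?thesis unfolding restrict ..
qed

lemma sum_nn_integral_prod_pairs_le:
  assumes f_measurable: "f \<in> borel_measurable borel" and "0 \<le> A"
    and integral_le: "\<And>S :: nat set. finite S \<Longrightarrow> card S = j \<Longrightarrow>
      (\<integral>\<^sup>+x. ennreal (\<Prod>(i,j)\<in>pairs S. f (G (x i) (x j))) \<partial>Pi\<^sub>M S (\<lambda>_. \<mu>)) \<le> ennreal A"
  shows "(\<Sum>S | S \<subseteq> {..<n} \<and> card S = j. \<integral>\<^sup>+x. ennreal (\<Prod>(i,j)\<in>pairs S. f (G (x i) (x j))) \<partial>Pi\<^sub>M {..<n} (\<lambda>_. \<mu>))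
    \<le> ennreal (real n ^ j * A)"
proof -
  let ?K = "{S. S \<subseteq> {..<n} \<and> card S = j}"
  have "card ?K = n choose j" by (simp add: n_subsets)
  also have "\<dots> \<le> n ^ j"
    by (cases "j \<le> n") (auto simp: binomial_le_pow binomial_eq_0)
  finally have card_le: "real (card ?K) \<le> real n ^ j" by (simp flip: of_nat_power)
  have "(\<Sum>S\<in>?K. \<integral>\<^sup>+x. ennreal (\<Prod>(i,j)\<in>pairs S. f (G (x i) (x j))) \<partial>Pi\<^sub>M {..<n} (\<lambda>_. \<mu>)) \<le> (\<Sum>S\<in>?K. ennreal A)"
  proof (intro sum_mono)
    fix S assume "S \<in> ?K"
    then have clique: "S \<subseteq> {..<n}" "finite S" "card S = j" by (auto intro: finite_subset)
    show "(\<integral>\<^sup>+x. ennreal (\<Prod>(i,j)\<in>pairs S. f (G (x i) (x j))) \<partial>Pi\<^sub>M {..<n} (\<lambda>_. \<mu>)) \<le> ennreal A"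
      unfolding nn_integral_prod_pairs_restrict[OF finite_lessThan clique(1) f_measurable]
      using clique by (intro integral_le)
  qed
  also have "\<dots> = ennreal (card ?K * A)"
    using \<open>0 \<le> A\<close> by (simp add: ennreal_mult ennreal_of_nat_eq_real_of_nat)
  also have "\<dots> \<le> ennreal (real n ^ j * A)"
    using card_le \<open>0 \<le> A\<close> by (intro ennreal_leI mult_right_mono)
  finally show ?thesis .
qed

lemma not_ramsey_prop_kernel:
  assumes density: "h \<in> borel_measurable borel" "\<And>g. 0 \<le> h g" "\<And>g. h g \<le> 1" and nonneg: "0 \<le> A" "0 \<le> B"
    and red: "\<And>S :: nat set. finite S \<Longrightarrow> card S = l \<Longrightarrow>
      (\<integral>\<^sup>+x. ennreal (\<Prod>(i,j)\<in>pairs S. h (G (x i) (x j))) \<partial>Pi\<^sub>M S (\<lambda>_. \<mu>)) \<le> ennreal A"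
    and blue: "\<And>S :: nat set. finite S \<Longrightarrow> card S = k \<Longrightarrow>
      (\<integral>\<^sup>+x. ennreal (\<Prod>(i,j)\<in>pairs S. 1 - h (G (x i) (x j))) \<partial>Pi\<^sub>M S (\<lambda>_. \<mu>)) \<le> ennreal B"
    and less: "real n ^ l * A + real n ^ k * B < 1"
  shows "\<not> ramsey_prop l k n"
proof
  assume ramsey: "ramsey_prop l k n"
  define V where "V = Pi\<^sub>M {..<n} (\<lambda>_. \<mu>)"
  interpret V: prob_space V unfolding V_def by (intro prob_space_PiM prob_space_axioms)
  let ?L = "{S. S \<subseteq> {..<n} \<and> card S = l}" and ?K = "{S. S \<subseteq> {..<n} \<and> card S = k}"
  let ?R = "\<lambda>x (S :: nat set). \<Prod>(i,j)\<in>pairs S. h (G (x i) (x j))"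
  let ?B = "\<lambda>x (S :: nat set). \<Prod>(i,j)\<in>pairs S. 1 - h (G (x i) (x j))"
  have codensity_measurable: "(\<lambda>g. 1 - h g) \<in> borel_measurable borel" using density(1) by measurable
  have measurable_R: "(\<lambda>x. ennreal (?R x S)) \<in> borel_measurable V" if "S \<subseteq> {..<n}" for S
    using prod_pairs_measurable[OF density(1) that] unfolding V_def by measurable
  have measurable_B: "(\<lambda>x. ennreal (?B x S)) \<in> borel_measurable V" if "S \<subseteq> {..<n}" for S
    using prod_pairs_measurable[OF codensity_measurable that] unfolding V_def by measurable
  have products_nonneg: "0 \<le> ?R x S" "0 \<le> ?B x S" for x S
    using density by (auto intro!: prod_nonneg)
  have sum_ge: "1 \<le> (\<Sum>S\<in>?L. ennreal (?R x S)) + (\<Sum>S\<in>?K. ennreal (?B x S))" for x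
  proof -
    have "1 \<le> (\<Sum>S\<in>?L. ?R x S) + (\<Sum>S\<in>?K. ?B x S)"
      using not_ramsey_prop_weights[of "\<lambda>(i,j). h (G (x i) (x j))" n l k] ramsey density
      by (force simp: case_prod_beta not_less)
    then have "ennreal 1 \<le> ennreal ((\<Sum>S\<in>?L. ?R x S) + (\<Sum>S\<in>?K. ?B x S))" by (rule ennreal_leI)
    also have "\<dots> = ennreal (\<Sum>S\<in>?L. ?R x S) + ennreal (\<Sum>S\<in>?K. ?B x S)"
      using products_nonneg by (intro ennreal_plus sum_nonneg)
    also have "\<dots> = (\<Sum>S\<in>?L. ennreal (?R x S)) + (\<Sum>S\<in>?K. ennreal (?B x S))"
      using products_nonneg by (simp only: sum_ennreal)
    finally show ?thesis by (simp only: ennreal_1)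
  qed
  have "1 = (\<integral>\<^sup>+x. 1 \<partial>V)" by (simp add: V.emeasure_space_1)
  also have "\<dots> \<le> (\<integral>\<^sup>+x. (\<Sum>S\<in>?L. ennreal (?R x S)) + (\<Sum>S\<in>?K. ennreal (?B x S)) \<partial>V)"
    by (intro nn_integral_mono sum_ge)
  also have "\<dots> = (\<integral>\<^sup>+x. (\<Sum>S\<in>?L. ennreal (?R x S)) \<partial>V) + (\<integral>\<^sup>+x. (\<Sum>S\<in>?K. ennreal (?B x S)) \<partial>V)"
    by (intro nn_integral_add borel_measurable_sum) (blast intro: measurable_R measurable_B)+
  also have "\<dots> = (\<Sum>S\<in>?L. \<integral>\<^sup>+x. ennreal (?R x S) \<partial>V) + (\<Sum>S\<in>?K. \<integral>\<^sup>+x. ennreal (?B x S) \<partial>V)"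
    by (intro arg_cong2[of _ _ _ _ "(+)"] nn_integral_sum) (blast intro: measurable_R measurable_B)+
  also have "\<dots> \<le> ennreal (real n ^ l * A) + ennreal (real n ^ k * B)"
    unfolding V_def using red blue nonneg
    by (intro add_mono sum_nn_integral_prod_pairs_le[OF density(1)]
        sum_nn_integral_prod_pairs_le[OF codensity_measurable]) auto
  also have "\<dots> = ennreal (real n ^ l * A + real n ^ k * B)" using nonneg by simp
  also have "\<dots> < ennreal 1" using less nonneg by (subst ennreal_less_iff) auto
  finally show False by simp
qed

lemma nn_integral_prod_pairs_le_soft:
  fixes S :: "nat set"
  assumes clique_size: "finite S" "card S = k" and "0 \<le> q"
    and f_range: "\<And>g. 0 \<le> f g" "\<And>g. f g \<le> q * max 0 (1 + b * g)"
    and soft_le: "(\<integral>\<^sup>+x. ennreal (\<Prod>(i,j)\<in>pairs S. max 0 (1 + b * G (x i) (x j))) \<partial>Pi\<^sub>M S (\<lambda>_. \<mu>)) \<le> ennreal A"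
  shows "(\<integral>\<^sup>+x. ennreal (\<Prod>(i,j)\<in>pairs S. f (G (x i) (x j))) \<partial>Pi\<^sub>M S (\<lambda>_. \<mu>)) \<le> ennreal (q ^ (k choose 2) * A)"
proof -
  let ?m = "\<lambda>x. \<Prod>(i,j)\<in>pairs S. max 0 (1 + b * G (x i) (x j))"
  have "(\<lambda>g. max 0 (1 + b * g)) \<in> borel_measurable borel" by measurable
  then have measurable_m: "(\<lambda>x. ennreal (?m x)) \<in> borel_measurable (Pi\<^sub>M S (\<lambda>_. \<mu>))"
    using prod_pairs_measurable[OF _ order_refl] by measurable
  have "(\<Prod>(i,j)\<in>pairs S. f (G (x i) (x j))) \<le> q ^ (k choose 2) * ?m x" for x
  proof -
    have "(\<Prod>(i,j)\<in>pairs S. f (G (x i) (x j))) \<le> (\<Prod>(i,j)\<in>pairs S. q * max 0 (1 + b * G (x i) (x j)))"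
      using f_range by (intro prod_mono) auto
    then show ?thesis
      using card_pairs[OF clique_size(1)] clique_size(2) by (simp add: case_prod_beta prod.distrib)
  qed
  then have "(\<integral>\<^sup>+x. ennreal (\<Prod>(i,j)\<in>pairs S. f (G (x i) (x j))) \<partial>Pi\<^sub>M S (\<lambda>_. \<mu>))
      \<le> (\<integral>\<^sup>+x. ennreal (q ^ (k choose 2)) * ennreal (?m x) \<partial>Pi\<^sub>M S (\<lambda>_. \<mu>))"
    using \<open>0 \<le> q\<close> by (intro nn_integral_mono) (simp add: ennreal_leI flip: ennreal_mult')
  also have "\<dots> = ennreal (q ^ (k choose 2)) * (\<integral>\<^sup>+x. ennreal (?m x) \<partial>Pi\<^sub>M S (\<lambda>_. \<mu>))"
    by (rule nn_integral_cmult[OF measurable_m])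
  also have "\<dots> \<le> ennreal (q ^ (k choose 2)) * ennreal A" by (intro mult_left_mono soft_le) simp
  finally show ?thesis using \<open>0 \<le> q\<close> by (simp add: ennreal_mult')
qed

lemma not_ramsey_prop_soft:
  fixes q t A B :: real
  assumes q_range: "0 < q" "q < 1" and nonneg: "0 \<le> A" "0 \<le> B"
    and red: "\<And>S :: nat set. finite S \<Longrightarrow> card S = l \<Longrightarrow>
      (\<integral>\<^sup>+x. ennreal (\<Prod>(i,j)\<in>pairs S. max 0 (1 + (- t) * G (x i) (x j))) \<partial>Pi\<^sub>M S (\<lambda>_. \<mu>)) \<le> ennreal A"
    and blue: "\<And>S :: nat set. finite S \<Longrightarrow> card S = k \<Longrightarrow>
      (\<integral>\<^sup>+x. ennreal (\<Prod>(i,j)\<in>pairs S. max 0 (1 + q * t / (1 - q) * G (x i) (x j))) \<partial>Pi\<^sub>M S (\<lambda>_. \<mu>)) \<le> ennreal B"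
    and less: "real n ^ l * (q ^ (l choose 2) * A) + real n ^ k * ((1 - q) ^ (k choose 2) * B) < 1"
  shows "\<not> ramsey_prop l k n"
proof (rule not_ramsey_prop_kernel[OF _ _ _ _ _ _ _ less])
  define h where "h = (\<lambda>g::real. min 1 (max 0 (q * (1 + (- t) * g))))"
  show "h \<in> borel_measurable borel" unfolding h_def by measurable
  show h_range: "0 \<le> h g" "h g \<le> 1" for g by (auto simp: h_def)
  have "h g \<le> q * max 0 (1 + (- t) * g)" for g
    using q_range by (simp add: h_def max_mult_distrib_left)
  then show "(\<integral>\<^sup>+x. ennreal (\<Prod>(i,j)\<in>pairs S. h (G (x i) (x j))) \<partial>Pi\<^sub>M S (\<lambda>_. \<mu>)) \<le> ennreal (q ^ (l choose 2) * A)"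
    if "finite S" "card S = l" for S :: "nat set"
    using that q_range h_range(1) by (intro nn_integral_prod_pairs_le_soft[OF _ _ _ _ _ red]) auto
  have "1 - h g \<le> (1 - q) * max 0 (1 + q * t / (1 - q) * g)" for g
  proof -
    have "1 - h g \<le> max 0 (1 - q * (1 + (- t) * g))" by (auto simp: h_def)
    also have "1 - q * (1 + (- t) * g) = (1 - q) * (1 + q * t / (1 - q) * g)"
      using q_range by (simp add: field_simps)
    also have "max 0 \<dots> = (1 - q) * max 0 (1 + q * t / (1 - q) * g)"
      using q_range by (simp add: max_mult_distrib_left)
    finally show ?thesis .
  qed
  then show "(\<integral>\<^sup>+x. ennreal (\<Prod>(i,j)\<in>pairs S. 1 - h (G (x i) (x j))) \<partial>Pi\<^sub>M S (\<lambda>_. \<mu>)) \<le> ennreal ((1 - q) ^ (k choose 2) * B)"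
    if "finite S" "card S = k" for S :: "nat set"
    using that q_range h_range(2) by (intro nn_integral_prod_pairs_le_soft[OF _ _ _ _ _ blue]) auto
qed (use q_range nonneg in auto)

end

section \<open>Asymptotics of the clique counts\<close>

text \<open>
  With \<open>s = \<sigma> * l\<close> and cliques of size \<open>\<gamma> * l\<close>, the two summands are the parts of the exponent that come
  from the slope \<open>b\<close>, with \<open>v = b * \<gamma> / \<sigma>\<close>, and from the mixture. Their second order terms cancel, which
  leaves \<open>v / 3\<close>, the contribution of the triangles.
\<close>

definition triangle_gain :: "real \<Rightarrow> real \<Rightarrow> real" where
  "triangle_gain \<eta> v = (1 + \<eta>) * slope_cost v / v\<^sup>2 - (1 - \<eta>)\<^sup>2 / 2"

definition subcritical :: "real \<Rightarrow> real \<Rightarrow> real \<Rightarrow> real \<Rightarrow> real \<Rightarrow> real \<Rightarrow> real \<Rightarrow> real \<Rightarrow> bool" where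
  "subcritical \<eta> a \<tau> \<sigma> L q b \<gamma> \<longleftrightarrow> b \<noteq> 0 \<and> 0 < \<gamma> \<and> \<bar>b * \<gamma> / \<sigma>\<bar> < 1 \<and> 32 * a\<^sup>2 * b\<^sup>2 * \<bar>b * \<gamma> / \<sigma>\<bar> < \<tau> \<and>
     L * \<gamma> + \<gamma>\<^sup>2 / 2 * ln q + \<gamma>\<^sup>2 * b\<^sup>2 / 2 * (triangle_gain \<eta> (b * \<gamma> / \<sigma>) + 33 * a\<^sup>2 * b\<^sup>2) < 0"

lemma mixture_exponent_le_triangle_gain:
  assumes "edge_mixture \<eta> \<kappa> a \<tau>" "b \<noteq> 0" "\<gamma> \<noteq> 0" "\<sigma> \<noteq> 0"
  shows "(1 + \<eta>) / 2 * (\<sigma>\<^sup>2 * slope_cost (b * \<gamma> / \<sigma>))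
      + \<gamma>\<^sup>2 / 2 * (32 * (a * b\<^sup>2)\<^sup>2 - \<kappa> * ((1 - \<eta>) * (a * b\<^sup>2) - (a * b\<^sup>2)\<^sup>2 / 2))
    \<le> \<gamma>\<^sup>2 * b\<^sup>2 / 2 * (triangle_gain \<eta> (b * \<gamma> / \<sigma>) + 33 * a\<^sup>2 * b\<^sup>2)"
proof -
  have kappa_bounds: "\<kappa> * a = (1 - \<eta>) / 2" "\<kappa> \<le> 2"
    using assms(1) by (auto simp: edge_mixture_def)
  have slope: "(1 + \<eta>) / 2 * (\<sigma>\<^sup>2 * slope_cost (b * \<gamma> / \<sigma>))
      = \<gamma>\<^sup>2 * b\<^sup>2 / 2 * ((1 + \<eta>) * slope_cost (b * \<gamma> / \<sigma>) / (b * \<gamma> / \<sigma>)\<^sup>2)"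
    using assms(2-4) by (simp add: power_divide power_mult_distrib)
  have "\<kappa> * ((1 - \<eta>) * (a * b\<^sup>2)) = \<kappa> * a * ((1 - \<eta>) * b\<^sup>2)" by simp
  also have "\<dots> = (1 - \<eta>)\<^sup>2 / 2 * b\<^sup>2" unfolding kappa_bounds(1) by (simp add: power2_eq_square)
  finally have "\<kappa> * ((1 - \<eta>) * (a * b\<^sup>2)) = (1 - \<eta>)\<^sup>2 / 2 * b\<^sup>2" .
  moreover have "\<kappa> * (a * b\<^sup>2)\<^sup>2 \<le> 2 * (a * b\<^sup>2)\<^sup>2"
    using kappa_bounds(2) by (intro mult_right_mono) auto
  ultimately have "32 * (a * b\<^sup>2)\<^sup>2 - \<kappa> * ((1 - \<eta>) * (a * b\<^sup>2) - (a * b\<^sup>2)\<^sup>2 / 2)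
      \<le> 33 * (a * b\<^sup>2)\<^sup>2 - (1 - \<eta>)\<^sup>2 / 2 * b\<^sup>2"
    unfolding right_diff_distrib[of \<kappa>] by linarith
  then have "\<gamma>\<^sup>2 / 2 * (32 * (a * b\<^sup>2)\<^sup>2 - \<kappa> * ((1 - \<eta>) * (a * b\<^sup>2) - (a * b\<^sup>2)\<^sup>2 / 2))
      \<le> \<gamma>\<^sup>2 / 2 * (33 * (a * b\<^sup>2)\<^sup>2 - (1 - \<eta>)\<^sup>2 / 2 * b\<^sup>2)"
    by (rule mult_left_mono) simp
  also have "\<dots> = \<gamma>\<^sup>2 * b\<^sup>2 / 2 * (33 * a\<^sup>2 * b\<^sup>2 - (1 - \<eta>)\<^sup>2 / 2)"
    by (simp add: power_mult_distrib power2_eq_square algebra_simps add_divide_distrib diff_divide_distrib)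
  finally show ?thesis
    unfolding slope triangle_gain_def by (simp add: algebra_simps)
qed

lemma tendsto_clique_exponent:
  fixes k s :: "nat \<Rightarrow> real"
  assumes size_limit: "(\<lambda>l. k l / l) \<longlonglongrightarrow> \<gamma>" and scale_limit: "(\<lambda>l. s l / l) \<longlonglongrightarrow> \<sigma>" and "0 < \<sigma>" "b * \<gamma> / \<sigma> < 1"
  shows "(\<lambda>l. clique_exponent \<eta> \<kappa> c b (s l) (k l) / (real l)\<^sup>2)
    \<longlonglongrightarrow> (1 + \<eta>) / 2 * (\<sigma>\<^sup>2 * slope_cost (b * \<gamma> / \<sigma>))
      + \<gamma>\<^sup>2 / 2 * (32 * c\<^sup>2 - \<kappa> * ((1 - \<eta>) * c - c\<^sup>2 / 2))"
proof (rule Lim_transform_eventually)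
  let ?x = "\<lambda>l::nat. k l / l" and ?y = "\<lambda>l::nat. s l / l" and ?z = "\<lambda>l::nat. 1 / real l"
  let ?R = "\<lambda>x y z. x * z * ln 2 + (1 + \<eta>) / 2 * (y\<^sup>2 * slope_cost (b / y * x))
     + x * (x - z) / 2 * (32 * c\<^sup>2 + 16 * c\<^sup>2 * x * z / y\<^sup>2 - \<kappa> * ((1 - \<eta>) * c - c\<^sup>2 / 2))"
  have "(\<lambda>l. ?R (?x l) (?y l) (?z l)) \<longlonglongrightarrow> ?R \<gamma> \<sigma> 0"
    unfolding slope_cost_def
    using assms(3,4) by (intro tendsto_intros size_limit scale_limit lim_1_over_n) auto
  also have "?R \<gamma> \<sigma> 0 = (1 + \<eta>) / 2 * (\<sigma>\<^sup>2 * slope_cost (b * \<gamma> / \<sigma>))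
      + \<gamma>\<^sup>2 / 2 * (32 * c\<^sup>2 - \<kappa> * ((1 - \<eta>) * c - c\<^sup>2 / 2))"
    by (simp add: power2_eq_square)
  finally show "(\<lambda>l. ?R (?x l) (?y l) (?z l)) \<longlonglongrightarrow> (1 + \<eta>) / 2 * (\<sigma>\<^sup>2 * slope_cost (b * \<gamma> / \<sigma>))
      + \<gamma>\<^sup>2 / 2 * (32 * c\<^sup>2 - \<kappa> * ((1 - \<eta>) * c - c\<^sup>2 / 2))" .
  have "\<forall>\<^sub>F l in sequentially. 0 < ?y l" using scale_limit \<open>0 < \<sigma>\<close> by (rule order_tendstoD)
  then show "\<forall>\<^sub>F l in sequentially. ?R (?x l) (?y l) (?z l) = clique_exponent \<eta> \<kappa> c b (s l) (k l) / (real l)\<^sup>2"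
    using eventually_gt_at_top[of 0]
  proof eventually_elim
    case (elim l)
    define n X Y where "n = real l" and "X = ?x l" and "Y = ?y l"
    have "0 < n" "0 < Y" using elim by (auto simp: n_def Y_def)
    then have "k l = X * n" "s l = Y * n" by (auto simp: X_def Y_def n_def)
    moreover have "clique_exponent \<eta> \<kappa> c b (Y * n) (X * n) / n\<^sup>2 = ?R X Y (1 / n)"
    proof -
      have "b / (Y * n) * (X * n) = b / Y * X" "16 * c\<^sup>2 * (X * n) / (Y * n)\<^sup>2 = 16 * c\<^sup>2 * X * (1 / n) / Y\<^sup>2"
        using \<open>0 < n\<close> by (simp_all add: power2_eq_square mult_ac)
      moreover have "X * n * ln 2 / n\<^sup>2 = X * (1 / n) * ln 2" "(Y * n)\<^sup>2 / n\<^sup>2 = Y\<^sup>2"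
          "X * n * (X * n - 1) / n\<^sup>2 = X * (X - 1 / n)"
        using \<open>0 < n\<close> by (simp_all add: power2_eq_square right_diff_distrib diff_divide_distrib)
      moreover have "(u + (1 + \<eta>) / 2 * (v * f) + w / 2 * g) / n\<^sup>2
          = u / n\<^sup>2 + (1 + \<eta>) / 2 * (v / n\<^sup>2 * f) + w / n\<^sup>2 / 2 * g" for u v w f g
        by (simp add: add_divide_distrib)
      ultimately show ?thesis unfolding clique_exponent_def by (simp only:)
    qed
    ultimately show ?case by (simp add: X_def Y_def n_def)
  qed
qed

lemma eventually_exp_less:
  fixes X :: "nat \<Rightarrow> real"
  assumes "(\<lambda>l. X l / (real l)\<^sup>2) \<longlonglongrightarrow> \<Theta>" "\<Theta> < 0" "0 < \<delta>"
  shows "\<forall>\<^sub>F l in sequentially. exp (X l) < \<delta>"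
proof -
  have "filterlim (\<lambda>l. (real l)\<^sup>2) at_top sequentially" by real_asymp
  then have "filterlim (\<lambda>l. X l / (real l)\<^sup>2 * (real l)\<^sup>2) at_bot sequentially"
    using assms(1,2) by (intro filterlim_tendsto_neg_mult_at_bot)
  then have "\<forall>\<^sub>F l in sequentially. X l / (real l)\<^sup>2 * (real l)\<^sup>2 < ln \<delta>"
    by (auto simp: filterlim_at_bot_dense)
  then show ?thesis
    using eventually_gt_at_top[of 0]
  proof eventually_elim
    case (elim l)
    then have "exp (X l) < exp (ln \<delta>)" by simp
    then show ?case using assms(3) by simp
  qed
qed

lemma eventually_clique_weight_less:
  fixes k :: "nat \<Rightarrow> nat" and s :: "nat \<Rightarrow> real"
  assumes size_limit: "(\<lambda>l. real (k l) / l) \<longlonglongrightarrow> \<gamma>" and scale_limit: "(\<lambda>l. s l / l) \<longlonglongrightarrow> \<sigma>" and "0 < \<sigma>" "0 < q" "0 < \<delta>"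
    and mixture: "edge_mixture \<eta> \<kappa> a \<tau>" and subcritical: "subcritical \<eta> a \<tau> \<sigma> L q b \<gamma>"
  shows "\<forall>\<^sub>F l in sequentially.
    exp (L * real l) ^ k l * (q ^ (k l choose 2) * exp (clique_exponent \<eta> \<kappa> (a * b\<^sup>2) b (s l) (real (k l)))) < \<delta>"
proof -
  let ?ce = "\<lambda>l. clique_exponent \<eta> \<kappa> (a * b\<^sup>2) b (s l) (real (k l))"
  let ?mix = "(1 + \<eta>) / 2 * (\<sigma>\<^sup>2 * slope_cost (b * \<gamma> / \<sigma>))
      + \<gamma>\<^sup>2 / 2 * (32 * (a * b\<^sup>2)\<^sup>2 - \<kappa> * ((1 - \<eta>) * (a * b\<^sup>2) - (a * b\<^sup>2)\<^sup>2 / 2))"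
  define X where "X = (\<lambda>l. L * real l * real (k l) + real (k l) * (real (k l) - 1) / 2 * ln q + ?ce l)"
  have rate: "b * \<gamma> / \<sigma> < 1"
      "L * \<gamma> + \<gamma>\<^sup>2 / 2 * ln q + \<gamma>\<^sup>2 * b\<^sup>2 / 2 * (triangle_gain \<eta> (b * \<gamma> / \<sigma>) + 33 * a\<^sup>2 * b\<^sup>2) < 0"
    and nonzero: "b \<noteq> 0" "\<gamma> \<noteq> 0"
    using subcritical unfolding subcritical_def by (auto simp only: abs_less_iff)
  have "(\<lambda>l. L * (real (k l) / l) + (real (k l) / l) * (real (k l) / l - 1 / l) / 2 * ln q + ?ce l / (real l)\<^sup>2)
      \<longlonglongrightarrow> L * \<gamma> + \<gamma> * (\<gamma> - 0) / 2 * ln q + ?mix"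
    by (intro tendsto_intros size_limit lim_1_over_n
        tendsto_clique_exponent[OF size_limit scale_limit \<open>0 < \<sigma>\<close> rate(1)]) simp_all
  moreover have "\<forall>\<^sub>F l in sequentially.
      L * (real (k l) / l) + (real (k l) / l) * (real (k l) / l - 1 / l) / 2 * ln q + ?ce l / (real l)\<^sup>2 = X l / (real l)\<^sup>2"
    using eventually_gt_at_top[of 0]
    by eventually_elim (simp add: X_def power2_eq_square field_simps)
  ultimately have "(\<lambda>l. X l / (real l)\<^sup>2) \<longlonglongrightarrow> L * \<gamma> + \<gamma> * (\<gamma> - 0) / 2 * ln q + ?mix"
    by (rule Lim_transform_eventually)
  moreover have "L * \<gamma> + \<gamma> * (\<gamma> - 0) / 2 * ln q + ?mix < 0"
  proof -
    have "?mix \<le> \<gamma>\<^sup>2 * b\<^sup>2 / 2 * (triangle_gain \<eta> (b * \<gamma> / \<sigma>) + 33 * a\<^sup>2 * b\<^sup>2)"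
      using \<open>0 < \<sigma>\<close> by (intro mixture_exponent_le_triangle_gain[OF mixture nonzero]) simp
    from le_less_trans[OF add_left_mono[OF this] rate(2)] show ?thesis
      by (simp only: power2_eq_square diff_zero)
  qed
  ultimately have "\<forall>\<^sub>F l in sequentially. exp (X l) < \<delta>"
    using \<open>0 < \<delta>\<close> by (rule eventually_exp_less)
  moreover have "exp (X l) = exp (L * real l) ^ k l * (q ^ (k l choose 2) * exp (?ce l))" for l
  proof -
    have "q ^ (k l choose 2) = exp (real (k l choose 2) * ln q)"
      using \<open>0 < q\<close> by (simp add: exp_of_nat_mult)
    then show ?thesis by (simp add: X_def exp_add exp_of_nat2_mult real_choose_two)
  qed
  ultimately show ?thesis by simp
qed

lemma eventually_reserve:
  fixes k s :: "nat \<Rightarrow> real"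
  assumes size_limit: "(\<lambda>l. k l / l) \<longlonglongrightarrow> \<gamma>" and scale_limit: "(\<lambda>l. s l / l) \<longlonglongrightarrow> \<sigma>" and "0 < \<sigma>" "0 < \<eta>"
    and mixture: "edge_mixture \<eta> \<kappa> a \<tau>" and subcritical: "subcritical \<eta> a \<tau> \<sigma> L q b \<gamma>"
  defines "\<alpha> \<equiv> \<lambda>l. 16 * (a * b\<^sup>2)\<^sup>2 * k l / (s l)\<^sup>2"
  shows "\<forall>\<^sub>F l in sequentially. - 1 \<le> b / s l * k l \<and> b / s l * k l < 1 \<and>
    \<alpha> l \<le> a * b\<^sup>2 \<and> \<alpha> l \<le> \<eta> / 6 * b\<^sup>2 \<and> \<alpha> l * (2 * s l) \<le> \<tau> * \<bar>b\<bar>"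
proof -
  have params: "0 < a" "0 < \<tau>" "b \<noteq> 0" "\<bar>b * (\<gamma> / \<sigma>)\<bar> < 1" "32 * a\<^sup>2 * b\<^sup>2 * \<bar>b * (\<gamma> / \<sigma>)\<bar> < \<tau>" "0 < \<gamma>"
    using mixture subcritical by (auto simp: edge_mixture_def subcritical_def)
  have "(\<lambda>l. (k l / l) / (s l / l)) \<longlonglongrightarrow> \<gamma> / \<sigma>"
    using \<open>0 < \<sigma>\<close> by (intro tendsto_divide size_limit scale_limit) auto
  moreover have "\<forall>\<^sub>F l in sequentially. (k l / l) / (s l / l) = k l / s l"
    using eventually_gt_at_top[of 0] by eventually_elim auto
  ultimately have ratio: "(\<lambda>l. k l / s l) \<longlonglongrightarrow> \<gamma> / \<sigma>" by (rule Lim_transform_eventually)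
  have "(\<lambda>l. (k l / l) / (s l / l)\<^sup>2 * (1 / real l)) \<longlonglongrightarrow> \<gamma> / \<sigma>\<^sup>2 * 0"
    using \<open>0 < \<sigma>\<close> by (intro tendsto_intros size_limit scale_limit lim_1_over_n) auto
  moreover have "\<forall>\<^sub>F l in sequentially. (k l / l) / (s l / l)\<^sup>2 * (1 / real l) = k l / (s l)\<^sup>2"
    using eventually_gt_at_top[of 0] by eventually_elim (simp add: power2_eq_square)
  ultimately have ratio2: "(\<lambda>l. k l / (s l)\<^sup>2) \<longlonglongrightarrow> \<gamma> / \<sigma>\<^sup>2 * 0" by (rule Lim_transform_eventually)
  have slope: "(\<lambda>l. b * (k l / s l)) \<longlonglongrightarrow> b * (\<gamma> / \<sigma>)" by (intro tendsto_intros ratio)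
  have alpha_limit: "(\<lambda>l. 16 * (a * b\<^sup>2)\<^sup>2 * (k l / (s l)\<^sup>2)) \<longlonglongrightarrow> 16 * (a * b\<^sup>2)\<^sup>2 * (\<gamma> / \<sigma>\<^sup>2 * 0)"
    by (intro tendsto_intros ratio2)
  have alpha_scale_limit: "(\<lambda>l. 32 * (a * b\<^sup>2)\<^sup>2 * (k l / s l)) \<longlonglongrightarrow> 32 * (a * b\<^sup>2)\<^sup>2 * (\<gamma> / \<sigma>)"
    by (intro tendsto_intros ratio)
  have "32 * (a * b\<^sup>2)\<^sup>2 * (\<gamma> / \<sigma>) = 32 * a\<^sup>2 * b\<^sup>2 * \<bar>b * (\<gamma> / \<sigma>)\<bar> * \<bar>b\<bar>"
    using params \<open>0 < \<sigma>\<close> by (simp add: abs_mult power_mult_distrib power2_eq_square mult_ac)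
  also have "\<dots> < \<tau> * \<bar>b\<bar>" using params by (intro mult_strict_right_mono) auto
  finally have "\<forall>\<^sub>F l in sequentially. 32 * (a * b\<^sup>2)\<^sup>2 * (k l / s l) < \<tau> * \<bar>b\<bar>"
    by (rule order_tendstoD(2)[OF alpha_scale_limit])
  moreover have "\<forall>\<^sub>F l in sequentially. 16 * (a * b\<^sup>2)\<^sup>2 * (k l / (s l)\<^sup>2) < a * b\<^sup>2"
    using params by (intro order_tendstoD(2)[OF alpha_limit]) auto
  moreover have "\<forall>\<^sub>F l in sequentially. 16 * (a * b\<^sup>2)\<^sup>2 * (k l / (s l)\<^sup>2) < \<eta> / 6 * b\<^sup>2"
    using params \<open>0 < \<eta>\<close> by (intro order_tendstoD(2)[OF alpha_limit]) auto
  moreover have "\<forall>\<^sub>F l in sequentially. - 1 < b * (k l / s l)" "\<forall>\<^sub>F l in sequentially. b * (k l / s l) < 1"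
    using params(4) unfolding abs_less_iff by (intro order_tendstoD[OF slope]; simp)+
  ultimately show ?thesis
    by eventually_elim (auto simp: \<alpha>_def params less_imp_le power2_eq_square)
qed

definition latent_dim :: "real \<Rightarrow> nat \<Rightarrow> nat" where
  "latent_dim \<sigma> l = nat \<lceil>(\<sigma> * real l)\<^sup>2\<rceil>"

lemma tendsto_sqrt_latent_dim:
  assumes "0 < \<sigma>"
  shows "(\<lambda>l. sqrt (real (latent_dim \<sigma> l)) / l) \<longlonglongrightarrow> \<sigma>"
  unfolding latent_dim_def using assms by real_asymp

lemma eventually_almost_gaussian_kernel:
  assumes "0 < \<eta>" "\<eta> \<le> 1" "0 < \<sigma>"
  shows "\<forall>\<^sub>F l in sequentially. almost_gaussian_kernel (shell_measure (latent_dim \<sigma> l) \<eta>)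
    (shell_kernel (latent_dim \<sigma> l)) (sqrt (real (latent_dim \<sigma> l))) \<eta>"
proof -
  have "\<forall>\<^sub>F l in sequentially. 32 \<le> \<eta>\<^sup>2 * (\<sigma> * real l)\<^sup>2" using assms by real_asymp
  then show ?thesis
  proof eventually_elim
    case (elim l)
    have "(\<sigma> * real l)\<^sup>2 \<le> real (latent_dim \<sigma> l)" unfolding latent_dim_def by linarith
    then have "\<eta>\<^sup>2 * (\<sigma> * real l)\<^sup>2 \<le> \<eta>\<^sup>2 * real (latent_dim \<sigma> l)" by (intro mult_left_mono) auto
    then have "32 \<le> \<eta>\<^sup>2 * real (latent_dim \<sigma> l)" using elim by linarith
    then show ?case using assms by (intro almost_gaussian_kernel_shell)
  qed
qed

lemma eventually_nn_integral_soft_clique_le: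
  fixes k :: "nat \<Rightarrow> nat"
  assumes size_limit: "(\<lambda>l. real (k l) / l) \<longlonglongrightarrow> \<gamma>" and "0 < \<eta>" "\<eta> \<le> 1" "0 < \<sigma>"
    and mixture: "edge_mixture \<eta> \<kappa> a \<tau>" and subcritical: "subcritical \<eta> a \<tau> \<sigma> L q b \<gamma>"
  shows "\<forall>\<^sub>F l in sequentially. \<forall>S :: nat set. finite S \<longrightarrow> card S = k l \<longrightarrow>
    (\<integral>\<^sup>+x. ennreal (\<Prod>(i,j)\<in>pairs S. max 0 (1 + b * shell_kernel (latent_dim \<sigma> l) (x i) (x j)))
        \<partial>Pi\<^sub>M S (\<lambda>_. shell_measure (latent_dim \<sigma> l) \<eta>))
    \<le> ennreal (exp (clique_exponent \<eta> \<kappa> (a * b\<^sup>2) b (sqrt (real (latent_dim \<sigma> l))) (real (k l))))"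
  using eventually_almost_gaussian_kernel[OF assms(2-4)]
    eventually_reserve[OF size_limit tendsto_sqrt_latent_dim[OF \<open>0 < \<sigma>\<close>] \<open>0 < \<sigma>\<close> \<open>0 < \<eta>\<close> mixture subcritical]
proof eventually_elim
  case (elim l)
  interpret almost_gaussian_kernel "shell_measure (latent_dim \<sigma> l) \<eta>" "shell_kernel (latent_dim \<sigma> l)"
    "sqrt (real (latent_dim \<sigma> l))" \<eta> by (rule elim(1))
  show ?case
  proof (intro allI impI)
    fix S :: "nat set" assume clique_size: "finite S" "card S = k l"
    show "(\<integral>\<^sup>+x. ennreal (\<Prod>(i,j)\<in>pairs S. max 0 (1 + b * shell_kernel (latent_dim \<sigma> l) (x i) (x j)))
        \<partial>Pi\<^sub>M S (\<lambda>_. shell_measure (latent_dim \<sigma> l) \<eta>))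
      \<le> ennreal (exp (clique_exponent \<eta> \<kappa> (a * b\<^sup>2) b (sqrt (real (latent_dim \<sigma> l))) (real (k l))))"
      unfolding clique_size(2)[symmetric]
      by (rule nn_integral_soft_clique_le_exponent[OF clique_size(1) mixture])
        (use elim(2) in \<open>simp_all only: clique_size(2)\<close>)
  qed
qed

lemma eventually_exp_le_ramsey_number:
  fixes k :: "nat \<Rightarrow> nat"
  assumes size_limit: "(\<lambda>l. real (k l) / l) \<longlonglongrightarrow> \<gamma>" and q_range: "0 < q" "q < 1"
    and eta_range: "0 < \<eta>" "\<eta> < 1" and sigma_pos: "0 < \<sigma>"
    and mixture: "edge_mixture \<eta> \<kappa> a \<tau>"
    and red: "subcritical \<eta> a \<tau> \<sigma> L q (- t) 1"
    and blue: "subcritical \<eta> a \<tau> \<sigma> L (1 - q) (q * t / (1 - q)) \<gamma>"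
  shows "\<forall>\<^sub>F l in sequentially. exp (L * real l) \<le> real (ramsey_number l (k l))"
proof -
  have red_size_limit: "(\<lambda>l. real l / l) \<longlonglongrightarrow> 1" by real_asymp
  have scale_limit: "(\<lambda>l. sqrt (real (latent_dim \<sigma> l)) / l) \<longlonglongrightarrow> \<sigma>"
    by (rule tendsto_sqrt_latent_dim[OF sigma_pos])
  have "0 < 1 - q" "0 < (1/2 :: real)" "\<eta> \<le> 1" using q_range eta_range by auto
  note weights = eventually_clique_weight_less[OF red_size_limit scale_limit sigma_pos q_range(1) this(2) mixture red]
    eventually_clique_weight_less[OF size_limit scale_limit sigma_pos this(1,2) mixture blue]
  note integrals = eventually_nn_integral_soft_clique_le[OF red_size_limit eta_range(1) \<open>\<eta> \<le> 1\<close> sigma_pos mixture red]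
    eventually_nn_integral_soft_clique_le[OF size_limit eta_range(1) \<open>\<eta> \<le> 1\<close> sigma_pos mixture blue]
  from weights integrals eventually_almost_gaussian_kernel[OF eta_range(1) \<open>\<eta> \<le> 1\<close> sigma_pos] show ?thesis
  proof eventually_elim
    case (elim l)
    interpret almost_gaussian_kernel "shell_measure (latent_dim \<sigma> l) \<eta>" "shell_kernel (latent_dim \<sigma> l)"
      "sqrt (real (latent_dim \<sigma> l))" \<eta> by (rule elim(5))
    define n where "n = nat \<lfloor>exp (L * real l)\<rfloor>"
    have floor_bounds: "real n \<le> exp (L * real l)" "exp (L * real l) < real n + 1"
      unfolding n_def by (simp add: of_nat_nat) linarith
    have weight: "real n ^ j * x < 1/2" if "exp (L * real l) ^ j * x < 1/2" "0 \<le> x" for j x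
    proof -
      have "real n ^ j * x \<le> exp (L * real l) ^ j * x"
        using that(2) floor_bounds(1) by (intro mult_right_mono power_mono) auto
      then show ?thesis using that(1) by linarith
    qed
    have "\<not> ramsey_prop l (k l) n"
    proof (rule not_ramsey_prop_soft[OF q_range _ _ elim(3)[rule_format] elim(4)[rule_format]])
      show "real n ^ l * (q ^ (l choose 2) * exp (clique_exponent \<eta> \<kappa> (a * (- t)\<^sup>2) (- t) (sqrt (real (latent_dim \<sigma> l))) (real l)))
          + real n ^ k l * ((1 - q) ^ (k l choose 2) * exp (clique_exponent \<eta> \<kappa> (a * (q * t / (1 - q))\<^sup>2) (q * t / (1 - q))
              (sqrt (real (latent_dim \<sigma> l))) (real (k l)))) < 1"
        using weight[OF elim(1)] weight[OF elim(2)] q_range by simp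
    qed auto
    then have "n < ramsey_number l (k l)" by (rule less_ramsey_number)
    then have "real n + 1 \<le> real (ramsey_number l (k l))" by linarith
    then show ?case using floor_bounds by linarith
  qed
qed

section \<open>Choice of the parameters\<close>

lemma log_ratio_times_square_less:
  fixes p :: real
  assumes "0 < p" "p < 1/2"
  shows "ln p / ln (1 - p) * p\<^sup>2 < (1 - p)\<^sup>2"
proof -
  define K where "K = (\<lambda>x::real. 1 / x + 1 / (1 - x) + ln (1 - x) / x\<^sup>2)"
  have "K p < K (1 - p)"
  proof (rule DERIV_pos_imp_increasing[of p "1 - p" K])
    fix x :: real assume "p \<le> x" "x \<le> 1 - p"
    then have x_range: "0 < x" "x < 1" using assms by auto
    define D where "D = - 1 / x\<^sup>2 + 1 / (1 - x)\<^sup>2 + ((- 1 / (1 - x)) * x\<^sup>2 - ln (1 - x) * (2 * x)) / (x\<^sup>2 * x\<^sup>2)"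
    have "(K has_real_derivative D) (at x)"
      unfolding K_def D_def using x_range
      by (auto intro!: derivative_eq_intros simp: power2_eq_square)
    moreover have "0 < D"
    proof -
      have "x ^ 4 / (1 - x)\<^sup>2 = x\<^sup>2 + x ^ 3 / (1 - x)\<^sup>2 - x\<^sup>2 / (1 - x)"
      proof -
        have "x\<^sup>2 * (1 - x)\<^sup>2 + x ^ 3 - x\<^sup>2 * (1 - x) = x ^ 4"
          by (simp add: power2_eq_square power3_eq_cube power4_eq_xxxx algebra_simps)
        moreover have "x\<^sup>2 * (1 - x) / (1 - x)\<^sup>2 = x\<^sup>2 / (1 - x)" "x\<^sup>2 * (1 - x)\<^sup>2 / (1 - x)\<^sup>2 = x\<^sup>2"
          using x_range by (simp_all add: power2_eq_square)
        ultimately show ?thesis by (metis add_divide_distrib diff_divide_distrib)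
      qed
      also have "\<dots> \<le> - x + x ^ 3 / (1 - x)\<^sup>2 - x / (1 - x) - 2 * ln (1 - x)"
      proof -
        have "ln (1 - x) \<le> - x - x\<^sup>2 / 2 - x ^ 3 / 3"
          using ln_one_plus_le_cubic[of "- x"] x_range by simp
        moreover have "0 \<le> x ^ 3" using x_range by simp
        moreover have "x / (1 - x) = x + x\<^sup>2 / (1 - x)"
          using x_range by (simp add: field_simps power2_eq_square)
        ultimately show ?thesis by linarith
      qed
      also have "\<dots> = x ^ 3 * D"
        using x_range by (simp add: D_def field_simps power2_eq_square power3_eq_cube)
      finally have "x ^ 4 / (1 - x)\<^sup>2 \<le> x ^ 3 * D" .
      moreover have "0 < x ^ 4 / (1 - x)\<^sup>2" using x_range by simp
      ultimately have "0 < x ^ 3 * D" by linarith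
      then show ?thesis using x_range by (simp add: zero_less_mult_iff)
    qed
    ultimately show "\<exists>y. (K has_real_derivative y) (at x) \<and> 0 < y" by blast
  qed (use assms in simp)
  then have "ln (1 - p) / p\<^sup>2 < ln p / (1 - p)\<^sup>2" by (simp add: K_def)
  then have "ln (1 - p) * (1 - p)\<^sup>2 < ln p * p\<^sup>2"
    using assms by (simp add: divide_less_eq less_divide_eq field_simps)
  then show ?thesis using assms by (simp add: divide_less_eq mult.commute)
qed

lemma tendsto_triangle_gain_over:
  assumes "c \<noteq> 0"
  shows "((\<lambda>\<rho>. triangle_gain (\<rho>\<^sup>2) (c * \<rho>) / \<rho>) \<longlongrightarrow> c / 3) (at_right 0)"
proof -
  define f where "f = (\<lambda>v::real. (slope_cost v - v\<^sup>2 / 2) / v ^ 3)"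
  have "(f \<longlongrightarrow> 1 / 3) (at 0)" unfolding f_def slope_cost_def by real_asymp
  moreover have "filterlim (\<lambda>\<rho>. c * \<rho>) (at 0) (at_right 0)" using assms by real_asymp
  ultimately have "((\<lambda>\<rho>. f (c * \<rho>)) \<longlongrightarrow> 1 / 3) (at_right 0)" by (rule filterlim_compose)
  then have "((\<lambda>\<rho>. (1 + \<rho>\<^sup>2) * c * f (c * \<rho>) + (3 * \<rho> - \<rho> ^ 3) / 2) \<longlongrightarrow> (1 + 0\<^sup>2) * c * (1 / 3) + (3 * 0 - 0 ^ 3) / 2) (at_right 0)"
    by (intro tendsto_intros) auto
  then have "((\<lambda>\<rho>. (1 + \<rho>\<^sup>2) * c * f (c * \<rho>) + (3 * \<rho> - \<rho> ^ 3) / 2) \<longlongrightarrow> c / 3) (at_right 0)" by simp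
  moreover have "\<forall>\<^sub>F \<rho> in at_right 0.
      (1 + \<rho>\<^sup>2) * c * f (c * \<rho>) + (3 * \<rho> - \<rho> ^ 3) / 2 = triangle_gain (\<rho>\<^sup>2) (c * \<rho>) / \<rho>"
    using eventually_at_right_less
  proof eventually_elim
    case (elim \<rho>)
    define v where "v = c * \<rho>"
    have "v \<noteq> 0" using assms elim by (simp add: v_def)
    then have "slope_cost v / v\<^sup>2 = 1/2 + v * f v"
      by (simp add: f_def power2_eq_square power3_eq_cube field_simps)
    then have "triangle_gain (\<rho>\<^sup>2) v = (1 + \<rho>\<^sup>2) * (1/2 + v * f v) - (1 - \<rho>\<^sup>2)\<^sup>2 / 2"
      by (simp add: triangle_gain_def times_divide_eq_right[symmetric] del: times_divide_eq_right)
    also have "\<dots> = ((1 + \<rho>\<^sup>2) * c * f v + (3 * \<rho> - \<rho> ^ 3) / 2) * \<rho>"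
      by (simp add: v_def power2_eq_square power3_eq_cube field_simps)
    finally show ?case using elim by (simp add: v_def)
  qed
  ultimately show ?thesis by (rule Lim_transform_eventually)
qed

text \<open>
  To second order in \<open>t\<close>, raising the red density from \<open>p\<close> to \<open>p * (1 + 2 * t\<^sup>2 * x)\<close> costs \<open>x\<close> for red
  and gains \<open>C * r * x\<close> for blue, where \<open>r = p / (1 - p)\<close>. The triangles gain \<open>\<rho> / 6\<close> for red and cost
  \<open>C * r * (C * r\<^sup>2) * \<rho> / 6\<close> for blue, and \<open>y\<close> is the gain in the number of vertices.
\<close>

lemma exists_balanced_rates:
  fixes C r :: real
  assumes "0 < C" "0 < r" "C * r\<^sup>2 < 1"
  obtains \<rho> x y where "0 < \<rho>" "\<rho> < 1" "C * \<rho> < 1" "0 < x" "0 < y"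
    "y + x + triangle_gain (\<rho>\<^sup>2) (- \<rho>) / 2 < 0"
    "y - C * r * x + C * r\<^sup>2 / 2 * triangle_gain (\<rho>\<^sup>2) (r * C * \<rho>) < 0"
proof -
  define \<delta> where "\<delta> = (1 - C * r\<^sup>2) / 12"
  define \<xi> where "\<xi> = (1 + C * r\<^sup>2) / 12"
  define \<nu> where "\<nu> = min \<delta> (C * r * \<delta>) / 2"
  have pos: "0 < \<delta>" "0 < \<xi>" "0 < \<nu>" "\<nu> < \<delta>" "\<nu> < C * r * \<delta>"
    using assms by (auto simp: \<delta>_def \<xi>_def \<nu>_def min_def add_pos_pos)
  have "((\<lambda>\<rho>. \<nu> + \<xi> + triangle_gain (\<rho>\<^sup>2) (- 1 * \<rho>) / \<rho> / 2) \<longlongrightarrow> \<nu> + \<xi> + (- 1) / 3 / 2) (at_right 0)"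
    by (intro tendsto_intros tendsto_triangle_gain_over) auto
  moreover have "\<nu> + \<xi> + (- 1) / 3 / 2 < 0" using pos by (simp add: \<delta>_def \<xi>_def field_simps)
  ultimately have red: "\<forall>\<^sub>F \<rho> in at_right 0. \<nu> + \<xi> + triangle_gain (\<rho>\<^sup>2) (- 1 * \<rho>) / \<rho> / 2 < 0"
    by (rule order_tendstoD)
  have "((\<lambda>\<rho>. \<nu> - C * r * \<xi> + C * r\<^sup>2 / 2 * (triangle_gain (\<rho>\<^sup>2) (r * C * \<rho>) / \<rho>))
      \<longlongrightarrow> \<nu> - C * r * \<xi> + C * r\<^sup>2 / 2 * (r * C / 3)) (at_right 0)"
    using assms by (intro tendsto_intros tendsto_triangle_gain_over) auto
  moreover have "\<nu> - C * r * \<xi> + C * r\<^sup>2 / 2 * (r * C / 3) = \<nu> - C * r * \<delta>"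
    by (simp add: \<delta>_def \<xi>_def power2_eq_square field_simps)
  ultimately have blue: "\<forall>\<^sub>F \<rho> in at_right 0. \<nu> - C * r * \<xi> + C * r\<^sup>2 / 2 * (triangle_gain (\<rho>\<^sup>2) (r * C * \<rho>) / \<rho>) < 0"
    using pos by (intro order_tendstoD(2)) auto
  have "\<forall>\<^sub>F \<rho>::real in at_right 0. 0 < \<rho> \<and> \<rho> < 1 \<and> C * \<rho> < 1"
    using assms(1) by (intro eventually_conj; real_asymp)
  with red blue have "\<forall>\<^sub>F \<rho>::real in at_right 0. thesis"
  proof eventually_elim
    case (elim \<rho>)
    then have rho_range: "0 < \<rho>" "\<rho> < 1" "C * \<rho> < 1" by auto
    show ?case
    proof (rule that[OF rho_range, of "\<xi> * \<rho>" "\<nu> * \<rho>"])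
      show "\<nu> * \<rho> + \<xi> * \<rho> + triangle_gain (\<rho>\<^sup>2) (- \<rho>) / 2 < 0"
        using mult_neg_pos[OF elim(1) rho_range(1)] rho_range(1) by (simp add: algebra_simps)
      show "\<nu> * \<rho> - C * r * (\<xi> * \<rho>) + C * r\<^sup>2 / 2 * triangle_gain (\<rho>\<^sup>2) (r * C * \<rho>) < 0"
        using mult_neg_pos[OF elim(2) rho_range(1)] rho_range(1) by (simp add: algebra_simps)
    qed (use pos rho_range in auto)
  qed
  then show thesis by simp
qed

lemma subcritical_red:
  fixes p t x y \<rho> :: real
  assumes "0 < p" "0 < t" "0 \<le> x" "0 < \<rho>" "\<rho> < 1" "32 * a\<^sup>2 * t\<^sup>2 < \<tau>"
    and rate: "y + x + (triangle_gain \<eta> (- \<rho>) + 33 * a\<^sup>2 * t\<^sup>2) / 2 < 0"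
  shows "subcritical \<eta> a \<tau> (t / \<rho>) (- ln p / 2 + t\<^sup>2 * y) (p * (1 + 2 * t\<^sup>2 * x)) (- t) 1"
proof -
  define E where "E = triangle_gain \<eta> (- \<rho>) + 33 * a\<^sup>2 * t\<^sup>2"
  have slope_ratio: "- t * 1 / (t / \<rho>) = - \<rho>" using assms by simp
  have "32 * a\<^sup>2 * t\<^sup>2 * \<rho> \<le> 32 * a\<^sup>2 * t\<^sup>2 * 1" using assms by (intro mult_left_mono) auto
  then have reserve: "32 * a\<^sup>2 * t\<^sup>2 * \<rho> < \<tau>" using assms by simp
  have "0 < 1 + 2 * t\<^sup>2 * x" using assms(3) by (simp add: add_pos_nonneg)
  then have "ln (p * (1 + 2 * t\<^sup>2 * x)) \<le> ln p + 2 * t\<^sup>2 * x"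
    using \<open>0 < p\<close> ln_le_minus_one[of "1 + 2 * t\<^sup>2 * x"] by (simp add: ln_mult)
  then have "- ln p / 2 + t\<^sup>2 * y + ln (p * (1 + 2 * t\<^sup>2 * x)) / 2 + t\<^sup>2 / 2 * E \<le> t\<^sup>2 * (y + x + E / 2)"
    by (simp add: algebra_simps add_divide_distrib)
  also have "\<dots> < 0" using rate assms(2) by (intro mult_pos_neg) (auto simp: E_def)
  finally show ?thesis
    unfolding subcritical_def slope_ratio using assms reserve by (simp add: E_def)
qed

lemma subcritical_blue:
  fixes C p t x y \<rho> :: real
  defines "q \<equiv> p * (1 + 2 * t\<^sup>2 * x)"
  defines "R \<equiv> q / (1 - q)"
  assumes p_balanced: "0 < p" "p < 1" "C * ln (1 - p) = ln p" and pos: "0 < C" "0 < t" "0 < \<rho>" "0 \<le> x"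
    and "q < 1/2" and C_rho_less: "C * \<rho> < 1" and "32 * a\<^sup>2 * t\<^sup>2 < \<tau>"
    and rate: "y - C * (p / (1 - p)) * x + C * R\<^sup>2 / 2 * (triangle_gain \<eta> (R * C * \<rho>) + 33 * a\<^sup>2 * (R * t)\<^sup>2) < 0"
  shows "subcritical \<eta> a \<tau> (t / \<rho>) (- ln p / 2 + t\<^sup>2 * y) (1 - q) (q * t / (1 - q)) C"
proof -
  define E where "E = triangle_gain \<eta> (R * C * \<rho>) + 33 * a\<^sup>2 * (R * t)\<^sup>2"
  define r where "r = p / (1 - p)"
  have "0 < q" using p_balanced(1) pos(4) by (simp add: q_def add_pos_nonneg)
  then have R_range: "0 < R" "R < 1" using \<open>q < 1/2\<close> by (auto simp: R_def)
  have slope: "q * t / (1 - q) = R * t" by (simp add: R_def)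
  have slope_ratio: "R * t * C / (t / \<rho>) = R * C * \<rho>" using pos by simp
  have "R * (C * \<rho>) < 1 * 1" using R_range pos C_rho_less by (intro mult_strict_mono) auto
  then have v_range: "0 < R * C * \<rho>" "R * C * \<rho> < 1" using R_range pos by (simp_all add: mult.assoc)
  have "(R * t)\<^sup>2 \<le> t\<^sup>2" using R_range pos by (intro power_mono) (auto simp: mult_left_le_one_le)
  then have "32 * a\<^sup>2 * (R * t)\<^sup>2 * (R * C * \<rho>) \<le> 32 * a\<^sup>2 * t\<^sup>2 * 1"
    using v_range by (intro mult_mono mult_left_mono) auto
  then have reserve: "32 * a\<^sup>2 * (R * t)\<^sup>2 * (R * C * \<rho>) < \<tau>" using \<open>32 * a\<^sup>2 * t\<^sup>2 < \<tau>\<close> by linarith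
  have factor: "1 - q = (1 - p) * (1 + - (2 * t\<^sup>2 * (r * x)))"
    using p_balanced by (simp add: q_def r_def field_simps)
  have "0 < 1 + - (2 * t\<^sup>2 * (r * x))"
    using \<open>q < 1/2\<close> p_balanced(2) factor zero_less_mult_pos[of "1 - p" "1 + - (2 * t\<^sup>2 * (r * x))"]
    by simp
  then have "ln (1 - q) \<le> ln (1 - p) - 2 * t\<^sup>2 * (r * x)"
    using p_balanced(2) ln_le_minus_one[of "1 + - (2 * t\<^sup>2 * (r * x))"]
    unfolding factor by (simp add: ln_mult)
  then have "C\<^sup>2 / 2 * ln (1 - q) \<le> C\<^sup>2 / 2 * (ln (1 - p) - 2 * t\<^sup>2 * (r * x))"
    by (rule mult_left_mono) simp
  also have "\<dots> = C / 2 * (C * ln (1 - p)) - C\<^sup>2 * t\<^sup>2 * (r * x)"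
    by (simp add: power2_eq_square algebra_simps)
  finally have "(- ln p / 2 + t\<^sup>2 * y) * C + C\<^sup>2 / 2 * ln (1 - q) + C\<^sup>2 * (R * t)\<^sup>2 / 2 * E
      \<le> C * t\<^sup>2 * (y - C * r * x + C * R\<^sup>2 / 2 * E)"
    unfolding p_balanced(3) by (simp add: power2_eq_square algebra_simps)
  also have "\<dots> < 0" using rate pos by (intro mult_pos_neg) (auto simp: E_def r_def)
  finally show ?thesis
    unfolding subcritical_def slope slope_ratio
    using R_range v_range reserve pos by (simp add: E_def)
qed

lemma exists_small_slope:
  fixes p r C x y \<rho> :: real
  defines "P \<equiv> \<lambda>t. p * (1 + 2 * t\<^sup>2 * x)"
  defines "R \<equiv> \<lambda>t. P t / (1 - P t)"
  assumes "0 < p" "p < 1/2" "0 < C" "0 < \<rho>" "C * \<rho> < 1" "0 < \<tau>"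
    and red: "y + x + triangle_gain \<eta> (- \<rho>) / 2 < 0"
    and blue: "y - C * (p / (1 - p)) * x + C * (p / (1 - p))\<^sup>2 / 2 * triangle_gain \<eta> (p / (1 - p) * C * \<rho>) < 0"
  obtains t where "0 < t" "P t < 1/2" "32 * a\<^sup>2 * t\<^sup>2 < \<tau>"
    "y + x + (triangle_gain \<eta> (- \<rho>) + 33 * a\<^sup>2 * t\<^sup>2) / 2 < 0"
    "y - C * (p / (1 - p)) * x + C * (R t)\<^sup>2 / 2 * (triangle_gain \<eta> (R t * C * \<rho>) + 33 * a\<^sup>2 * (R t * t)\<^sup>2) < 0"
proof -
  define r where "r = p / (1 - p)"
  have r_range: "0 < r" "r < 1" using assms(3,4) by (auto simp: r_def)
  then have "r * (C * \<rho>) < 1 * 1" using assms by (intro mult_strict_mono) auto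
  then have slope_less: "r * C * \<rho> < 1" by (simp add: mult.assoc)
  have t_limit: "((\<lambda>t. t) \<longlongrightarrow> 0) (at_right (0::real))" by (rule tendsto_ident_at)
  have P_limit: "(P \<longlongrightarrow> p * (1 + 2 * 0\<^sup>2 * x)) (at_right 0)"
    unfolding P_def by (intro tendsto_intros t_limit)
  then have R_limit: "(R \<longlongrightarrow> r) (at_right 0)"
    unfolding R_def r_def using assms(3,4) by (auto intro!: tendsto_intros)
  have "((\<lambda>t. 32 * a\<^sup>2 * t\<^sup>2) \<longlongrightarrow> 32 * a\<^sup>2 * 0\<^sup>2) (at_right 0)"
    "((\<lambda>t. y + x + (triangle_gain \<eta> (- \<rho>) + 33 * a\<^sup>2 * t\<^sup>2) / 2)
        \<longlongrightarrow> y + x + (triangle_gain \<eta> (- \<rho>) + 33 * a\<^sup>2 * 0\<^sup>2) / 2) (at_right 0)"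
    "((\<lambda>t. y - C * r * x + C * (R t)\<^sup>2 / 2 * (triangle_gain \<eta> (R t * C * \<rho>) + 33 * a\<^sup>2 * (R t * t)\<^sup>2))
        \<longlongrightarrow> y - C * r * x + C * r\<^sup>2 / 2 * (triangle_gain \<eta> (r * C * \<rho>) + 33 * a\<^sup>2 * (r * 0)\<^sup>2)) (at_right 0)"
    unfolding triangle_gain_def slope_cost_def
    using r_range slope_less assms(5,6) by (intro tendsto_intros R_limit t_limit; simp)+
  note limits = P_limit this
  have "\<forall>\<^sub>F t in at_right 0. P t < 1/2 \<and> 32 * a\<^sup>2 * t\<^sup>2 < \<tau>
      \<and> y + x + (triangle_gain \<eta> (- \<rho>) + 33 * a\<^sup>2 * t\<^sup>2) / 2 < 0
      \<and> y - C * r * x + C * (R t)\<^sup>2 / 2 * (triangle_gain \<eta> (R t * C * \<rho>) + 33 * a\<^sup>2 * (R t * t)\<^sup>2) < 0 \<and> 0 < t"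
    using assms red blue eventually_at_right_less
    by (intro eventually_conj limits[THEN order_tendstoD(2)]) (auto simp: r_def)
  then obtain t where "P t < 1/2 \<and> 32 * a\<^sup>2 * t\<^sup>2 < \<tau>
      \<and> y + x + (triangle_gain \<eta> (- \<rho>) + 33 * a\<^sup>2 * t\<^sup>2) / 2 < 0
      \<and> y - C * r * x + C * (R t)\<^sup>2 / 2 * (triangle_gain \<eta> (R t * C * \<rho>) + 33 * a\<^sup>2 * (R t * t)\<^sup>2) < 0 \<and> 0 < t"
    using eventually_happens'[OF trivial_limit_at_right_real] by blast
  then show thesis using that unfolding r_def by blast
qed

lemma exists_subcritical:
  fixes C p :: real
  assumes "0 < C" "0 < p" "p < 1/2" "C * ln (1 - p) = ln p"
  obtains q t \<eta> \<kappa> a \<tau> \<sigma> L where "0 < q" "q < 1" "0 < \<eta>" "\<eta> < 1" "0 < \<sigma>" "edge_mixture \<eta> \<kappa> a \<tau>"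
    "subcritical \<eta> a \<tau> \<sigma> L q (- t) 1" "subcritical \<eta> a \<tau> \<sigma> L (1 - q) (q * t / (1 - q)) C"
    "- ln p / 2 < L"
proof -
  define r where "r = p / (1 - p)"
  have "C = ln p / ln (1 - p)" using assms by (simp add: field_simps)
  then have "C * p\<^sup>2 < (1 - p)\<^sup>2" using log_ratio_times_square_less[OF assms(2,3)] by simp
  then have "0 < r" "C * r\<^sup>2 < 1" using assms by (auto simp: r_def power_divide)
  then obtain \<rho> x y where rho_range: "0 < \<rho>" "\<rho> < 1" "C * \<rho> < 1" and rates_pos: "0 < x" "0 < y"
    and rates: "y + x + triangle_gain (\<rho>\<^sup>2) (- \<rho>) / 2 < 0"
      "y - C * r * x + C * r\<^sup>2 / 2 * triangle_gain (\<rho>\<^sup>2) (r * C * \<rho>) < 0"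
    by (rule exists_balanced_rates[OF assms(1)])
  have eta_range: "0 < \<rho>\<^sup>2" "\<rho>\<^sup>2 < 1" using rho_range by (auto simp: power_less_one_iff)
  then obtain \<kappa> a \<tau> where mixture: "edge_mixture (\<rho>\<^sup>2) \<kappa> a \<tau>" using exists_edge_mixture by blast
  then have "0 < \<tau>" by (simp add: edge_mixture_def)
  obtain t where t_small: "0 < t" "p * (1 + 2 * t\<^sup>2 * x) < 1/2" "32 * a\<^sup>2 * t\<^sup>2 < \<tau>"
    and red: "y + x + (triangle_gain (\<rho>\<^sup>2) (- \<rho>) + 33 * a\<^sup>2 * t\<^sup>2) / 2 < 0"
    and blue: "y - C * (p / (1 - p)) * x + C * (p * (1 + 2 * t\<^sup>2 * x) / (1 - p * (1 + 2 * t\<^sup>2 * x)))\<^sup>2 / 2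
        * (triangle_gain (\<rho>\<^sup>2) (p * (1 + 2 * t\<^sup>2 * x) / (1 - p * (1 + 2 * t\<^sup>2 * x)) * C * \<rho>)
          + 33 * a\<^sup>2 * (p * (1 + 2 * t\<^sup>2 * x) / (1 - p * (1 + 2 * t\<^sup>2 * x)) * t)\<^sup>2) < 0"
    by (rule exists_small_slope[OF assms(2,3,1) rho_range(1,3) \<open>0 < \<tau>\<close> rates[unfolded r_def]])
  define q where "q = p * (1 + 2 * t\<^sup>2 * x)"
  have q_range: "0 < q" "q < 1"
    using t_small(2) rates_pos(1) assms(2) by (simp_all add: q_def add_pos_nonneg)
  have "subcritical (\<rho>\<^sup>2) a \<tau> (t / \<rho>) (- ln p / 2 + t\<^sup>2 * y) q (- t) 1"
    unfolding q_def
    using rates_pos assms(2) t_small rho_range by (intro subcritical_red red) simp_all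
  moreover have "subcritical (\<rho>\<^sup>2) a \<tau> (t / \<rho>) (- ln p / 2 + t\<^sup>2 * y) (1 - q) (q * t / (1 - q)) C"
    unfolding q_def
    using rates_pos assms t_small rho_range by (intro subcritical_blue blue) simp_all
  moreover have "0 < t / \<rho>" "- ln p / 2 < - ln p / 2 + t\<^sup>2 * y"
    using t_small(1) rho_range(1) rates_pos(2) by simp_all
  ultimately show thesis by (intro that[OF q_range eta_range _ mixture])
qed

theorem theorem1p1:
  fixes C p :: real
  assumes "C > 1" and "0 < p" and "p < 1/2" and "C = ln p / ln (1 - p)"
  shows "\<exists>\<epsilon>>0. \<forall>\<^sub>F l in sequentially.
           real (ramsey_number l (nat \<lfloor>C * real l\<rfloor>)) \<ge> (p powr (-1/2) + \<epsilon>) ^ l"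
proof -
  have "0 < C" using assms(1) by simp
  have "C * ln (1 - p) = ln p" using assms by simp
  then obtain q t \<eta> \<kappa> a \<tau> \<sigma> L where params: "0 < q" "q < 1" "0 < \<eta>" "\<eta> < 1" "0 < \<sigma>" "edge_mixture \<eta> \<kappa> a \<tau>"
      "subcritical \<eta> a \<tau> \<sigma> L q (- t) 1" "subcritical \<eta> a \<tau> \<sigma> L (1 - q) (q * t / (1 - q)) C"
    and L_greater: "- ln p / 2 < L"
    by (rule exists_subcritical[OF \<open>0 < C\<close> assms(2,3)])
  have "(\<lambda>l. real (nat \<lfloor>C * real l\<rfloor>) / real l) \<longlonglongrightarrow> C"
    using \<open>0 < C\<close> by real_asymp
  from eventually_exp_le_ramsey_number[OF this params]
  have "\<forall>\<^sub>F l in sequentially. (p powr (- 1/2) + (exp L - p powr (- 1/2))) ^ l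
      \<le> real (ramsey_number l (nat \<lfloor>C * real l\<rfloor>))"
    by (simp add: exp_of_nat2_mult)
  moreover have "0 < exp L - p powr (- 1/2)"
    using L_greater \<open>0 < p\<close> by (simp add: powr_def)
  ultimately show ?thesis by blast
qed

end
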